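(* Let $\mathbb{V}$ be a Danielewski variety. For $\delta=hD_{\mathbb{V}}$, where $h\in\mathbb{K}[y_2,\dots,y_m]$, we have $$\mathrm{Aut}(\delta)\cong\mathbb{G}_\delta\ltimes\mathbb{U}(D_{\mathbb{V}}).$$
   Context: $\mathbb{K}$ is an algebraically closed field of characteristic zero; $d,m,k_2,\dots,k_m$ are integers $\geqslant 2$. A Danielewski variety $\mathbb{V}\subseteq\mathbb{K}^{m+1}$ is an affine variety with coordinate ring $$\mathbb{K}[\mathbb{V}]=\mathbb{K}[Y_1,\dots,Y_m,Z]/(Y_1Y_2^{k_2}\cdots Y_m^{k_m}-P(Y_2,\dots,Y_m,Z)),$$ where $P=Z^d+s_{d-1}(Y_2,\dots,Y_m)Z^{d-1}+\dots+s_0(Y_2,\dots,Y_m)$; by a change of coordinates it is assumed throughout that $s_{d-1}=0$. Let $y_1,\dots,y_m,z$ be the images of $Y_1,\dots,Y_m,Z$. The canonical locally nilpotent derivation $D_{\mathbb{V}}$ is the $\mathbb{K}$-derivation with $D_{\mathbb{V}}(y_1)=\frac{\partial P}{\partial z}$, $D_{\mathbb{V}}(z)=y_2^{k_2}\cdots y_m^{k_m}$, $D_{\mathbb{V}}(y_i)=0$ for $i\geqslant 2$. The big unipotent group is $\mathbb{U}(D_{\mathbb{V}})=\{\mathrm{Exp}(fD_{\mathbb{V}}):f\in\mathrm{Ker}(D_{\mathbb{V}})\}$, with $\mathrm{Exp}(\delta)=\sum_{i\geqslant0}\frac1{i!}\delta^i$. Let $S(\mathbb{V})$ be the group of permutations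 $\sigma$ of $\{2,\dots,m\}$ stabilizing the monomial $Y_2^{k_2}\cdots Y_m^{k_m}$ (permuting the indices $i$ with equal $k_i$). The semidirect product $G=S(\mathbb{V})\ltimes(\mathbb{K}^* )^m$ acts on the field $\mathbb{K}(y_2,\dots,y_m,z)$ by $(\sigma,t_2,\dots,t_{m+1})\cdot(y_2,\dots,y_m,z)=(t_2y_{\sigma(2)},\dots,t_my_{\sigma(m)},t_{m+1}z)$. The ring $\mathbb{K}[\mathbb{V}]$ embeds in this field via $y_1\mapsto P(y_2,\dots,y_m,z)/(y_2^{k_2}\cdots y_m^{k_m})$. The canonical group $\mathbb{G}\subseteq G$ is the stabilizer of the image of $\mathbb{K}[\mathbb{V}]$; it acts on $\mathbb{K}[\mathbb{V}]$, and the corresponding subgroup of the group $\mathrm{Aut}(\mathbb{V})$ of $\mathbb{K}$-algebra automorphisms of $\mathbb{K}[\mathbb{V}]$ is also denoted $\mathbb{G}$. $\mathrm{Aut}(\delta)=\{\sigma\in\mathrm{Aut}(\mathbb{V}):\sigma\delta=\delta\sigma\}$ and $\mathbb{G}_\delta=\mathbb{G}\cap\mathrm{Aut}(\delta)$. In the semidirect product, $\mathbb{U}(D_{\mathbb{V}})$ is the normal factor. *)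

theory Defs
  imports
    "HOL-Library.Poly_Mapping"
    "HOL-Computational_Algebra.Polynomial"
    "HOL-Computational_Algebra.Fraction_Field"
    "HOL-Combinatorics.Permutations"
    "HOL-Algebra.QuotRing"
    "HOL-Algebra.Bij"
begin

section \<open>Multivariate polynomials\<close>

text \<open>
  A polynomial is a finitely supported map from exponent vectors to coefficients, with
  variables indexed by natural numbers. For a Danielewski variety in \<open>m + 1\<close>-space the
  variables \<open>Y\<^sub>1, \<dots>, Y\<^sub>m\<close> have the indices \<open>1, \<dots>, m\<close> and \<open>Z\<close> has the index \<open>m + 1\<close>.
\<close>

type_synonym 'k mpoly = "(nat \<Rightarrow>\<^sub>0 nat) \<Rightarrow>\<^sub>0 'k"

definition Const :: "'k \<Rightarrow> 'k::field mpoly" where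
  "Const c = Poly_Mapping.single 0 c"

definition Var :: "nat \<Rightarrow> 'k::field mpoly" where
  "Var i = Poly_Mapping.single (Poly_Mapping.single i 1) 1"

definition vars :: "'k::field mpoly \<Rightarrow> nat set" where
  "vars p = (\<Union>\<alpha>\<in>Poly_Mapping.keys p. Poly_Mapping.keys \<alpha>)"

definition polys_in :: "nat set \<Rightarrow> 'k::field mpoly set" where
  "polys_in I = {p. vars p \<subseteq> I}"

definition poly_ring :: "nat set \<Rightarrow> 'k::field mpoly ring" where
  "poly_ring I = \<lparr>carrier = polys_in I, mult = (*), one = 1, zero = 0, add = (+)\<rparr>"

text \<open>Evaluation at \<open>x\<close>, the coefficients being mapped by \<open>c\<close>.\<close>

definition peval :: "('k \<Rightarrow> 'b) \<Rightarrow> (nat \<Rightarrow> 'b) \<Rightarrow> 'k::field mpoly \<Rightarrow> 'b::comm_ring_1" where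
  "peval c x p = (\<Sum>\<alpha>\<in>Poly_Mapping.keys p. c (Poly_Mapping.lookup p \<alpha>) *
     (\<Prod>i\<in>Poly_Mapping.keys \<alpha>. x i ^ Poly_Mapping.lookup \<alpha> i))"

text \<open>Formal partial derivative. If \<open>\<alpha>\<close> does not involve \<open>i\<close>, the coefficient is zero,
  so that the truncated subtraction of exponents is harmless.\<close>

definition partial :: "nat \<Rightarrow> 'k::field mpoly \<Rightarrow> 'k mpoly" where
  "partial i p = (\<Sum>\<alpha>\<in>Poly_Mapping.keys p.
     Poly_Mapping.single (\<alpha> - Poly_Mapping.single i 1)
       (of_nat (Poly_Mapping.lookup \<alpha> i) * Poly_Mapping.lookup p \<alpha>))"


section \<open>The coordinate ring of a Danielewski variety\<close>

definition dmonom :: "nat \<Rightarrow> (nat \<Rightarrow> nat) \<Rightarrow> 'k::field mpoly" where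
  "dmonom m k = (\<Prod>i\<in>{2..m}. Var i ^ k i)"

definition dideal :: "nat \<Rightarrow> (nat \<Rightarrow> nat) \<Rightarrow> 'k::field mpoly \<Rightarrow> 'k mpoly set" where
  "dideal m k P = PIdl\<^bsub>poly_ring {1..m+1}\<^esub> (Var 1 * dmonom m k - P)"

definition coord_ring :: "nat \<Rightarrow> (nat \<Rightarrow> nat) \<Rightarrow> 'k::field mpoly \<Rightarrow> 'k mpoly set ring" where
  "coord_ring m k P = poly_ring {1..m+1} Quot dideal m k P"

definition cls :: "nat \<Rightarrow> (nat \<Rightarrow> nat) \<Rightarrow> 'k::field mpoly \<Rightarrow> 'k mpoly \<Rightarrow> 'k mpoly set" where
  "cls m k P p = dideal m k P +>\<^bsub>poly_ring {1..m+1}\<^esub> p"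

text \<open>Algebra automorphisms are represented by extensional functions, as in
  \<^const>\<open>BijGroup\<close>; the group operation is composition.\<close>

definition AutV :: "nat \<Rightarrow> (nat \<Rightarrow> nat) \<Rightarrow> 'k::field mpoly
    \<Rightarrow> ('k mpoly set \<Rightarrow> 'k mpoly set) monoid" where
  "AutV m k P = (let A = coord_ring m k P in
     (BijGroup (carrier A))\<lparr>carrier :=
        {\<phi> \<in> ring_iso A A. \<phi> \<in> extensional (carrier A) \<and>
           (\<forall>c. \<phi> (cls m k P (Const c)) = cls m k P (Const c))}\<rparr>)"


section \<open>Derivations and exponentials\<close>

definition derivation :: "nat \<Rightarrow> (nat \<Rightarrow> nat) \<Rightarrow> 'k::field mpoly
    \<Rightarrow> ('k mpoly set \<Rightarrow> 'k mpoly set) \<Rightarrow> bool" where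
  "derivation m k P D \<longleftrightarrow> (let A = coord_ring m k P in
     D \<in> carrier A \<rightarrow>\<^sub>E carrier A \<and>
     (\<forall>a\<in>carrier A. \<forall>b\<in>carrier A. D (a \<oplus>\<^bsub>A\<^esub> b) = D a \<oplus>\<^bsub>A\<^esub> D b) \<and>
     (\<forall>c. \<forall>a\<in>carrier A.
        D (cls m k P (Const c) \<otimes>\<^bsub>A\<^esub> a) = cls m k P (Const c) \<otimes>\<^bsub>A\<^esub> D a) \<and>
     (\<forall>a\<in>carrier A. \<forall>b\<in>carrier A.
        D (a \<otimes>\<^bsub>A\<^esub> b) = (D a \<otimes>\<^bsub>A\<^esub> b) \<oplus>\<^bsub>A\<^esub> (a \<otimes>\<^bsub>A\<^esub> D b)))"

text \<open>Uniqueness holds because the ring is generated by the classes of the variables; existence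
  because the derivation of the polynomial ring with these values annihilates
  \<open>Y\<^sub>1 Y\<^sub>2\<^bsup>k\<^sub>2\<^esup> \<cdots> Y\<^sub>m\<^bsup>k\<^sub>m\<^esup> - P\<close>.\<close>

definition canonical_lnd :: "nat \<Rightarrow> (nat \<Rightarrow> nat) \<Rightarrow> 'k::field mpoly
    \<Rightarrow> ('k mpoly set \<Rightarrow> 'k mpoly set)" where
  "canonical_lnd m k P = (THE D. derivation m k P D \<and>
     D (cls m k P (Var 1)) = cls m k P (partial (m+1) P) \<and>
     D (cls m k P (Var (m+1))) = cls m k P (dmonom m k) \<and>
     (\<forall>i\<in>{2..m}. D (cls m k P (Var i)) = \<zero>\<^bsub>coord_ring m k P\<^esub>))"

definition scale :: "nat \<Rightarrow> (nat \<Rightarrow> nat) \<Rightarrow> 'k::field mpoly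
    \<Rightarrow> 'k mpoly set \<Rightarrow> ('k mpoly set \<Rightarrow> 'k mpoly set) \<Rightarrow> ('k mpoly set \<Rightarrow> 'k mpoly set)" where
  "scale m k P f D = (\<lambda>a\<in>carrier (coord_ring m k P). f \<otimes>\<^bsub>coord_ring m k P\<^esub> D a)"

text \<open>For a locally nilpotent \<open>\<delta>\<close> only finitely many terms of the exponential series at \<open>a\<close>
  are nonzero; the sum is taken over these.\<close>

definition Exp :: "nat \<Rightarrow> (nat \<Rightarrow> nat) \<Rightarrow> 'k::field_char_0 mpoly
    \<Rightarrow> ('k mpoly set \<Rightarrow> 'k mpoly set) \<Rightarrow> ('k mpoly set \<Rightarrow> 'k mpoly set)" where
  "Exp m k P \<delta> = (let A = coord_ring m k P in
     (\<lambda>a\<in>carrier A. \<Oplus>\<^bsub>A\<^esub>i\<in>{i. (\<delta> ^^ i) a \<noteq> \<zero>\<^bsub>A\<^esub>}.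
        cls m k P (Const (1 / fact i)) \<otimes>\<^bsub>A\<^esub> (\<delta> ^^ i) a))"

definition big_unipotent :: "nat \<Rightarrow> (nat \<Rightarrow> nat) \<Rightarrow> 'k::field_char_0 mpoly
    \<Rightarrow> ('k mpoly set \<Rightarrow> 'k mpoly set) set" where
  "big_unipotent m k P = (let A = coord_ring m k P; D = canonical_lnd m k P in
     {Exp m k P (scale m k P f D) | f. f \<in> carrier A \<and> D f = \<zero>\<^bsub>A\<^esub>})"

definition Aut_der :: "nat \<Rightarrow> (nat \<Rightarrow> nat) \<Rightarrow> 'k::field mpoly
    \<Rightarrow> ('k mpoly set \<Rightarrow> 'k mpoly set) \<Rightarrow> ('k mpoly set \<Rightarrow> 'k mpoly set) monoid" where
  "Aut_der m k P \<delta> = (AutV m k P)\<lparr>carrier :=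
     {\<phi> \<in> carrier (AutV m k P). \<forall>a\<in>carrier (coord_ring m k P). \<phi> (\<delta> a) = \<delta> (\<phi> a)}\<rparr>"


section \<open>The canonical group\<close>

definition S_V :: "nat \<Rightarrow> (nat \<Rightarrow> nat) \<Rightarrow> 'k::field itself \<Rightarrow> (nat \<Rightarrow> nat) set" where
  "S_V m k _ = {\<sigma>. \<sigma> permutes {2..m} \<and>
     (\<Prod>i\<in>{2..m}. Var (\<sigma> i) ^ k i) = (dmonom m k :: 'k mpoly)}"

text \<open>The action of \<open>(\<sigma>, t)\<close> sends \<open>y\<^sub>i\<close> to \<open>t\<^sub>i y\<^bsub>\<sigma>(i)\<^esub>\<close> for \<open>2 \<le> i \<le> m + 1\<close>; since
  \<open>\<sigma>\<close> permutes \<open>{2..m}\<close>, it fixes the index \<open>m + 1\<close> of \<open>z\<close>. On a fraction in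
  \<open>K(y\<^sub>2, \<dots>, y\<^sub>m, z)\<close> it acts on numerator and denominator; the result does not depend on
  the chosen representation.\<close>

definition poly_act :: "(nat \<Rightarrow> nat) \<Rightarrow> (nat \<Rightarrow> 'k) \<Rightarrow> 'k::field mpoly \<Rightarrow> 'k mpoly" where
  "poly_act \<sigma> t = peval Const (\<lambda>i. Const (t i) * Var (\<sigma> i))"

definition field_act :: "nat \<Rightarrow> (nat \<Rightarrow> nat) \<Rightarrow> (nat \<Rightarrow> 'k)
    \<Rightarrow> 'k::field mpoly fract \<Rightarrow> 'k mpoly fract" where
  "field_act m \<sigma> t r =
     (let (p, q) = (SOME (p, q). p \<in> polys_in {2..m+1} \<and> q \<in> polys_in {2..m+1} \<and> q \<noteq> 0 \<and>
                      r = Fract p q)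
      in Fract (poly_act \<sigma> t p) (poly_act \<sigma> t q))"

text \<open>The embedding of the coordinate ring into \<open>K(y\<^sub>2, \<dots>, y\<^sub>m, z)\<close>; evaluation is constant on
  each residue class.\<close>

definition embed :: "nat \<Rightarrow> (nat \<Rightarrow> nat) \<Rightarrow> 'k::field mpoly
    \<Rightarrow> 'k mpoly set \<Rightarrow> 'k mpoly fract" where
  "embed m k P a = the_elem (peval (\<lambda>c. Fract (Const c) 1)
     (\<lambda>i. if i = 1 then Fract P (dmonom m k) else Fract (Var i) 1) ` a)"

definition canonical_stabilizer :: "nat \<Rightarrow> (nat \<Rightarrow> nat) \<Rightarrow> 'k::field mpoly
    \<Rightarrow> ((nat \<Rightarrow> nat) \<times> (nat \<Rightarrow> 'k)) set" where
  "canonical_stabilizer m k P =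
     {(\<sigma>, t) \<in> S_V m k TYPE('k) \<times> ({2..m+1} \<rightarrow>\<^sub>E - {0}).
        field_act m \<sigma> t ` (embed m k P ` carrier (coord_ring m k P)) =
          embed m k P ` carrier (coord_ring m k P)}"

definition canonical_group :: "nat \<Rightarrow> (nat \<Rightarrow> nat) \<Rightarrow> 'k::field mpoly
    \<Rightarrow> ('k mpoly set \<Rightarrow> 'k mpoly set) set" where
  "canonical_group m k P =
     {\<phi> \<in> carrier (AutV m k P). \<exists>(\<sigma>, t) \<in> canonical_stabilizer m k P.
        \<forall>a\<in>carrier (coord_ring m k P). embed m k P (\<phi> a) = field_act m \<sigma> t (embed m k P a)}"


section \<open>Semidirect products\<close>

text \<open>\<open>H\<close> acts on the normal factor \<open>N\<close> by \<open>act\<close>; the pair \<open>(n, h)\<close> stands for \<open>n h\<close>.\<close>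

definition semidirect :: "('a, 'c) monoid_scheme \<Rightarrow> ('b, 'd) monoid_scheme
    \<Rightarrow> ('b \<Rightarrow> 'a \<Rightarrow> 'a) \<Rightarrow> ('a \<times> 'b) monoid" where
  "semidirect N H act = \<lparr>carrier = carrier N \<times> carrier H,
     mult = (\<lambda>(n, h) (n', h'). (n \<otimes>\<^bsub>N\<^esub> act h n', h \<otimes>\<^bsub>H\<^esub> h')),
     one = (\<one>\<^bsub>N\<^esub>, \<one>\<^bsub>H\<^esub>)\<rparr>"

definition conj_act :: "('a, 'c) monoid_scheme \<Rightarrow> 'a \<Rightarrow> 'a \<Rightarrow> 'a" where
  "conj_act G h n = h \<otimes>\<^bsub>G\<^esub> n \<otimes>\<^bsub>G\<^esub> inv\<^bsub>G\<^esub> h"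

end

theory Submission
  imports Defs
begin

text \<open>
  The coordinate ring embeds in \<open>M[z]\<close>, where \<open>M\<close> is the ring of Laurent polynomials in
  \<open>y\<^sub>2, \<dots>, y\<^sub>m\<close>, by \<open>y\<^sub>1 \<mapsto> P / Y\<close> with \<open>Y = y\<^sub>2\<^bsup>k\<^sub>2\<^esup> \<cdots> y\<^sub>m\<^bsup>k\<^sub>m\<^esup>\<close>; there the
  canonical derivation is \<open>Y \<partial>/\<partial>z\<close>, with kernel \<open>R = K[y\<^sub>2, \<dots>, y\<^sub>m]\<close>. For the lexicographic order
  with \<open>z\<close> first, the leading exponents form the monoid generated by those of \<open>y\<^sub>1, \<dots>, y\<^sub>m, z\<close>,
  and a nonzero locally nilpotent derivation induces an additive weight on this monoid, with values in
  the natural numbers, that is lowered by one along a fixed lattice vector. Since \<open>d \<ge> 2\<close> and \<open>k\<^sub>i \<ge> 2\<close>,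
  every \<open>y\<^sub>i\<close> with \<open>i \<ge> 2\<close> has weight \<open>0\<close>, so that the kernel of the derivation is contained in \<open>R\<close>.

  Applied to conjugates of the canonical derivation this shows that every automorphism \<open>\<Phi>\<close> preserves
  \<open>R\<close>. Hence \<open>\<Phi>(z) = t z + b\<close> with \<open>t\<close> constant and \<open>b \<in> R\<close>, and comparing coefficients in
  \<open>\<Phi>(y\<^sub>1) \<Phi>(Y) = \<Phi>(P)\<close> shows that \<open>\<Phi>\<close> permutes \<open>y\<^sub>2, \<dots>, y\<^sub>m\<close> up to constants and, because
  \<open>s\<^bsub>d-1\<^esub> = 0\<close>, that \<open>Y\<close> divides \<open>b\<close>. The big unipotent group consists of the automorphisms that fix
  \<open>R\<close> and map \<open>z\<close> to \<open>z + Y f\<close> with \<open>f \<in> R\<close>, and the canonical group of those with \<open>b = 0\<close>; together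
  they generate all automorphisms, and the former commute with \<open>\<delta>\<close>.
\<close>

section \<open>Polynomials and their evaluation\<close>

text \<open>Why a derivation yields a weight: take the largest amount \<open>shift\<close> by which
  it moves the leading exponent of a generator, and record the coefficient met at that position. By
  the Leibniz rule this coefficient is additive in the exponent. As long as it is nonzero, the
  leading exponent really moves by \<open>shift\<close>; local nilpotency makes it vanish after
  finitely many moves, so it is minus a natural multiple of one fixed scalar. In characteristic zero
  the multiple is well defined, and it is the weight. All exponents on the way stay in the monoid,
  which is what restricts the lattice vector.

  The obstacle is that distinct monomials can share a leading exponent: d times that of z equals
  that of y1 plus that of Y. Reducing modulo the equation to z-degree less than d removes this
  relation, so leading terms of reduced representatives cannot cancel. This also makes the embedding
  injective.

  Working in M[z] gives access to degree, derivative and composition in z; the results are carried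
  back to residue classes only at the end.\<close>

abbreviation lookup where "lookup \<equiv> Poly_Mapping.lookup"
abbreviation keys where "keys \<equiv> Poly_Mapping.keys"
abbreviation single where "single \<equiv> Poly_Mapping.single"

section \<open>Polynomials in a prescribed set of variables\<close>

lemma polys_in_iff: "p \<in> polys_in I \<longleftrightarrow> (\<forall>\<alpha>\<in>keys p. keys \<alpha> \<subseteq> I)"
  by (auto simp: polys_in_def vars_def)

lemma polys_in_0 [simp]: "0 \<in> polys_in I"
  and polys_in_1 [simp]: "1 \<in> polys_in I"
  and polys_in_Const [simp]: "Const a \<in> polys_in I"
  by (auto simp: polys_in_iff Const_def)

lemma polys_in_Var: "i \<in> I \<Longrightarrow> Var i \<in> polys_in I"
  by (auto simp: polys_in_iff Var_def)

lemma polys_in_add: "p \<in> polys_in I \<Longrightarrow> q \<in> polys_in I \<Longrightarrow> p + q \<in> polys_in I"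
  using keys_add[of p q] by (auto simp: polys_in_iff)

lemma polys_in_uminus: "p \<in> polys_in I \<Longrightarrow> - p \<in> polys_in I"
  by (auto simp: polys_in_iff in_keys_iff)

lemma polys_in_diff: "p \<in> polys_in I \<Longrightarrow> q \<in> polys_in I \<Longrightarrow> p - q \<in> polys_in I"
  using polys_in_add[of p I "- q"] polys_in_uminus[of q I] by simp

lemma polys_in_mult: "p \<in> polys_in I \<Longrightarrow> q \<in> polys_in I \<Longrightarrow> p * q \<in> polys_in I"
  unfolding polys_in_iff
proof
  fix \<alpha> assume p: "\<forall>\<alpha>\<in>keys p. keys \<alpha> \<subseteq> I" and q: "\<forall>\<alpha>\<in>keys q. keys \<alpha> \<subseteq> I"
    and "\<alpha> \<in> keys (p * q)"
  then obtain a b where "a \<in> keys p" "b \<in> keys q" "\<alpha> = a + b" using keys_mult[of p q] by blast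
  with p q keys_add[of a b] show "keys \<alpha> \<subseteq> I" by blast
qed

lemma polys_in_power: "p \<in> polys_in I \<Longrightarrow> p ^ n \<in> polys_in I"
  by (induction n) (auto intro: polys_in_mult)

lemma polys_in_sum: "(\<And>j. j \<in> J \<Longrightarrow> f j \<in> polys_in I) \<Longrightarrow> sum f J \<in> polys_in I"
  by (induction J rule: infinite_finite_induct) (auto intro: polys_in_add)

lemma polys_in_prod: "(\<And>j. j \<in> J \<Longrightarrow> f j \<in> polys_in I) \<Longrightarrow> prod f J \<in> polys_in I"
  by (induction J rule: infinite_finite_induct) (auto intro: polys_in_mult)

lemma polys_in_mono: "p \<in> polys_in I \<Longrightarrow> I \<subseteq> J \<Longrightarrow> p \<in> polys_in J"
  by (auto simp: polys_in_def)

lemmas polys_in_intros = polys_in_Var polys_in_add polys_in_diff polys_in_mult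
  polys_in_uminus polys_in_power polys_in_sum polys_in_prod

lemma sum_single_keys: "(\<Sum>\<alpha>\<in>keys p. single \<alpha> (lookup p \<alpha>)) = p"
proof (rule poly_mapping_eqI)
  fix \<beta>
  have "lookup (\<Sum>\<alpha>\<in>keys p. single \<alpha> (lookup p \<alpha>)) \<beta>
      = (\<Sum>\<alpha>\<in>keys p. if \<alpha> = \<beta> then lookup p \<alpha> else 0)"
    by (auto simp: lookup_sum lookup_single when_def intro!: sum.cong)
  also have "\<dots> = lookup p \<beta>"
    by (auto simp: in_keys_iff)
  finally show "lookup (\<Sum>\<alpha>\<in>keys p. single \<alpha> (lookup p \<alpha>)) \<beta> = lookup p \<beta>" .
qed

lemma Const_0 [simp]: "Const 0 = 0" and Const_1 [simp]: "Const 1 = 1"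
  and Const_add: "Const (a + b) = Const a + Const b"
  and Const_mult: "Const (a * b) = Const a * Const b"
  by (simp_all add: Const_def single_add mult_single)

lemma Const_mult_single: "Const a * single \<alpha> b = single \<alpha> (a * b)"
  by (simp add: Const_def mult_single)

lemma Var_neq_0 [simp]: "Var i \<noteq> 0"
  unfolding Var_def by (metis lookup_single_eq lookup_zero zero_neq_one)

lemma single_decomp:
  fixes \<alpha> :: "nat \<Rightarrow>\<^sub>0 nat"
  assumes "\<alpha> \<noteq> 0"
  obtains i \<beta> where "i \<in> keys \<alpha>" "keys \<beta> \<subseteq> keys \<alpha>" "\<alpha> = single i 1 + \<beta>"
    "lookup \<alpha> i = Suc (lookup \<beta> i)"
proof -
  from assms obtain i where i: "i \<in> keys \<alpha>" by fastforce
  define \<beta> where "\<beta> = \<alpha> - single i 1"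
  have "\<alpha> = single i 1 + \<beta>"
    using i by (intro poly_mapping_eqI) (auto simp: \<beta>_def lookup_add lookup_minus lookup_single when_def in_keys_iff)
  moreover have "keys \<beta> \<subseteq> keys \<alpha>"
    by (auto simp: \<beta>_def in_keys_iff lookup_minus)
  moreover have "lookup \<alpha> i = Suc (lookup \<beta> i)"
    using i by (auto simp: \<beta>_def lookup_minus in_keys_iff)
  ultimately show thesis using that i by blast
qed

text \<open>Splitting off one variable lowers the total degree, which is the induction
  measure.\<close>

lemma exponent_induct [consumes 1, case_names zero add]:
  fixes \<alpha> :: "nat \<Rightarrow>\<^sub>0 nat"
  assumes "keys \<alpha> \<subseteq> I" and "Q 0"
    and "\<And>i \<beta>. i \<in> I \<Longrightarrow> keys \<beta> \<subseteq> I \<Longrightarrow> Q \<beta> \<Longrightarrow> Q (single i 1 + \<beta>)"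
  shows "Q \<alpha>"
  using assms(1)
proof (induction "\<Sum>i\<in>keys \<alpha>. lookup \<alpha> i" arbitrary: \<alpha> rule: less_induct)
  case less
  show ?case
  proof (cases "\<alpha> = 0")
    case False
    then obtain i \<beta> where *: "i \<in> keys \<alpha>" "keys \<beta> \<subseteq> keys \<alpha>" "\<alpha> = single i 1 + \<beta>"
      "lookup \<alpha> i = Suc (lookup \<beta> i)" using single_decomp by blast
    have "(\<Sum>i\<in>keys \<beta>. lookup \<beta> i) = (\<Sum>i\<in>keys \<alpha>. lookup \<beta> i)"
      using * by (intro sum.mono_neutral_left) (auto simp: in_keys_iff)
    also have "\<dots> < (\<Sum>i\<in>keys \<alpha>. lookup \<alpha> i)"
    proof (rule sum_strict_mono_ex1)
      show "\<forall>x\<in>keys \<alpha>. lookup \<beta> x \<le> lookup \<alpha> x" by (subst *(3)) (simp add: lookup_add)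
      show "\<exists>a\<in>keys \<alpha>. lookup \<beta> a < lookup \<alpha> a" using *(1,4) by (intro bexI[of _ i]) auto
    qed simp
    finally have "Q \<beta>" using less * by blast
    then have "Q (single i 1 + \<beta>)" using assms(3) * less.prems by blast
    then show ?thesis using *(3) by simp
  qed (use assms in simp)
qed

text \<open>Monomials arise from constants by multiplying with one variable at a time. The cases
  keep the membership facts because most maps used later are additive and multiplicative only on
  their domain.\<close>

lemma polys_in_induct [consumes 1, case_names Const add Var_mult]:
  assumes "p \<in> polys_in I"
    and "\<And>a. Q (Const a)"
    and "\<And>p q. p \<in> polys_in I \<Longrightarrow> q \<in> polys_in I \<Longrightarrow> Q p \<Longrightarrow> Q q \<Longrightarrow> Q (p + q)"
    and "\<And>i p. i \<in> I \<Longrightarrow> p \<in> polys_in I \<Longrightarrow> Q p \<Longrightarrow> Q (Var i * p)"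
  shows "Q p"
proof -
  have single: "single \<alpha> a \<in> polys_in I \<and> Q (single \<alpha> a)" if "keys \<alpha> \<subseteq> I" for \<alpha> a
    using that
  proof (induction \<alpha> rule: exponent_induct)
    case zero
    show ?case using assms(2)[of a] by (simp add: Const_def[symmetric])
  next
    case (add i \<beta>)
    have "single (single i 1 + \<beta>) a = Var i * single \<beta> a"
      by (simp add: Var_def mult_single)
    then show ?case using add assms(4)[of i "single \<beta> a"] by (auto intro!: polys_in_intros)
  qed
  have "Q (\<Sum>\<alpha>\<in>K. single \<alpha> (lookup p \<alpha>)) \<and> (\<Sum>\<alpha>\<in>K. single \<alpha> (lookup p \<alpha>)) \<in> polys_in I"
    if "finite K" "K \<subseteq> keys p" for K
    using that
  proof (induction K rule: finite_induct)
    case empty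
    show ?case using assms(2)[of 0] by simp
  next
    case (insert \<alpha> K)
    then have "keys \<alpha> \<subseteq> I" using assms(1) by (auto simp: polys_in_iff)
    then show ?case using insert single assms(3) by (auto intro!: polys_in_intros)
  qed
  from this[of "keys p"] show ?thesis by (simp add: sum_single_keys)
qed

lemma in_polys_UNIV [simp]: "p \<in> polys_in UNIV"
  by (simp add: polys_in_def)

lemmas mpoly_induct = polys_in_induct[OF in_polys_UNIV, case_names Const add Var_mult]

section \<open>Evaluation as a ring homomorphism\<close>

locale coeff_hom =
  fixes c :: "'k::field \<Rightarrow> 'b::comm_ring_1"
  assumes c_0 [simp]: "c 0 = 0" and c_1 [simp]: "c 1 = 1"
    and c_add: "c (a + b) = c a + c b" and c_mult: "c (a * b) = c a * c b"
begin

lemma peval_superset: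
  assumes "finite K" "keys p \<subseteq> K"
  shows "peval c x p = (\<Sum>\<alpha>\<in>K. c (lookup p \<alpha>) * (\<Prod>i\<in>keys \<alpha>. x i ^ lookup \<alpha> i))"
  unfolding peval_def using assms
  by (intro sum.mono_neutral_left) (auto simp: in_keys_iff)

lemma peval_single: "peval c x (single \<alpha> a) = c a * (\<Prod>i\<in>keys \<alpha>. x i ^ lookup \<alpha> i)"
  by (subst peval_superset[of "{\<alpha>}"]) auto

lemma peval_0 [simp]: "peval c x 0 = 0"
  by (simp add: peval_def)

lemma peval_Const [simp]: "peval c x (Const a) = c a"
  by (simp add: Const_def peval_single)

lemma peval_1 [simp]: "peval c x 1 = 1"
  using peval_Const[of x 1] by simp

lemma peval_Var [simp]: "peval c x (Var i) = x i"
  by (simp add: Var_def peval_single)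

lemma peval_add: "peval c x (p + q) = peval c x p + peval c x q"
proof -
  let ?K = "keys p \<union> keys q"
  show ?thesis
    using keys_add[of p q]
    by (simp add: peval_superset[of ?K] lookup_add c_add distrib_right sum.distrib)
qed

text \<open>The core of multiplicativity: products are built from constants and single variables by
  \<open>mpoly_induct\<close>. On a monomial the new factor raises one exponent, also when
  \<open>i\<close> is not yet among its keys.\<close>

lemma peval_Var_mult: "peval c x (Var i * p) = x i * peval c x p"
proof -
  have *: "(\<Prod>j\<in>keys (single i 1 + \<alpha>). x j ^ lookup (single i 1 + \<alpha>) j)
      = x i * (\<Prod>j\<in>keys \<alpha>. x j ^ lookup \<alpha> j)" for \<alpha>
  proof -
    let ?K = "insert i (keys \<alpha>)"
    have "(\<Prod>j\<in>keys (single i 1 + \<alpha>). x j ^ lookup (single i 1 + \<alpha>) j)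
        = (\<Prod>j\<in>?K. x j ^ lookup (single i 1 + \<alpha>) j)"
      using keys_add[of "single i 1" \<alpha>] by (intro prod.mono_neutral_left) (auto simp: in_keys_iff)
    also have "\<dots> = (\<Prod>j\<in>?K. (if j = i then x i else 1) * x j ^ lookup \<alpha> j)"
      by (intro prod.cong) (auto simp: lookup_add lookup_single when_def)
    also have "\<dots> = (\<Prod>j\<in>?K. if j = i then x i else 1) * (\<Prod>j\<in>?K. x j ^ lookup \<alpha> j)"
      by (rule prod.distrib)
    also have "(\<Prod>j\<in>?K. if j = i then x i else 1) = x i"
      by (subst prod.delta) auto
    also have "(\<Prod>j\<in>?K. x j ^ lookup \<alpha> j) = (\<Prod>j\<in>keys \<alpha>. x j ^ lookup \<alpha> j)"
      by (rule prod.mono_neutral_right) (auto simp: in_keys_iff)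
    finally show ?thesis .
  qed
  have 1: "peval c x (Var i * single \<alpha> a) = x i * peval c x (single \<alpha> a)" for \<alpha> a
    by (simp add: Var_def mult_single peval_single *[unfolded One_nat_def] mult.left_commute)
  have "peval c x (Var i * (\<Sum>\<alpha>\<in>K. single \<alpha> (lookup p \<alpha>)))
      = x i * peval c x (\<Sum>\<alpha>\<in>K. single \<alpha> (lookup p \<alpha>))" for K
    by (induction K rule: infinite_finite_induct) (simp_all add: distrib_left peval_add 1)
  from this[of "keys p"] show ?thesis by (simp add: sum_single_keys)
qed

lemma peval_mult: "peval c x (p * q) = peval c x p * peval c x q"
proof -
  have C: "peval c x (Const a * q) = c a * peval c x q" for a
  proof (induction q rule: mpoly_induct)
    case (Const b)
    then show ?case by (simp add: Const_mult[symmetric] c_mult)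
  next
    case (Var_mult i p)
    have "peval c x (Const a * (Var i * p)) = peval c x (Var i * (Const a * p))"
      by (simp add: ac_simps)
    also have "\<dots> = x i * (c a * peval c x p)"
      by (simp only: peval_Var_mult Var_mult)
    finally show ?case by (simp add: peval_Var_mult mult.left_commute)
  qed (simp_all add: distrib_left peval_add)
  show ?thesis
  proof (induction p rule: mpoly_induct)
    case (Var_mult i p)
    then show ?case by (simp add: peval_Var_mult mult.assoc)
  qed (simp_all add: C peval_add distrib_right)
qed

lemma peval_uminus: "peval c x (- p) = - peval c x p"
  using peval_add[of x p "- p"] by (simp add: eq_neg_iff_add_eq_0 add.commute)

lemma peval_diff: "peval c x (p - q) = peval c x p - peval c x q"
  using peval_add[of x p "- q"] by (simp add: peval_uminus)

lemma peval_power: "peval c x (p ^ n) = peval c x p ^ n"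
  by (induction n) (simp_all add: peval_mult)

lemma peval_sum: "peval c x (sum f J) = (\<Sum>j\<in>J. peval c x (f j))"
  by (induction J rule: infinite_finite_induct) (simp_all add: peval_add)

lemma peval_prod: "peval c x (prod f J) = (\<Prod>j\<in>J. peval c x (f j))"
  by (induction J rule: infinite_finite_induct) (simp_all add: peval_mult)

lemmas peval_hom = peval_add peval_mult peval_uminus peval_diff peval_power peval_sum peval_prod

end

text \<open>The laws are asked for on \<open>polys_in I\<close> only, so that the lemma applies to a
  map sending p to \<open>\<Phi> (ev p)\<close>, where \<open>\<Phi>\<close> is a homomorphism just
  on the image of the coordinate ring.\<close>

lemma hom_eqI:
  fixes f g :: "'k::field mpoly \<Rightarrow> 'b::comm_ring_1"
  assumes "p \<in> polys_in I"
    and "\<And>a. f (Const a) = g (Const a)" and "\<And>i. i \<in> I \<Longrightarrow> f (Var i) = g (Var i)"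
    and "\<And>p q. p \<in> polys_in I \<Longrightarrow> q \<in> polys_in I \<Longrightarrow> f (p + q) = f p + f q"
    and "\<And>p q. p \<in> polys_in I \<Longrightarrow> q \<in> polys_in I \<Longrightarrow> g (p + q) = g p + g q"
    and "\<And>p q. p \<in> polys_in I \<Longrightarrow> q \<in> polys_in I \<Longrightarrow> f (p * q) = f p * f q"
    and "\<And>p q. p \<in> polys_in I \<Longrightarrow> q \<in> polys_in I \<Longrightarrow> g (p * q) = g p * g q"
  shows "f p = g p"
  using assms(1) by (induction p rule: polys_in_induct) (auto simp: assms polys_in_Var)

section \<open>Representatives reduced in Z\<close>

lemma poly_ring_simps [simp]:
  "carrier (poly_ring I) = polys_in I" "mult (poly_ring I) = (*)" "one (poly_ring I) = 1"
  "zero (poly_ring I) = 0" "add (poly_ring I) = (+)"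
  by (simp_all add: poly_ring_def)

lemma cring_poly_ring: "cring (poly_ring I)"
proof (rule cringI)
  show "abelian_group (poly_ring I)"
  proof (rule abelian_groupI)
    fix x assume "x \<in> carrier (poly_ring I)"
    then show "\<exists>y\<in>carrier (poly_ring I). y \<oplus>\<^bsub>poly_ring I\<^esub> x = \<zero>\<^bsub>poly_ring I\<^esub>"
      by (intro bexI[of _ "- x"]) (auto intro: polys_in_intros)
  qed (auto intro: polys_in_intros)
  show "comm_monoid (poly_ring I)"
    by (rule comm_monoidI) (auto intro: polys_in_intros)
qed (auto simp: distrib_right)

lemma poly_ring_minus:
  assumes "p \<in> polys_in I" "q \<in> polys_in I"
  shows "p \<ominus>\<^bsub>poly_ring I\<^esub> q = p - q"
proof -
  interpret R: cring "poly_ring I" by (rule cring_poly_ring)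
  have "\<ominus>\<^bsub>poly_ring I\<^esub> q = - q"
    using assms by (intro R.minus_equality) (auto intro: polys_in_intros)
  then show ?thesis by (simp add: R.minus_eq)
qed

section \<open>The coordinate ring as a quotient\<close>

locale danielewski =
  fixes m d :: nat and k :: "nat \<Rightarrow> nat" and s :: "nat \<Rightarrow> 'k::field_char_0 mpoly" and P :: "'k mpoly"
  assumes m_ge: "m \<ge> 2" and d_ge: "d \<ge> 2"
    and k_ge: "\<And>i. i \<in> {2..m} \<Longrightarrow> k i \<ge> 2"
    and s_in: "\<And>j. j < d \<Longrightarrow> s j \<in> polys_in {2..m}"
    and s_0: "s (d - 1) = 0"
    and P_def: "P = Var (m+1) ^ d + (\<Sum>j<d. s j * Var (m+1) ^ j)"
begin

abbreviation A where "A \<equiv> coord_ring m k P"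
abbreviation cl where "cl \<equiv> cls m k P"
abbreviation vs where "vs \<equiv> {1..m+1}"
abbreviation F where "F \<equiv> Var 1 * dmonom m k - P"

lemma P_in: "P \<in> polys_in {2..m+1}"
  unfolding P_def using m_ge by (auto intro!: polys_in_intros polys_in_mono[OF s_in])

lemma P_in': "P \<in> polys_in vs"
  by (rule polys_in_mono[OF P_in]) auto

lemma dmonom_in: "dmonom m k \<in> polys_in {2..m}"
  by (auto simp: dmonom_def intro!: polys_in_intros)

lemma dmonom_in': "dmonom m k \<in> polys_in vs"
  by (rule polys_in_mono[OF dmonom_in]) auto

lemma F_in: "F \<in> polys_in vs"
  using P_in' dmonom_in' by (auto intro!: polys_in_intros)

lemma dideal_eq: "dideal m k P = {r * F | r. r \<in> polys_in vs}"
  by (simp add: dideal_def cgenideal_def)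

lemma ideal_dideal: "ideal (dideal m k P) (poly_ring vs)"
  unfolding dideal_def by (rule cring.cgenideal_ideal[OF cring_poly_ring]) (use F_in in simp)

lemma cring_A: "cring A"
  unfolding coord_ring_def by (rule ideal.quotient_is_cring[OF ideal_dideal cring_poly_ring])

lemma cl_eq: "cl p = {h + p | h. h \<in> dideal m k P}"
  by (auto simp: cls_def a_r_coset_def')

lemma carrier_A: "carrier A = cl ` polys_in vs"
  by (auto simp: coord_ring_def FactRing_def A_RCOSETS_def' cls_def)

lemma cl_in [intro]: "p \<in> polys_in vs \<Longrightarrow> cl p \<in> carrier A"
  by (simp add: carrier_A)

lemma cl_hom:
  shows cl_add: "p \<in> polys_in vs \<Longrightarrow> q \<in> polys_in vs \<Longrightarrow> cl p \<oplus>\<^bsub>A\<^esub> cl q = cl (p + q)"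
    and cl_mult: "p \<in> polys_in vs \<Longrightarrow> q \<in> polys_in vs \<Longrightarrow> cl p \<otimes>\<^bsub>A\<^esub> cl q = cl (p * q)"
    and cl_1: "\<one>\<^bsub>A\<^esub> = cl 1"
    and cl_0: "\<zero>\<^bsub>A\<^esub> = cl 0"
proof -
  note H = ideal.rcos_ring_hom[OF ideal_dideal]
  show "p \<in> polys_in vs \<Longrightarrow> q \<in> polys_in vs \<Longrightarrow> cl p \<oplus>\<^bsub>A\<^esub> cl q = cl (p + q)"
    using ring_hom_add[OF H, of p q] by (simp add: cls_def coord_ring_def)
  show "p \<in> polys_in vs \<Longrightarrow> q \<in> polys_in vs \<Longrightarrow> cl p \<otimes>\<^bsub>A\<^esub> cl q = cl (p * q)"
    using ring_hom_mult[OF H, of p q] by (simp add: cls_def coord_ring_def)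
  show "\<one>\<^bsub>A\<^esub> = cl 1"
    using ring_hom_one[OF H] by (simp add: cls_def coord_ring_def)
  show "\<zero>\<^bsub>A\<^esub> = cl 0"
    by (auto simp: cl_eq coord_ring_def FactRing_def)
qed

lemma cl_eq_iff:
  assumes "p \<in> polys_in vs" "q \<in> polys_in vs"
  shows "cl p = cl q \<longleftrightarrow> (\<exists>r\<in>polys_in vs. p - q = r * F)"
proof -
  interpret R: cring "poly_ring vs" by (rule cring_poly_ring)
  have "cl p = cl q \<longleftrightarrow> p \<ominus>\<^bsub>poly_ring vs\<^esub> q \<in> dideal m k P"
    using R.quotient_eq_iff_same_a_r_cos[OF ideal_dideal, of p q] assms by (simp add: cls_def)
  then show ?thesis using assms by (auto simp: poly_ring_minus dideal_eq)
qed

text \<open>Every class has a representative of degree less than \<open>d\<close> in \<open>Z\<close>, since \<open>P\<close> is monic in \<open>Z\<close>.\<close>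

definition reduced :: "'k mpoly set" where
  "reduced = {p \<in> polys_in vs. \<forall>\<alpha>\<in>keys p. lookup \<alpha> (m+1) < d}"

lemma reduced_0: "0 \<in> reduced"
  by (simp add: reduced_def)

lemma reduced_add: "p \<in> reduced \<Longrightarrow> q \<in> reduced \<Longrightarrow> p + q \<in> reduced"
  using keys_add[of p q] by (auto simp: reduced_def intro: polys_in_add)

lemma reduced_diff: "p \<in> reduced \<Longrightarrow> q \<in> reduced \<Longrightarrow> p - q \<in> reduced"
  using keys_diff[of p q] by (auto simp: reduced_def intro: polys_in_diff)

lemma reduced_sum: "(\<And>j. j \<in> J \<Longrightarrow> f j \<in> reduced) \<Longrightarrow> sum f J \<in> reduced"
  by (induction J rule: infinite_finite_induct) (auto intro: reduced_add reduced_0)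

lemma reduced_mult:
  assumes "p \<in> reduced" "q \<in> polys_in {1..m}"
  shows "p * q \<in> reduced"
proof -
  have "lookup \<alpha> (m+1) < d" if "\<alpha> \<in> keys (p * q)" for \<alpha>
  proof -
    obtain a b where ab: "a \<in> keys p" "b \<in> keys q" "\<alpha> = a + b"
      using \<open>\<alpha> \<in> keys (p * q)\<close> keys_mult[of p q] by blast
    then have "m + 1 \<notin> keys b" using assms(2) by (force simp: polys_in_iff)
    then have "lookup b (m+1) = 0" by (simp add: in_keys_iff)
    then show ?thesis using ab assms by (auto simp: lookup_add reduced_def)
  qed
  then show ?thesis
    using assms polys_in_mono[OF assms(2), of vs] by (auto simp: reduced_def intro!: polys_in_mult)
qed

lemma Var_power: "Var i ^ n = single (single i n) 1"
  by (induction n) (simp_all add: Var_def mult_single single_add[symmetric])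

lemma keys_polys_in: "p \<in> polys_in I \<Longrightarrow> \<alpha> \<in> keys p \<Longrightarrow> i \<notin> I \<Longrightarrow> lookup \<alpha> i = 0"
  by (meson in_keys_iff polys_in_iff subsetD)

lemma reduced_Var_power: "j < d \<Longrightarrow> Var (m+1) ^ j \<in> reduced"
  by (auto simp: reduced_def Var_power polys_in_iff split: if_splits)

lemma reduced_sZ: "(\<Sum>j<d. s j * Var (m+1) ^ j) \<in> reduced"
proof (rule reduced_sum)
  fix j assume "j \<in> {..<d}"
  then have "Var (m+1) ^ j * s j \<in> reduced"
    using polys_in_mono[OF s_in] by (intro reduced_mult reduced_Var_power) auto
  then show "s j * Var (m+1) ^ j \<in> reduced" by (simp add: mult.commute)
qed

text \<open>Only multiplication by Z can leave the reduced range, and then a monomial has Z-degree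
  exactly d. The equation replaces its factor Z^d by \<open>Var 1 * dmonom m k\<close> minus the
  lower terms of P, all of Z-degree less than d, so one replacement is enough.\<close>

lemma ex_reduced:
  assumes "p \<in> polys_in vs"
  shows "\<exists>q\<in>reduced. cl p = cl q"
  using assms
proof (induction rule: polys_in_induct)
  case (Const a)
  have "Const a \<in> reduced" using d_ge by (auto simp: reduced_def, auto simp: Const_def split: if_splits)
  then show ?case by auto
next
  case (add p q)
  then obtain p' q' where "p' \<in> reduced" "q' \<in> reduced" "cl p = cl p'" "cl q = cl q'" by auto
  moreover from this have "cl (p + q) = cl (p' + q')"
    using add.hyps by (simp add: reduced_def cl_add[symmetric])
  ultimately show ?case by (auto intro: reduced_add)
next
  case (Var_mult i p)
  then obtain q where q: "q \<in> reduced" "cl p = cl q" by auto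
  then have qin: "q \<in> polys_in vs" by (simp add: reduced_def)
  have eq: "cl (Var i * p) = cl (Var i * q)"
    using Var_mult.hyps q qin by (simp add: cl_mult[symmetric] polys_in_Var)
  show ?case
  proof (cases "i = m + 1")
    case False
    then have "q * Var i \<in> reduced" using Var_mult.hyps(1) by (intro reduced_mult q polys_in_Var) auto
    then show ?thesis using eq by (auto simp: mult.commute)
  next
    case True
    have step: "\<exists>r\<in>reduced. cl (Var (m+1) * single \<alpha> a) = cl r" if "\<alpha> \<in> keys q" for \<alpha> a
    proof (cases "lookup \<alpha> (m+1) + 1 < d")
      case True
      have "Var (m+1) * single \<alpha> a \<in> reduced"
        using that qin True
        by (auto simp: reduced_def Var_def mult_single polys_in_iff lookup_add
            split: if_splits dest!: subsetD[OF keys_add])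
      then show ?thesis by blast
    next
      case False
      have lt: "lookup \<alpha> (m+1) < d" using q that by (auto simp: reduced_def)
      \<comment> \<open>Here \<alpha> has Z-degree exactly d - 1, so \<beta> is its part without
        Z.\<close>
      define \<beta> where "\<beta> = \<alpha> - single (m+1) (d-1)"
      have \<beta>: "\<alpha> = \<beta> + single (m+1) (d-1)" "m + 1 \<notin> keys \<beta>" "keys \<beta> \<subseteq> keys \<alpha>"
        using lt False by (auto intro!: poly_mapping_eqI
            simp: \<beta>_def lookup_minus lookup_add lookup_single when_def in_keys_iff)
      moreover have "keys \<alpha> \<subseteq> vs" using that qin by (auto simp: polys_in_iff)
      ultimately have "keys \<beta> \<subseteq> vs - {m + 1}" by blast
      moreover have "vs - {m + 1} = {1..m}" by auto
      ultimately have "keys \<beta> \<subseteq> {1..m}" by blast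
      then have \<beta>in: "single \<beta> a \<in> polys_in {1..m}" by (auto simp: polys_in_iff)
      then have \<beta>in': "single \<beta> a \<in> polys_in vs" by (auto elim: polys_in_mono)
      let ?g = "\<Sum>j<d. s j * Var (m+1) ^ j"
      \<comment> \<open>\<open>?r\<close> is congruent to Z^d modulo F.\<close>
      let ?r = "Var 1 * dmonom m k - ?g"
      have "Var (m+1) * single \<alpha> a = single (single (m+1) 1 + single (m+1) (d-1) + \<beta>) a"
        by (simp add: Var_def mult_single \<beta>(1) ac_simps)
      also have "single (m+1) 1 + single (m+1) (d-1) = (single (m+1) d :: nat \<Rightarrow>\<^sub>0 nat)"
        using d_ge by (simp add: single_add[symmetric])
      also have "single (single (m+1) d + \<beta>) a = single \<beta> a * Var (m+1) ^ d"
        by (simp only: Var_power mult_single) (simp add: add.commute)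
      also have "Var (m+1) ^ d = ?r - F"
        by (simp add: P_def)
      finally have *: "Var (m+1) * single \<alpha> a - single \<beta> a * ?r = (- single \<beta> a) * F"
        by (simp add: algebra_simps)
      have "Var 1 * dmonom m k \<in> polys_in {1..m}"
        using m_ge by (intro polys_in_intros polys_in_mono[OF dmonom_in]) auto
      then have "1 * (Var 1 * dmonom m k) \<in> reduced"
        using d_ge by (intro reduced_mult) (auto simp: reduced_def)
      then have "?r \<in> reduced" by (intro reduced_diff reduced_sZ) simp
      then have "?r * single \<beta> a \<in> reduced" by (rule reduced_mult[OF _ \<beta>in])
      then have r: "single \<beta> a * ?r \<in> reduced" by (simp add: mult.commute)
      have "single \<alpha> a \<in> polys_in vs" using that qin by (auto simp: polys_in_iff)
      then have "cl (Var (m+1) * single \<alpha> a) = cl (single \<beta> a * ?r)"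
        using r * \<beta>in' by (subst cl_eq_iff) (auto simp only: reduced_def intro!: polys_in_intros, auto intro: polys_in_intros)
      then show ?thesis using r by blast
    qed
    have *: "\<exists>r\<in>reduced. cl (Var (m+1) * (\<Sum>\<alpha>\<in>K. single \<alpha> (lookup q \<alpha>))) = cl r"
      if "finite K" "K \<subseteq> keys q" for K
      using that
    proof (induction K rule: finite_induct)
      case empty
      then show ?case using reduced_0 by (intro bexI[of _ 0]) auto
    next
      case (insert \<alpha> K)
      then obtain r r' where r: "r \<in> reduced" "r' \<in> reduced"
        "cl (Var (m+1) * single \<alpha> (lookup q \<alpha>)) = cl r"
        "cl (Var (m+1) * (\<Sum>\<alpha>\<in>K. single \<alpha> (lookup q \<alpha>))) = cl r'"
        using step insert by (meson insert_subset)
      have e: "Var (m+1) * single \<beta> a \<in> polys_in vs" if "\<beta> \<in> keys q" for \<beta> a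
      proof -
        have "single \<beta> a \<in> polys_in vs" using that qin by (auto simp: polys_in_iff)
        then show ?thesis by (intro polys_in_intros) auto
      qed
      have e': "(\<Sum>\<alpha>\<in>K. Var (m+1) * single \<alpha> (lookup q \<alpha>)) \<in> polys_in vs"
        using insert.prems by (intro polys_in_sum e) auto
      have "cl (Var (m+1) * (\<Sum>\<alpha>\<in>insert \<alpha> K. single \<alpha> (lookup q \<alpha>)))
          = cl (Var (m+1) * single \<alpha> (lookup q \<alpha>)) \<oplus>\<^bsub>A\<^esub>
            cl (\<Sum>\<alpha>\<in>K. Var (m+1) * single \<alpha> (lookup q \<alpha>))"
        using insert e' by (subst cl_add) (auto intro!: e simp: distrib_left sum_distrib_left simp del: One_nat_def)
      also have "\<dots> = cl (r + r')"
        using r by (subst cl_add[symmetric]) (simp_all add: reduced_def sum_distrib_left)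
      finally have "cl (Var (m+1) * (\<Sum>\<alpha>\<in>insert \<alpha> K. single \<alpha> (lookup q \<alpha>))) = cl (r + r')" .
      then show ?case using r reduced_add by blast
    qed
    from *[of "keys q"] show ?thesis using eq True by (simp add: sum_single_keys)
  qed
qed

end

section \<open>Leading exponents in Laurent polynomials\<close>

type_synonym 'k laurent = "(nat \<Rightarrow>\<^sub>0 int) \<Rightarrow>\<^sub>0 'k"

declare single_one [simp del] single_of_nat [simp del] single_numeral [simp del]

lemma frag_cmul_single: "frag_cmul a (single i b) = single i (a * b)"
  by (rule poly_mapping_eqI) (simp add: lookup_single when_def)

section \<open>Laurent monomials\<close>

definition ymono :: "(nat \<Rightarrow>\<^sub>0 int) \<Rightarrow> 'k::field laurent" where
  "ymono e = single e 1"

lemma ymono_mult: "ymono a * ymono b = ymono (a + b)"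
  by (simp add: ymono_def mult_single)

lemma ymono_0 [simp]: "ymono 0 = 1"
  by (simp add: ymono_def single_one)

lemma ymono_power: "ymono e ^ n = ymono (frag_cmul (int n) e)"
  by (induction n) (simp_all add: ymono_mult frag_cmul_distrib)

lemma ymono_inverse: "ymono (- e) * ymono e = 1" "ymono e * ymono (- e) = 1"
  by (simp_all add: ymono_mult)

lemma ymono_neq_0 [simp]: "ymono e \<noteq> 0"
  unfolding ymono_def by (metis lookup_single_eq lookup_zero zero_neq_one)

definition kc :: "'k \<Rightarrow> 'k::field laurent poly" where
  "kc c = [:single 0 c:]"

interpretation kc: coeff_hom kc
  by standard (simp_all add: kc_def single_add mult_single single_one one_pCons mult.commute)

text \<open>Here \<open>c\<close> may be zero, so that \<open>e\<close> need not be an exponent of \<open>x\<close>.\<close>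

definition top_coeff :: "'k::field laurent \<Rightarrow> (nat \<Rightarrow>\<^sub>0 int) \<Rightarrow> 'k \<Rightarrow> bool" where
  "top_coeff x e c \<longleftrightarrow> (\<forall>e'\<in>keys x. e' \<le> e) \<and> lookup x e = c"

section \<open>Calculus of top coefficients\<close>

lemma top_coeff_add:
  "top_coeff x e c \<Longrightarrow> top_coeff y e c' \<Longrightarrow> top_coeff (x + y) e (c + c')"
  using keys_add[of x y] by (auto simp: top_coeff_def lookup_add)

lemma top_coeff_less: "top_coeff x e c \<Longrightarrow> e < e' \<Longrightarrow> top_coeff x e' 0"
  unfolding top_coeff_def by (metis in_keys_iff leD order.strict_implies_order order.trans)

lemma top_coeff_0 [simp]: "top_coeff 0 e c \<longleftrightarrow> c = 0"
  by (auto simp: top_coeff_def)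

lemma top_coeff_single: "top_coeff (single e c) e c"
  by (auto simp: top_coeff_def)

lemma top_coeff_ymono: "top_coeff (ymono e) e 1"
  by (auto simp: top_coeff_def ymono_def)

lemma top_coeff_unique:
  "top_coeff x e c \<Longrightarrow> top_coeff x e' c' \<Longrightarrow> c \<noteq> 0 \<Longrightarrow> c' \<noteq> 0 \<Longrightarrow> e = e'"
  unfolding top_coeff_def by (metis in_keys_iff order_antisym)

text \<open>Split off the terms of x and y at a and b; the products that involve a remainder cannot
  meet a + b. Uniqueness is assumed instead of maximality so that the lemma serves at the largest
  exponent in \<open>top_coeff_mult\<close> and at both ends of the support in
  \<open>single_of_mult_eq_single\<close>.\<close>

lemma lookup_mult_unique:
  fixes x y :: "'a::cancel_comm_monoid_add \<Rightarrow>\<^sub>0 'b::ring"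
  assumes "\<And>a' b'. a' \<in> keys x \<Longrightarrow> b' \<in> keys y \<Longrightarrow> a' + b' = a + b \<Longrightarrow> a' = a"
  shows "lookup (x * y) (a + b) = lookup x a * lookup y b"
proof -
  let ?x = "x - single a (lookup x a)" and ?y = "y - single b (lookup y b)"
  have zero: "lookup (u * v) (a + b) = 0"
    if "\<And>a' b'. a' \<in> keys u \<Longrightarrow> b' \<in> keys v \<Longrightarrow> a' + b' \<noteq> a + b" for u v :: "'a \<Rightarrow>\<^sub>0 'b"
  proof (rule ccontr)
    assume "lookup (u * v) (a + b) \<noteq> 0"
    then obtain a' b' where "a' \<in> keys u" "b' \<in> keys v" "a + b = a' + b'"
      using keys_mult[of u v] by (auto simp: in_keys_iff)
    then show False using that by metis
  qed
  have x: "a' \<in> keys x \<and> a' \<noteq> a" if "a' \<in> keys ?x" for a'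
    using that by (auto simp: in_keys_iff lookup_minus lookup_single when_def split: if_splits)
  have y: "b' \<noteq> b" if "b' \<in> keys ?y" for b'
    using that by (auto simp: in_keys_iff lookup_minus)
  have "x * y = ?x * y + single a (lookup x a) * ?y + single a (lookup x a) * single b (lookup y b)"
    by (simp add: algebra_simps)
  then have "lookup (x * y) (a + b) = lookup (?x * y) (a + b)
      + lookup (single a (lookup x a) * ?y) (a + b) + lookup x a * lookup y b"
    by (simp add: lookup_add mult_single)
  also have "lookup (?x * y) (a + b) = 0"
    using x assms by (intro zero) blast
  also have "lookup (single a (lookup x a) * ?y) (a + b) = 0"
    using y by (intro zero) (auto split: if_splits)
  finally show ?thesis by simp
qed

lemma top_coeff_mult:
  assumes "top_coeff x e c" "top_coeff y e' c'"
  shows "top_coeff (x * y) (e + e') (c * c')"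
proof -
  have "\<forall>a\<in>keys (x * y). a \<le> e + e'"
    using assms keys_mult[of x y] by (fastforce simp: top_coeff_def intro: add_mono)
  moreover have "lookup (x * y) (e + e') = lookup x e * lookup y e'"
  proof (rule lookup_mult_unique)
    fix a b assume "a \<in> keys x" "b \<in> keys y" and eq: "a + b = e + e'"
    then have "a \<le> e" "b \<le> e'" using assms by (auto simp: top_coeff_def)
    then show "a = e" using eq add_less_le_mono[of a e b e'] by force
  qed
  ultimately show ?thesis using assms by (simp add: top_coeff_def)
qed

text \<open>The largest exponents of the factors add up to an exponent of the product, and so do the
  smallest. If the product has one term, the two sums agree, which leaves the factor x a single
  exponent.\<close>

lemma single_of_mult_eq_single:
  fixes x y :: "'a::linordered_ab_group_add \<Rightarrow>\<^sub>0 'b::idom"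
  assumes "x * y = single e c" "c \<noteq> 0"
  shows "\<exists>e' c'. x = single e' c' \<and> c' \<noteq> 0"
proof -
  have "single e c \<noteq> 0" using assms(2) by (metis lookup_single_eq lookup_zero)
  then have "x \<noteq> 0" "y \<noteq> 0" using assms(1) by auto
  then have ne: "keys x \<noteq> {}" "keys y \<noteq> {}" by simp_all
  have *: "a + b = e" if "a \<in> keys x" "b \<in> keys y"
    "\<And>a' b'. a' \<in> keys x \<Longrightarrow> b' \<in> keys y \<Longrightarrow> a' + b' = a + b \<Longrightarrow> a' = a" for a b
  proof -
    have "lookup (single e c) (a + b) = lookup x a * lookup y b"
      using lookup_mult_unique[of x y a b] that(3) assms(1) by simp
    then show ?thesis using that(1,2) by (auto simp: in_keys_iff lookup_single when_def split: if_splits)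
  qed
  have "Max (keys x) + Max (keys y) = e"
    by (rule *, use ne in simp, use ne in simp)
       (metis Max_ge add_le_less_mono add_less_le_mono finite_keys not_less_iff_gr_or_eq order_le_less)
  moreover have "Min (keys x) + Min (keys y) = e"
    by (rule *, use ne in simp, use ne in simp)
       (metis Min_le add_le_less_mono add_less_le_mono finite_keys not_less_iff_gr_or_eq order_le_less)
  moreover have "Min (keys x) \<le> Max (keys x)" "Min (keys y) \<le> Max (keys y)" using ne by simp_all
  ultimately have eq: "Min (keys x) = Max (keys x)"
    using add_less_le_mono[of "Min (keys x)" "Max (keys x)" "Min (keys y)" "Max (keys y)"] by force
  have "keys x = {Max (keys x)}"
  proof
    show "keys x \<subseteq> {Max (keys x)}"
    proof
      fix a assume "a \<in> keys x"
      then have "a \<le> Max (keys x)" "Min (keys x) \<le> a" by simp_all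
      then show "a \<in> {Max (keys x)}" using eq by simp
    qed
  qed (use ne in simp)
  then obtain a where a: "keys x = {a}" by blast
  have "x = single a (lookup x a)" using sum_single_keys[of x] a by simp
  moreover have "lookup x a \<noteq> 0" using a by (auto simp: in_keys_iff)
  ultimately show ?thesis by blast
qed

lemma top_coeff_sum_all:
  "(\<And>j. j \<in> K \<Longrightarrow> top_coeff (f j) e (c j)) \<Longrightarrow> top_coeff (sum f K) e (sum c K)"
  by (induction K rule: infinite_finite_induct) (auto intro: top_coeff_add)

lemma top_coeff_sum_less:
  assumes "\<And>j. j \<in> K \<Longrightarrow> \<exists>a c. top_coeff (f j) a c \<and> a < e"
  shows "top_coeff (sum f K) e 0"
proof -
  have "top_coeff (f j) e 0" if "j \<in> K" for j
    using assms[OF that] top_coeff_less by blast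
  from top_coeff_sum_all[of K f e "\<lambda>_. 0", OF this] show ?thesis by simp
qed

lemma top_coeff_sum:
  assumes "finite K" "\<alpha> \<in> K" "top_coeff (f \<alpha>) e c"
    and "\<And>j. j \<in> K \<Longrightarrow> j \<noteq> \<alpha> \<Longrightarrow> \<exists>a c. top_coeff (f j) a c \<and> a < e"
  shows "top_coeff (sum f K) e c"
proof -
  have "sum f K = f \<alpha> + sum f (K - {\<alpha>})" using assms by (simp add: sum.remove)
  moreover have "top_coeff (sum f (K - {\<alpha>})) e 0"
    using assms by (intro top_coeff_sum_less) auto
  ultimately show ?thesis using top_coeff_add[OF assms(3)] by fastforce
qed

text \<open>The order on exponents is lexicographic from the smallest index, so a difference at
  index 0 decides.\<close>

lemma less_lookup_0: "lookup a 0 < lookup b (0::nat) \<Longrightarrow> a < (b :: nat \<Rightarrow>\<^sub>0 int)"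
  by (auto simp: less_poly_mapping.rep_eq less_fun_def)

lemma le_lookup_0: "a \<le> (b :: nat \<Rightarrow>\<^sub>0 int) \<Longrightarrow> lookup a 0 \<le> lookup b 0"
  using less_lookup_0[of b a] by force

text \<open>The index \<open>0\<close>, which no \<open>y\<^sub>i\<close> uses, is reserved for \<open>z\<close>.\<close>

definition zfree :: "'k::field laurent \<Rightarrow> bool" where
  "zfree x \<longleftrightarrow> (\<forall>e\<in>keys x. lookup e 0 = 0)"

lemma zfree_0 [simp]: "zfree 0" and zfree_1 [simp]: "zfree 1"
  by (simp_all add: zfree_def)

lemma zfree_single: "lookup e 0 = 0 \<Longrightarrow> zfree (single e c)" by (simp add: zfree_def)

lemma zfree_add: "zfree x \<Longrightarrow> zfree y \<Longrightarrow> zfree (x + y)"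
  using keys_add[of x y] by (auto simp: zfree_def)

lemma zfree_mult: "zfree x \<Longrightarrow> zfree y \<Longrightarrow> zfree (x * y)"
  using keys_mult[of x y] by (fastforce simp: zfree_def lookup_add)

lemma zfree_sum: "(\<And>j. j \<in> K \<Longrightarrow> zfree (f j)) \<Longrightarrow> zfree (sum f K)"
  by (induction K rule: infinite_finite_induct) (auto intro: zfree_add)

definition zfree_coeffs :: "'k::field laurent poly \<Rightarrow> bool" where
  "zfree_coeffs q \<longleftrightarrow> (\<forall>j. zfree (coeff q j))"

lemma zfree_coeffs_add: "zfree_coeffs p \<Longrightarrow> zfree_coeffs q \<Longrightarrow> zfree_coeffs (p + q)"
  by (simp add: zfree_coeffs_def zfree_add)

lemma zfree_coeffs_mult: "zfree_coeffs p \<Longrightarrow> zfree_coeffs q \<Longrightarrow> zfree_coeffs (p * q)"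
  by (simp add: zfree_coeffs_def coeff_mult zfree_sum zfree_mult)

lemma zfree_coeffs_smult: "zfree c \<Longrightarrow> zfree_coeffs q \<Longrightarrow> zfree_coeffs (smult c q)"
  by (simp add: zfree_coeffs_def zfree_mult)

lemma zfree_coeffs_pCons_iff [simp]: "zfree_coeffs (pCons a p) \<longleftrightarrow> zfree a \<and> zfree_coeffs p"
  by (auto simp: zfree_coeffs_def coeff_pCons split: nat.splits)

lemma zfree_coeffs_0 [simp]: "zfree_coeffs 0"
  by (simp add: zfree_coeffs_def)

lemma zfree_coeffs_kc [simp]: "zfree_coeffs (kc c)"
  by (simp add: kc_def zfree_single)

lemma zfree_coeffs_peval:
  assumes "\<And>i. i \<in> I \<Longrightarrow> zfree_coeffs (x i)" "p \<in> polys_in I"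
  shows "zfree_coeffs (peval kc x p)"
  using assms(2)
  by (induction rule: polys_in_induct)
    (simp_all add: kc.peval_hom zfree_coeffs_add zfree_coeffs_mult assms)

text \<open>A polynomial in z over Laurent polynomials is read as one Laurent polynomial with z at
  index 0, so that a single linear order compares exponents in all variables and ranks z
  first.\<close>

definition zsubst :: "'k::field laurent poly \<Rightarrow> 'k laurent" where
  "zsubst q = poly q (ymono (single 0 1))"

lemma zsubst_hom [simp]:
  "zsubst 0 = 0" "zsubst 1 = 1" "zsubst (p + q) = zsubst p + zsubst q"
  "zsubst (p - q) = zsubst p - zsubst q" "zsubst (- p) = - zsubst p"
  "zsubst (p * q) = zsubst p * zsubst q" "zsubst (p ^ n) = zsubst p ^ n"
  "zsubst (smult c p) = c * zsubst p" "zsubst [:c:] = c" "zsubst [:0, 1:] = ymono (single 0 1)"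
  by (simp_all add: zsubst_def)

lemma zsubst_kc [simp]: "zsubst (kc c) = single 0 c"
  by (simp add: kc_def)

lemma zsubst_sum: "zsubst (sum f K) = (\<Sum>j\<in>K. zsubst (f j))"
  by (induction K rule: infinite_finite_induct) auto

lemma keys_zsubst:
  assumes "zfree_coeffs q" "e \<in> keys (zsubst q)"
  shows "0 \<le> lookup e 0" "lookup e 0 \<le> int (degree q)"
proof -
  have "zsubst q = (\<Sum>j\<le>degree q. coeff q j * ymono (single 0 (int j)))"
    by (simp add: zsubst_def poly_altdef ymono_power frag_cmul_single)
  then obtain j where j: "j \<le> degree q" "e \<in> keys (coeff q j * ymono (single 0 (int j)))"
    using assms(2) keys_sum by fastforce
  then obtain a where "a \<in> keys (coeff q j)" "e = a + single 0 (int j)"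
    using keys_mult[of "coeff q j" "ymono (single 0 (int j))"] by (auto simp: ymono_def)
  then have "lookup e 0 = int j" using assms(1) by (auto simp: zfree_coeffs_def zfree_def lookup_add)
  then show "0 \<le> lookup e 0" "lookup e 0 \<le> int (degree q)" using j by auto
qed

section \<open>The embedding into polynomials in z over Laurent polynomials\<close>

context danielewski
begin

definition \<kappa> :: "nat \<Rightarrow>\<^sub>0 int" where
  "\<kappa> = (\<Sum>i\<in>{2..m}. single i (int (k i)))"

definition ux :: "nat \<Rightarrow> 'k laurent poly" where
  "ux i = (if i = m + 1 then [:0, 1:] else [:ymono (single i 1):])"

text \<open>The value at y1 is forced by y1 Y = P, as Y is invertible among the Laurent polynomials.
  P does not involve the first variable, so it can be evaluated by \<open>ux\<close> without
  circularity.\<close>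

definition xv :: "nat \<Rightarrow> 'k laurent poly" where
  "xv i = (if i = 1 then smult (ymono (- \<kappa>)) (peval kc ux P) else ux i)"

definition ev :: "'k mpoly \<Rightarrow> 'k laurent poly" where
  "ev = peval kc xv"

lemma ev_hom [simp]:
  "ev (Const c) = kc c" "ev 0 = 0" "ev 1 = 1" "ev (Var i) = xv i"
  "ev (p + q) = ev p + ev q" "ev (p - q) = ev p - ev q" "ev (- p) = - ev p"
  "ev (p * q) = ev p * ev q" "ev (p ^ n) = ev p ^ n"
  "ev (sum f K) = (\<Sum>j\<in>K. ev (f j))" "ev (prod f K) = (\<Prod>j\<in>K. ev (f j))"
  by (simp_all add: ev_def kc.peval_hom)

lemma xv_z: "xv (m + 1) = [:0, 1:]"
  using m_ge by (simp add: xv_def ux_def)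

lemma xv_y: "i \<in> {2..m} \<Longrightarrow> xv i = [:ymono (single i 1):]"
  by (auto simp: xv_def ux_def)

lemma ev_ux: "p \<in> polys_in {2..m+1} \<Longrightarrow> ev p = peval kc ux p"
  by (rule hom_eqI) (auto simp: kc.peval_hom xv_def)

lemma lookup_\<kappa>: "lookup \<kappa> i = (if i \<in> {2..m} then int (k i) else 0)"
proof -
  have "lookup \<kappa> i = (\<Sum>j\<in>{2..m}. if j = i then int (k j) else 0)"
    by (simp add: \<kappa>_def lookup_sum lookup_single when_def)
  then show ?thesis by simp
qed

lemma prod_ymono: "(\<Prod>i\<in>K. ymono (f i)) = ymono (\<Sum>i\<in>K. f i)"
  by (induction K rule: infinite_finite_induct) (simp_all add: ymono_mult)

lemma prod_const_poly: "(\<Prod>i\<in>K. [:f i:]) = [:\<Prod>i\<in>K. f i:]"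
  by (induction K rule: infinite_finite_induct) (simp_all add: one_pCons mult.commute)

lemma const_poly_power: "[:c:] ^ n = [:c ^ n:]"
  by (induction n) (simp_all add: one_pCons mult.commute)

lemma ev_dmonom: "ev (dmonom m k) = [:ymono \<kappa>:]"
proof -
  have "ev (dmonom m k) = (\<Prod>i\<in>{2..m}. [:ymono (single i (int (k i))):])"
    by (auto simp: dmonom_def xv_y const_poly_power ymono_power frag_cmul_single intro!: prod.cong)
  then show ?thesis by (simp add: prod_const_poly prod_ymono \<kappa>_def)
qed

lemma ev_P: "ev P = peval kc ux P"
  by (rule ev_ux[OF P_in])

lemma xv_1: "xv 1 = smult (ymono (- \<kappa>)) (ev P)"
  by (simp add: xv_def ev_P)

lemma xv_1_mult: "xv 1 * [:ymono \<kappa>:] = ev P"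
  unfolding xv_1 by (simp add: ymono_mult)

lemma ev_F: "ev F = 0"
  using xv_1_mult by (simp add: ev_dmonom)

lemma zfree_ux: "i \<in> {2..m+1} \<Longrightarrow> zfree_coeffs (ux i)"
  by (simp add: ux_def zfree_single ymono_def)

lemma zfree_xv: "i \<in> vs \<Longrightarrow> zfree_coeffs (xv i)"
  using zfree_ux[of i] zfree_coeffs_peval[OF zfree_ux P_in]
  by (auto simp: xv_def ymono_def lookup_\<kappa> intro!: zfree_coeffs_smult zfree_single)

lemma zfree_ev: "p \<in> polys_in vs \<Longrightarrow> zfree_coeffs (ev p)"
  unfolding ev_def by (rule zfree_coeffs_peval[OF zfree_xv])

section \<open>Leading exponents of the generators\<close>

definition vexp :: "nat \<Rightarrow> nat \<Rightarrow>\<^sub>0 int" where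
  "vexp i = (if i = 1 then single 0 (int d) - \<kappa> else if i = m + 1 then single 0 1 else single i 1)"

lemma zfree_ev_R: "p \<in> polys_in {2..m} \<Longrightarrow> \<exists>x. ev p = [:x:] \<and> zfree x"
proof (induction rule: polys_in_induct)
  case (Const a)
  then show ?case by (auto simp: kc_def zfree_single)
next
  case (add p q)
  then show ?case by (auto simp: zfree_add)
next
  case (Var_mult i p)
  then show ?case by (auto simp: xv_y ymono_def intro!: zfree_mult zfree_single)
qed

text \<open>P is monic in z, and every other term has smaller z-degree; as z ranks first, the powers
  of the other variables in the coefficients do not matter.\<close>

lemma top_P: "top_coeff (zsubst (ev P)) (single 0 (int d)) 1"
proof -
  have "top_coeff (zsubst (ev (s j) * xv (m+1) ^ j)) (single 0 (int d)) 0" if "j < d" for j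
  proof -
    obtain x where x: "ev (s j) = [:x:]" "zfree x" using zfree_ev_R[OF s_in[OF \<open>j < d\<close>]] by blast
    have "e < single 0 (int d)" if e: "e \<in> keys (x * ymono (single 0 (int j)))" for e
    proof -
      obtain a where "a \<in> keys x" "e = a + single 0 (int j)"
        using e keys_mult[of x "ymono (single 0 (int j))"] by (auto simp: ymono_def)
      then show ?thesis using x(2) \<open>j < d\<close> by (auto simp: zfree_def lookup_add intro!: less_lookup_0)
    qed
    then have "top_coeff (x * ymono (single 0 (int j))) (single 0 (int d)) 0"
      unfolding top_coeff_def by (metis in_keys_iff order_less_irrefl order_less_imp_le)
    then show ?thesis by (simp add: x xv_z[simplified] ymono_power frag_cmul_single)
  qed
  then have "top_coeff (\<Sum>j<d. zsubst (ev (s j) * xv (m+1) ^ j)) (single 0 (int d)) (\<Sum>j<d. 0)"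
    by (intro top_coeff_sum_all) auto
  then have "top_coeff (ymono (single 0 (int d)) + (\<Sum>j<d. zsubst (ev (s j) * xv (m+1) ^ j)))
      (single 0 (int d)) (1 + 0)"
    by (intro top_coeff_add top_coeff_ymono) simp
  moreover have "zsubst (ev P) = ymono (single 0 (int d)) + (\<Sum>j<d. zsubst (ev (s j) * xv (m+1) ^ j))"
    by (subst P_def) (simp add: xv_z[simplified] ymono_power frag_cmul_single zsubst_sum)
  ultimately show ?thesis by simp
qed

lemma top_xv:
  assumes "i \<in> vs"
  shows "top_coeff (zsubst (xv i)) (vexp i) 1"
proof -
  consider "i = 1" | "i \<in> {2..m}" | "i = m + 1" using assms by force
  then show ?thesis
  proof cases
    case 1
    have "top_coeff (ymono (- \<kappa>) * zsubst (ev P)) (- \<kappa> + single 0 (int d)) (1 * 1)"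
      by (intro top_coeff_mult top_coeff_ymono top_P)
    then show ?thesis using 1 by (simp add: xv_1[simplified] vexp_def)
  qed (use m_ge in \<open>auto simp: xv_y xv_z[simplified] vexp_def intro!: top_coeff_ymono\<close>)
qed

text \<open>The leading exponent of the image of a monomial, see \<open>top_single\<close>.\<close>

definition vv :: "(nat \<Rightarrow>\<^sub>0 nat) \<Rightarrow> (nat \<Rightarrow>\<^sub>0 int)" where
  "vv \<alpha> = (\<Sum>i\<in>vs. frag_cmul (int (lookup \<alpha> i)) (vexp i))"

lemma vv_add: "vv (\<alpha> + \<beta>) = vv \<alpha> + vv \<beta>"
  by (simp add: vv_def lookup_add frag_cmul_distrib sum.distrib)

lemma vv_0 [simp]: "vv 0 = 0"
  by (simp add: vv_def)

lemma vv_single: "i \<in> vs \<Longrightarrow> vv (single i 1) = vexp i"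
proof -
  assume i: "i \<in> vs"
  have "vv (single i 1) = (\<Sum>j\<in>vs. if j = i then vexp i else 0)"
    unfolding vv_def by (intro sum.cong) (auto simp: lookup_single when_def)
  then show ?thesis using i by simp
qed

lemma lookup_vexp_0: "i \<in> vs \<Longrightarrow> lookup (vexp i) 0 = (if i = 1 then int d else if i = m + 1 then 1 else 0)"
  using m_ge by (auto simp: vexp_def lookup_minus lookup_\<kappa> lookup_single when_def)

lemma lookup_vexp_y:
  "i \<in> vs \<Longrightarrow> j \<in> {2..m} \<Longrightarrow>
    lookup (vexp i) j = (if i = 1 then - int (k j) else if i = j then 1 else 0)"
  by (auto simp: vexp_def lookup_minus lookup_\<kappa> lookup_single when_def)

lemma sum_vs: "(\<Sum>i\<in>vs. f i) = f 1 + (\<Sum>i\<in>{2..m}. f i) + f (m + 1)" for f :: "nat \<Rightarrow> 'b::comm_monoid_add"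
proof -
  have "vs = insert 1 (insert (m+1) {2..m})" using m_ge by auto
  then show ?thesis using m_ge by (simp add: ac_simps)
qed

lemma lookup_vv_0: "lookup (vv \<alpha>) 0 = int d * int (lookup \<alpha> 1) + int (lookup \<alpha> (m+1))"
proof -
  have "lookup (vv \<alpha>) 0 = (\<Sum>i\<in>vs. int (lookup \<alpha> i) * (if i = 1 then int d else if i = m + 1 then 1 else 0))"
    unfolding vv_def lookup_sum by (intro sum.cong) (auto simp: lookup_vexp_0[simplified])
  then show ?thesis using m_ge by (subst (asm) sum_vs) simp
qed

lemma lookup_vv_y:
  assumes "j \<in> {2..m}"
  shows "lookup (vv \<alpha>) j = int (lookup \<alpha> j) - int (lookup \<alpha> 1) * int (k j)"
proof -
  have "lookup (vv \<alpha>) j = (\<Sum>i\<in>vs. int (lookup \<alpha> i) * (if i = 1 then - int (k j) else if i = j then 1 else 0))"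
    unfolding vv_def lookup_sum by (intro sum.cong) (use assms in \<open>auto simp: lookup_vexp_y[simplified]\<close>)
  also have "\<dots> = - (int (lookup \<alpha> 1) * int (k j))
      + (\<Sum>i\<in>{2..m}. int (lookup \<alpha> i) * (if i = 1 then - int (k j) else if i = j then 1 else 0))"
    using assms by (subst sum_vs) simp
  also have "(\<Sum>i\<in>{2..m}. int (lookup \<alpha> i) * (if i = 1 then - int (k j) else if i = j then 1 else 0))
      = (\<Sum>i\<in>{2..m}. if i = j then int (lookup \<alpha> i) else 0)"
    by (intro sum.cong) auto
  finally show ?thesis using assms by simp
qed

text \<open>The coordinate at index 0 is d times the y1-degree plus the z-degree. With z-degree less
  than d this is division with remainder, so both are recovered; the other coordinates then give the
  remaining degrees.\<close>

lemma vv_inj: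
  assumes "vv \<alpha> = vv \<beta>" "keys \<alpha> \<subseteq> vs" "keys \<beta> \<subseteq> vs" "lookup \<alpha> (m+1) < d" "lookup \<beta> (m+1) < d"
  shows "\<alpha> = \<beta>"
proof (rule poly_mapping_eqI)
  fix i
  have "int d * int (lookup \<alpha> 1) + int (lookup \<alpha> (m+1)) = int d * int (lookup \<beta> 1) + int (lookup \<beta> (m+1))"
    using arg_cong[OF assms(1), of "\<lambda>v. lookup v 0"] by (simp add: lookup_vv_0)
  then have eq: "d * lookup \<alpha> 1 + lookup \<alpha> (m+1) = d * lookup \<beta> 1 + lookup \<beta> (m+1)"
    by (simp flip: of_nat_mult of_nat_add)
  from arg_cong[OF eq, of "\<lambda>n. n div d"] arg_cong[OF eq, of "\<lambda>n. n mod d"]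
  have 1: "lookup \<alpha> 1 = lookup \<beta> 1" and z: "lookup \<alpha> (m+1) = lookup \<beta> (m+1)"
    using assms(4,5) by auto
  consider "i \<notin> vs" | "i = 1" | "i \<in> {2..m}" | "i = m + 1" by force
  then show "lookup \<alpha> i = lookup \<beta> i"
  proof cases
    case 1
    then show ?thesis using assms(2,3) by (metis in_keys_iff subsetD)
  next
    case 3
    then show ?thesis using arg_cong[OF assms(1), of "\<lambda>v. lookup v i"] 1 by (simp add: lookup_vv_y)
  qed (use 1 z in auto)
qed

lemma top_single:
  assumes "keys \<alpha> \<subseteq> vs"
  shows "top_coeff (zsubst (ev (single \<alpha> a))) (vv \<alpha>) a"
  using assms
proof (induction \<alpha> rule: exponent_induct)
  case zero
  then show ?case using top_coeff_single[of 0 a] by (simp add: Const_def[symmetric])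
next
  case (add i \<beta>)
  have "single (single i 1 + \<beta>) a = Var i * single \<beta> a"
    by (simp add: Var_def mult_single)
  then show ?case using top_coeff_mult[OF top_xv[OF add.hyps(1)] add.IH] add.hyps(1)
    by (simp add: vv_add vv_single[unfolded One_nat_def])
qed

lemma ev_eq_sum: "ev p = (\<Sum>\<alpha>\<in>keys p. ev (single \<alpha> (lookup p \<alpha>)))"
  by (subst sum_single_keys[of p, symmetric]) (simp only: ev_hom)

lemma reducedD: "p \<in> reduced \<Longrightarrow> \<alpha> \<in> keys p \<Longrightarrow> keys \<alpha> \<subseteq> vs \<and> lookup \<alpha> (m+1) < d"
  by (auto simp: reduced_def polys_in_iff)

text \<open>By \<open>vv_inj\<close> the monomials of a reduced polynomial have distinct leading
  exponents, so the largest one belongs to a single monomial and cannot cancel.\<close>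

lemma reduced_top:
  assumes "p \<in> reduced" "p \<noteq> 0"
  obtains \<alpha> where "\<alpha> \<in> keys p" "\<And>\<beta>. \<beta> \<in> keys p \<Longrightarrow> \<beta> \<noteq> \<alpha> \<Longrightarrow> vv \<beta> < vv \<alpha>"
    "top_coeff (zsubst (ev p)) (vv \<alpha>) (lookup p \<alpha>)"
proof -
  have "Max (vv ` keys p) \<in> vv ` keys p" using assms by (intro Max_in) auto
  then obtain \<alpha> where \<alpha>: "\<alpha> \<in> keys p" "vv \<alpha> = Max (vv ` keys p)" by auto
  have less: "vv \<beta> < vv \<alpha>" if "\<beta> \<in> keys p" "\<beta> \<noteq> \<alpha>" for \<beta>
  proof -
    have "vv \<beta> \<le> vv \<alpha>" using \<alpha> that by (auto intro: Max_ge)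
    moreover have "vv \<beta> \<noteq> vv \<alpha>"
      using vv_inj[of \<beta> \<alpha>] reducedD[OF assms(1)] that \<alpha> by blast
    ultimately show ?thesis by simp
  qed
  moreover have "top_coeff (zsubst (ev p)) (vv \<alpha>) (lookup p \<alpha>)"
    unfolding ev_eq_sum[of p] zsubst_sum
  proof (rule top_coeff_sum[where \<alpha>=\<alpha>])
    show "\<exists>a c. top_coeff (zsubst (ev (single j (lookup p j)))) a c \<and> a < vv \<alpha>"
      if "j \<in> keys p" "j \<noteq> \<alpha>" for j
      using that less top_single reducedD[OF assms(1)] by blast
    show "top_coeff (zsubst (ev (single \<alpha> (lookup p \<alpha>)))) (vv \<alpha>) (lookup p \<alpha>)"
      using \<alpha>(1) reducedD[OF assms(1)] by (intro top_single) auto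
  qed (use \<alpha> in auto)
  ultimately show ?thesis using that \<alpha> by blast
qed

lemma reduced_ev_0: "p \<in> reduced \<Longrightarrow> zsubst (ev p) = 0 \<Longrightarrow> p = 0"
  using reduced_top[of p] by (metis in_keys_iff top_coeff_0)

text \<open>F maps to 0, which gives one direction. For the other, pass to reduced representatives:
  their difference is reduced with image 0, hence 0. This is the injectivity of the
  embedding.\<close>

lemma cl_eq_ev:
  assumes "p \<in> polys_in vs" "q \<in> polys_in vs"
  shows "cl p = cl q \<longleftrightarrow> ev p = ev q"
proof
  have ev_eq: "ev p = ev q" if eq: "cl p = cl q" for p q
  proof -
    have "0 \<in> dideal m k P" by (auto simp: dideal_eq intro: exI[of _ 0])
    then have "0 + q \<in> cl q" by (force simp: cl_eq)
    then have "q \<in> cl p" by (simp add: eq)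
    then obtain h where h: "h \<in> dideal m k P" "q = h + p" by (auto simp: cl_eq)
    then obtain r where "h = r * F" by (auto simp: dideal_eq)
    then have "ev h = ev r * ev F" by (simp only: ev_hom)
    then show ?thesis using ev_F h by simp
  qed
  then show "cl p = cl q \<Longrightarrow> ev p = ev q" .
  assume eq: "ev p = ev q"
  obtain p' where p': "p' \<in> reduced" "cl p = cl p'" using ex_reduced[OF assms(1)] by auto
  obtain q' where q': "q' \<in> reduced" "cl q = cl q'" using ex_reduced[OF assms(2)] by auto
  note * = p' q'
  have "ev p' = ev q'" using ev_eq[OF p'(2)] ev_eq[OF q'(2)] eq by simp
  then have "zsubst (ev (p' - q')) = 0" by simp
  then have "p' - q' = 0" using * by (intro reduced_ev_0 reduced_diff)
  then show "cl p = cl q" using * by simp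
qed

text \<open>The leading exponent survives in the image, so its coordinate at index 0 is bounded by
  the degree there. Since z ranks first, no other monomial exceeds it at this coordinate.\<close>

lemma reduced_degree_bound:
  assumes "p \<in> reduced" "degree (ev p) \<le> n" "\<beta> \<in> keys p"
  shows "d * lookup \<beta> 1 + lookup \<beta> (m+1) \<le> n"
proof -
  have "p \<noteq> 0" using assms by auto
  then obtain \<alpha> where \<alpha>: "\<alpha> \<in> keys p" "\<And>\<beta>. \<beta> \<in> keys p \<Longrightarrow> \<beta> \<noteq> \<alpha> \<Longrightarrow> vv \<beta> < vv \<alpha>"
    "top_coeff (zsubst (ev p)) (vv \<alpha>) (lookup p \<alpha>)" using reduced_top[OF assms(1)] by metis
  have "vv \<alpha> \<in> keys (zsubst (ev p))" using \<alpha> by (auto simp: top_coeff_def in_keys_iff)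
  moreover have "zfree_coeffs (ev p)" using assms(1) by (intro zfree_ev) (auto simp: reduced_def)
  ultimately have "lookup (vv \<alpha>) 0 \<le> int n"
    using keys_zsubst(2)[of "ev p" "vv \<alpha>"] assms(2) by linarith
  moreover have "lookup (vv \<beta>) 0 \<le> lookup (vv \<alpha>) 0"
    using \<alpha> assms(3) by (cases "\<beta> = \<alpha>") (auto intro!: le_lookup_0 simp: less_imp_le)
  ultimately have "int d * int (lookup \<beta> 1) + int (lookup \<beta> (m+1)) \<le> int n"
    by (simp add: lookup_vv_0)
  then show ?thesis by (simp flip: of_nat_mult of_nat_add)
qed

end

section \<open>Kernels of locally nilpotent derivations\<close>

text \<open>Excludes a weight \<open>a > 0\<close> of \<open>y\<^sub>i\<close>. Here \<open>b\<close> is the weight of \<open>z\<close>, and \<open>e0\<close> and \<open>ei\<close> are the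
  coordinates at \<open>z\<close> and \<open>y\<^sub>i\<close> of the lattice vector that lowers the weight by one; the assumptions say
  that the leading exponents obtained from \<open>z\<close> and \<open>y\<^sub>i\<close> at weight \<open>0\<close>, and from \<open>z\<close> at weight \<open>1\<close>, lie in
  the monoid. The point is that \<open>-(k e0 + d ei)\<close> divides \<open>k\<close> and \<open>d\<close> and lies in the monoid they generate.\<close>

lemma no_lattice_root:
  fixes d k a b e0 ei r r' t g g' :: int
  assumes "d \<ge> 2" "k \<ge> 2" "a > 0" "b > 0" "g \<ge> 0" "g' \<ge> 0"
    and q: "1 + b * e0 = d * r" "b * ei = - r * k"
    and p: "a * e0 = d * r'" "1 + a * ei = - r' * k"
    and w: "1 + (b - 1) * e0 = d * t + g" "(b - 1) * ei = g' - t * k"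
  shows False
proof -
  define x where "x = - (k * e0 + d * ei)"
  have "b * x = - k * (b * e0) - d * (b * ei)" by (simp add: x_def algebra_simps)
  moreover have "b * e0 = d * r - 1" using q by simp
  ultimately have k: "k = b * x" using q by (simp add: algebra_simps)
  have "a * x = - k * (a * e0) - d * (a * ei)" by (simp add: x_def algebra_simps)
  moreover have "a * ei = - r' * k - 1" using p by simp
  ultimately have d: "d = a * x" using p by (simp add: algebra_simps)
  have x: "x > 0" using k assms(2,4) by (metis not_le mult_nonneg_nonpos order.strict_implies_order zero_less_numeral order_less_le_trans)
  have e0: "(b - 1) * e0 = d * t + g - 1" using w by simp
  \<comment> \<open>Expanding with the equations for z at weight 1 gives
    \<open>x = k * g + d * g'\<close>. Cancelling x leaves \<open>b * g + a * g' = 1\<close> with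
    nonnegative summands, hence b = 1 or a = 1, and then k or d would divide 1.\<close>
  have "x = b * x + (b - 1) * (- x)" by (simp add: algebra_simps)
  also have "\<dots> = k + k * ((b - 1) * e0) + d * ((b - 1) * ei)"
    by (simp add: k[symmetric]) (simp add: x_def algebra_simps)
  also have "\<dots> = k * g + d * g'" by (simp only: e0 w(2)) (simp add: algebra_simps)
  also have "\<dots> = x * (b * g + a * g')" by (subst k, subst d) (simp add: algebra_simps)
  finally have 1: "b * g + a * g' = 1" using x by simp
  have "b * g \<ge> 0" "a * g' \<ge> 0" using assms by auto
  with 1 have "b * g = 1 \<or> a * g' = 1" by linarith
  then consider "b = 1" | "a = 1"
    using assms by (metis pos_zmult_eq_1_iff)
  then show False
  proof cases
    case 1
    then have "ei = - r * k" using q by simp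
    then have "k * (a * r - r') = 1" using p by (simp add: algebra_simps)
    then have "k dvd 1" by (metis dvd_triv_left)
    then show False using assms(2) zdvd_imp_le[of k 1] by simp
  next
    case 2
    then have "e0 = d * r'" using p by simp
    then have "d * (r - b * r') = 1" using q by (simp add: algebra_simps)
    then have "d dvd 1" by (metis dvd_triv_left)
    then show False using assms(1) zdvd_imp_le[of d 1] by simp
  qed
qed

context danielewski
begin

section \<open>The image of the coordinate ring and its subring \<open>R\<close>\<close>

definition B :: "'k laurent poly set" where "B = ev ` polys_in vs"
definition R :: "'k laurent poly set" where "R = ev ` polys_in {2..m}"

lemma R_subset_B: "x \<in> R \<Longrightarrow> x \<in> B"
  unfolding R_def B_def by (auto intro!: imageI elim!: polys_in_mono)

lemma B_kc [simp]: "kc c \<in> B"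
  unfolding B_def by (rule image_eqI[of _ _ "Const c"]) auto

lemma B_xv: "i \<in> vs \<Longrightarrow> xv i \<in> B"
  unfolding B_def by (rule image_eqI[of _ _ "Var i"]) (auto intro: polys_in_Var)

lemma B_closed:
  shows B_add: "x \<in> B \<Longrightarrow> y \<in> B \<Longrightarrow> x + y \<in> B"
    and B_mult: "x \<in> B \<Longrightarrow> y \<in> B \<Longrightarrow> x * y \<in> B"
  unfolding B_def by (force intro: image_eqI[of _ _ "_ + _"] image_eqI[of _ _ "_ * _"] polys_in_intros)+

lemma B_0 [simp]: "0 \<in> B" and B_1 [simp]: "1 \<in> B"
  using B_kc[of 0] B_kc[of 1] by simp_all

lemma kc_m1: "kc (- 1) = - 1"
  by (simp add: kc_def single_uminus single_one one_pCons)

lemma B_uminus: "x \<in> B \<Longrightarrow> - x \<in> B"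
  using B_mult[OF B_kc, of x "- 1"] unfolding kc_m1 by simp

lemma B_power: "x \<in> B \<Longrightarrow> x ^ n \<in> B"
  by (induction n) (auto intro: B_mult)

lemma B_sum: "(\<And>j. j \<in> K \<Longrightarrow> f j \<in> B) \<Longrightarrow> sum f K \<in> B"
  by (induction K rule: infinite_finite_induct) (auto intro: B_add)

lemma B_prod: "(\<And>j. j \<in> K \<Longrightarrow> f j \<in> B) \<Longrightarrow> prod f K \<in> B"
  by (induction K rule: infinite_finite_induct) (auto intro: B_mult)

lemma B_ev: "p \<in> polys_in vs \<Longrightarrow> ev p \<in> B"
  by (simp add: B_def)

lemma B_single: "keys \<alpha> \<subseteq> vs \<Longrightarrow> ev (single \<alpha> a) \<in> B"
  by (rule B_ev) (auto simp: polys_in_iff)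

lemma B_reduced: "x \<in> B \<Longrightarrow> \<exists>p\<in>reduced. x = ev p"
  unfolding B_def using ex_reduced cl_eq_ev by (auto simp: reduced_def)

lemma B_zsubst_0: "x \<in> B \<Longrightarrow> zsubst x = 0 \<Longrightarrow> x = 0"
  using B_reduced[of x] reduced_ev_0 ev_hom(2) by metis

lemma B_induct [consumes 1, case_names kc add xv_mult]:
  assumes "x \<in> B" "\<And>c. Q (kc c)"
    and "\<And>x y. x \<in> B \<Longrightarrow> y \<in> B \<Longrightarrow> Q x \<Longrightarrow> Q y \<Longrightarrow> Q (x + y)"
    and "\<And>i x. i \<in> vs \<Longrightarrow> x \<in> B \<Longrightarrow> Q x \<Longrightarrow> Q (xv i * x)"
  shows "Q x"
proof -
  obtain p where "p \<in> polys_in vs" "x = ev p" using assms(1) by (auto simp: B_def)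
  moreover have "Q (ev p)" if "p \<in> polys_in vs"
    using that
  proof (induction rule: polys_in_induct)
    case (add p q)
    then show ?case using assms(3)[of "ev p" "ev q"] B_ev by simp
  next
    case (Var_mult i p)
    then show ?case using assms(4)[of i "ev p"] B_ev by simp
  qed (simp add: assms)
  ultimately show ?thesis by blast
qed

end

text \<open>To be applied to conjugates of the canonical derivation by automorphisms, whose values
  outside \<open>B\<close> are arbitrary; hence the laws are restricted to \<open>B\<close>.\<close>

locale danielewski_lnd = danielewski m d k s P
  for m d :: nat and k :: "nat \<Rightarrow> nat" and s :: "nat \<Rightarrow> 'k::field_char_0 mpoly" and P :: "'k mpoly" +
  fixes \<Delta> :: "'k laurent poly \<Rightarrow> 'k laurent poly"
  assumes del_B: "x \<in> B \<Longrightarrow> \<Delta> x \<in> B"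
    and del_add: "x \<in> B \<Longrightarrow> y \<in> B \<Longrightarrow> \<Delta> (x + y) = \<Delta> x + \<Delta> y"
    and del_mult: "x \<in> B \<Longrightarrow> y \<in> B \<Longrightarrow> \<Delta> (x * y) = \<Delta> x * y + x * \<Delta> y"
    and del_kc: "\<Delta> (kc c) = 0"
    and del_nilp: "x \<in> B \<Longrightarrow> \<exists>n. (\<Delta> ^^ n) x = 0"
    and del_nz: "\<exists>x\<in>B. \<Delta> x \<noteq> 0"
begin

lemma del_0 [simp]: "\<Delta> 0 = 0" and del_1 [simp]: "\<Delta> 1 = 0"
  using del_kc[of 0] del_kc[of 1] by simp_all

lemma del_sum: "(\<And>j. j \<in> K \<Longrightarrow> f j \<in> B) \<Longrightarrow> \<Delta> (sum f K) = (\<Sum>j\<in>K. \<Delta> (f j))"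
  by (induction K rule: infinite_finite_induct) (simp_all add: del_add B_sum)

lemma del_kc_mult: "x \<in> B \<Longrightarrow> \<Delta> (kc c * x) = kc c * \<Delta> x"
  by (simp add: del_mult del_kc)

section \<open>The leading part of a locally nilpotent derivation\<close>

definition le :: "'k laurent poly \<Rightarrow> (nat \<Rightarrow>\<^sub>0 int)" where
  "le x = Max (keys (zsubst x))"

text \<open>Generators killed by \<Delta> are left out because \<open>le\<close> is meaningless at
  0; some generator remains by \<open>ex_del_xv\<close>. A generator displaced by less than
  \<open>shift\<close> gets \<open>lam i = 0\<close>.\<close>

definition shift :: "nat \<Rightarrow>\<^sub>0 int" where
  "shift = Max ((\<lambda>i. le (\<Delta> (xv i)) - vexp i) ` {i\<in>vs. \<Delta> (xv i) \<noteq> 0})"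

definition lam :: "nat \<Rightarrow> 'k" where
  "lam i = lookup (zsubst (\<Delta> (xv i))) (vexp i + shift)"

text \<open>Here l may be 0: \<open>\<mu> + shift\<close> only bounds the exponents of
  \<open>\<Delta> x\<close>. Admitting 0 makes the notion closed under products, with l
  additive.\<close>

definition good :: "'k laurent poly \<Rightarrow> (nat \<Rightarrow>\<^sub>0 int) \<Rightarrow> 'k \<Rightarrow> bool" where
  "good x \<mu> l \<longleftrightarrow> x \<in> B \<and> top_coeff (zsubst x) \<mu> 1 \<and> top_coeff (zsubst (\<Delta> x)) (\<mu> + shift) l"

lemma le_key: "x \<in> B \<Longrightarrow> x \<noteq> 0 \<Longrightarrow> le x \<in> keys (zsubst x)"
  unfolding le_def using B_zsubst_0 by (intro Max_in) auto

lemma key_le: "\<mu> \<in> keys (zsubst x) \<Longrightarrow> \<mu> \<le> le x"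
  unfolding le_def by (intro Max_ge) auto

lemma ex_del_xv: "\<exists>i\<in>vs. \<Delta> (xv i) \<noteq> 0"
proof (rule ccontr)
  assume *: "\<not> ?thesis"
  have "\<Delta> x = 0" if "x \<in> B" for x
    using that
  proof (induction rule: B_induct)
    case (xv_mult i x)
    then show ?case using * by (subst del_mult) (auto simp: B_xv[simplified])
  qed (simp_all add: del_kc del_add)
  then show False using del_nz by blast
qed

text \<open>The maximum that defines \<open>shift\<close> is attained, and there \<open>lam\<close>
  is a leading coefficient.\<close>

lemma ex_lam: "\<exists>i\<in>vs. lam i \<noteq> 0"
proof -
  have "shift \<in> (\<lambda>i. le (\<Delta> (xv i)) - vexp i) ` {i\<in>vs. \<Delta> (xv i) \<noteq> 0}"
    unfolding shift_def using ex_del_xv by (intro Max_in) auto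
  then obtain i where i: "i \<in> vs" "\<Delta> (xv i) \<noteq> 0" "shift = le (\<Delta> (xv i)) - vexp i" by blast
  then have "lam i = lookup (zsubst (\<Delta> (xv i))) (le (\<Delta> (xv i)))" by (simp add: lam_def)
  also have "\<dots> \<noteq> 0" using le_key[OF del_B[OF B_xv[OF i(1)]] i(2)] by (simp add: in_keys_iff)
  finally show ?thesis using i by blast
qed

lemma good_xv:
  assumes "i \<in> vs"
  shows "good (xv i) (vexp i) (lam i)"
proof -
  have "\<mu> \<le> vexp i + shift" if "\<mu> \<in> keys (zsubst (\<Delta> (xv i)))" for \<mu>
  proof -
    have "\<Delta> (xv i) \<noteq> 0" using that by auto
    then have "le (\<Delta> (xv i)) - vexp i \<le> shift"
      unfolding shift_def using assms by (intro Max_ge) auto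
    then show ?thesis using key_le[OF that] by (simp add: diff_le_eq add.commute)
  qed
  then show ?thesis
    using assms top_xv[OF assms] B_xv[OF assms] by (auto simp: good_def lam_def top_coeff_def)
qed

lemma good_1: "good 1 0 0"
  using top_coeff_ymono[of 0] by (simp add: good_def)

text \<open>Both summands of the Leibniz rule are bounded by \<open>\<mu> + \<nu> + shift\<close>;
  as x and y have leading coefficient 1, they contribute l and l' there.\<close>

lemma good_mult:
  assumes "good x \<mu> l" "good y \<nu> l'"
  shows "good (x * y) (\<mu> + \<nu>) (l + l')"
proof -
  have "top_coeff (zsubst (\<Delta> x) * zsubst y) (\<mu> + shift + \<nu>) (l * 1)"
    "top_coeff (zsubst x * zsubst (\<Delta> y)) (\<mu> + (\<nu> + shift)) (1 * l')"
    "top_coeff (zsubst x * zsubst y) (\<mu> + \<nu>) (1 * 1)"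
    using assms by (auto simp only: good_def intro!: top_coeff_mult)
  moreover from this have "top_coeff (zsubst (\<Delta> x) * zsubst y + zsubst x * zsubst (\<Delta> y))
      (\<mu> + \<nu> + shift) (l + l')"
    by (intro top_coeff_add) (simp_all add: ac_simps)
  ultimately show ?thesis
    using assms by (simp add: good_def del_mult B_mult)
qed

lemma good_power: "good x \<mu> l \<Longrightarrow> good (x ^ n) (frag_cmul (int n) \<mu>) (of_nat n * l)"
proof (induction n)
  case (Suc n)
  then show ?case using good_mult[of x \<mu> l "x ^ n"] by (simp add: frag_cmul_distrib distrib_right)
qed (simp add: good_1)

lemma good_prod:
  "(\<And>j. j \<in> K \<Longrightarrow> good (f j) (g j) (l j)) \<Longrightarrow> good (prod f K) (sum g K) (sum l K)"
  by (induction K rule: infinite_finite_induct) (auto intro: good_mult good_1)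

definition Lam :: "(nat \<Rightarrow>\<^sub>0 nat) \<Rightarrow> 'k" where
  "Lam \<alpha> = (\<Sum>i\<in>vs. of_nat (lookup \<alpha> i) * lam i)"

lemma Lam_add: "Lam (\<alpha> + \<beta>) = Lam \<alpha> + Lam \<beta>"
  by (simp add: Lam_def lookup_add distrib_right sum.distrib)

lemma Lam_single: "i \<in> vs \<Longrightarrow> Lam (single i 1) = lam i"
proof -
  assume i: "i \<in> vs"
  have "Lam (single i 1) = (\<Sum>j\<in>vs. if j = i then lam i else 0)"
    unfolding Lam_def by (intro sum.cong) (auto simp: lookup_single when_def)
  then show ?thesis using i by simp
qed

lemma good_single: "keys \<alpha> \<subseteq> vs \<Longrightarrow> good (ev (single \<alpha> 1)) (vv \<alpha>) (Lam \<alpha>)"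
proof (induction \<alpha> rule: exponent_induct)
  case zero
  have "Lam 0 = 0" by (simp add: Lam_def)
  then show ?case using good_1 by (simp add: single_one)
next
  case (add i \<beta>)
  have "single (single i 1 + \<beta>) 1 = Var i * (single \<beta> 1 :: 'k mpoly)"
    by (simp add: Var_def mult_single)
  then show ?case using good_mult[OF good_xv[OF add.hyps(1)] add.IH] add.hyps(1)
    by (simp add: vv_add vv_single[unfolded One_nat_def] Lam_add Lam_single[unfolded One_nat_def])
qed

lemma top_del_single:
  assumes "keys \<alpha> \<subseteq> vs"
  shows "top_coeff (zsubst (\<Delta> (ev (single \<alpha> a)))) (vv \<alpha> + shift) (a * Lam \<alpha>)"
proof -
  have "single \<alpha> a = Const a * single \<alpha> 1" by (simp add: Const_mult_single)
  then have "ev (single \<alpha> a) = kc a * ev (single \<alpha> 1)" by simp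
  then have "\<Delta> (ev (single \<alpha> a)) = kc a * \<Delta> (ev (single \<alpha> 1))"
    using assms by (simp add: del_kc_mult B_single)
  moreover have "top_coeff (single 0 a * zsubst (\<Delta> (ev (single \<alpha> 1)))) (0 + (vv \<alpha> + shift)) (a * Lam \<alpha>)"
    using good_single[OF assms] by (intro top_coeff_mult top_coeff_single) (auto simp: good_def)
  ultimately show ?thesis by simp
qed

lemma del_ev_eq_sum:
  "p \<in> polys_in vs \<Longrightarrow> \<Delta> (ev p) = (\<Sum>\<beta>\<in>keys p. \<Delta> (ev (single \<beta> (lookup p \<beta>))))"
  by (subst ev_eq_sum, rule del_sum, rule B_single) (simp add: polys_in_iff)

lemma top_del_less:
  assumes "p \<in> polys_in vs" "\<And>\<beta>. \<beta> \<in> keys p \<Longrightarrow> vv \<beta> < \<mu>"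
  shows "top_coeff (zsubst (\<Delta> (ev p))) (\<mu> + shift) 0"
  unfolding del_ev_eq_sum[OF assms(1)] zsubst_sum
proof (rule top_coeff_sum_less)
  fix \<beta> assume "\<beta> \<in> keys p"
  then show "\<exists>a c. top_coeff (zsubst (\<Delta> (ev (single \<beta> (lookup p \<beta>))))) a c \<and> a < \<mu> + shift"
    using top_del_single[of \<beta>] assms by (intro exI conjI) (auto simp: polys_in_iff)
qed

text \<open>The counterpart of \<open>reduced_top\<close> for \<Delta>: all bounds are displaced by
  the same \<open>shift\<close>, so the leading monomial still dominates. The coefficient found
  there vanishes exactly if \<open>Lam \<alpha> = 0\<close>.\<close>

lemma top_del:
  assumes "x \<in> B" "x \<noteq> 0"
  obtains p \<alpha> c where "p \<in> reduced" "x = ev p" "\<alpha> \<in> keys p"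
    "\<And>\<beta>. \<beta> \<in> keys p \<Longrightarrow> vv \<beta> \<le> vv \<alpha>" "c \<noteq> 0" "keys \<alpha> \<subseteq> vs"
    "top_coeff (zsubst x) (vv \<alpha>) c" "top_coeff (zsubst (\<Delta> x)) (vv \<alpha> + shift) (c * Lam \<alpha>)"
proof -
  obtain p where p: "p \<in> reduced" "x = ev p" using B_reduced assms by blast
  moreover from this assms have "p \<noteq> 0" by auto
  ultimately obtain \<alpha> where \<alpha>: "\<alpha> \<in> keys p" "\<And>\<beta>. \<beta> \<in> keys p \<Longrightarrow> \<beta> \<noteq> \<alpha> \<Longrightarrow> vv \<beta> < vv \<alpha>"
    "top_coeff (zsubst (ev p)) (vv \<alpha>) (lookup p \<alpha>)" using reduced_top by metis
  have pin: "p \<in> polys_in vs" using p by (simp add: reduced_def)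
  have "top_coeff (zsubst (\<Delta> (ev p))) (vv \<alpha> + shift) (lookup p \<alpha> * Lam \<alpha>)"
    unfolding del_ev_eq_sum[OF pin] zsubst_sum
  proof (rule top_coeff_sum[where \<alpha>=\<alpha>])
    fix \<beta> assume "\<beta> \<in> keys p" "\<beta> \<noteq> \<alpha>"
    then show "\<exists>a c. top_coeff (zsubst (\<Delta> (ev (single \<beta> (lookup p \<beta>))))) a c \<and> a < vv \<alpha> + shift"
      using top_del_single[of \<beta>] \<alpha> reducedD[OF p(1)] by (intro exI conjI) auto
  next
    show "top_coeff (zsubst (\<Delta> (ev (single \<alpha> (lookup p \<alpha>))))) (vv \<alpha> + shift) (lookup p \<alpha> * Lam \<alpha>)"
      using \<alpha>(1) reducedD[OF p(1)] by (intro top_del_single) auto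
  qed (use \<alpha> in auto)
  then show thesis
    using p \<alpha> reducedD[OF p(1) \<alpha>(1)]
    by (intro that[of p \<alpha> "lookup p \<alpha>"]) (auto simp: in_keys_iff less_imp_le, metis order.refl less_imp_le)
qed

text \<open>Apply \<Delta> to y1 Y = P and compare coefficients at the leading exponent of z^d
  displaced by \<open>shift\<close>; the lower terms of P contribute 0 there by
  \<open>top_del_less\<close>.\<close>

lemma lam_relation: "lam 1 + (\<Sum>i\<in>{2..m}. of_nat (k i) * lam i) = of_nat d * lam (m + 1)"
proof -
  have "good (xv i ^ k i) (single i (int (k i))) (of_nat (k i) * lam i)" if "i \<in> {2..m}" for i
    using good_power[OF good_xv[of i], of "k i"] that by (simp add: vexp_def frag_cmul_single)
  then have "good (\<Prod>i\<in>{2..m}. xv i ^ k i) \<kappa> (\<Sum>i\<in>{2..m}. of_nat (k i) * lam i)"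
    unfolding \<kappa>_def by (rule good_prod)
  moreover have "ev (dmonom m k) = (\<Prod>i\<in>{2..m}. xv i ^ k i)" by (simp add: dmonom_def)
  ultimately have "good [:ymono \<kappa>:] \<kappa> (\<Sum>i\<in>{2..m}. of_nat (k i) * lam i)"
    by (simp add: ev_dmonom)
  then have "good (xv 1 * [:ymono \<kappa>:]) (vexp 1 + \<kappa>) (lam 1 + (\<Sum>i\<in>{2..m}. of_nat (k i) * lam i))"
    by (intro good_mult good_xv) auto
  then have 1: "good (ev P) (single 0 (int d)) (lam 1 + (\<Sum>i\<in>{2..m}. of_nat (k i) * lam i))"
    by (simp only: xv_1_mult) (simp add: vexp_def)
  have "vexp (m + 1) = single 0 1" using m_ge by (simp add: vexp_def)
  then have 2: "good (xv (m+1) ^ d) (single 0 (int d)) (of_nat d * lam (m + 1))"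
    using good_power[OF good_xv[of "m + 1"], of d] by (simp add: frag_cmul_single)
  let ?g = "\<Sum>j<d. s j * Var (m+1) ^ j"
  have g: "?g \<in> reduced" by (rule reduced_sZ)
  have g': "?g \<in> polys_in {2..m+1}"
    using m_ge by (auto intro!: polys_in_intros polys_in_mono[OF s_in])
  have "vv \<beta> < single 0 (int d)" if "\<beta> \<in> keys ?g" for \<beta>
  proof (rule less_lookup_0)
    have "lookup \<beta> 1 = 0" using keys_polys_in[OF g' that] by simp
    then show "lookup (vv \<beta>) 0 < lookup (single 0 (int d)) 0"
      using reducedD[OF g that] by (simp add: lookup_vv_0[simplified])
  qed
  then have "top_coeff (zsubst (\<Delta> (ev ?g))) (single 0 (int d) + shift) 0"
    using g by (intro top_del_less) (auto simp: reduced_def)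
  then have "top_coeff (zsubst (\<Delta> (xv (m+1) ^ d)) + zsubst (\<Delta> (ev ?g))) (single 0 (int d) + shift)
      (of_nat d * lam (m + 1) + 0)"
    using 2 by (intro top_coeff_add) (auto simp: good_def)
  moreover have "ev P = xv (m+1) ^ d + ev ?g"
    by (subst P_def) (simp only: ev_hom)
  then have "\<Delta> (ev P) = \<Delta> (xv (m+1) ^ d) + \<Delta> (ev ?g)"
    using g by (auto intro!: del_add B_power B_xv B_ev simp only: reduced_def) (auto intro!: B_xv B_power)
  ultimately show ?thesis using 1 by (simp add: good_def top_coeff_def)
qed

text \<open>The linear extension of \<open>Lam\<close> to the lattice. It is written without
  \<open>lam 1\<close>; agreement at y1 is what \<open>lam_relation\<close> provides, see
  \<open>L_vv\<close>.\<close>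

definition L :: "(nat \<Rightarrow>\<^sub>0 int) \<Rightarrow> 'k" where
  "L \<mu> = (\<Sum>i\<in>{2..m}. of_int (lookup \<mu> i) * lam i) + of_int (lookup \<mu> 0) * lam (m + 1)"

lemma L_add: "L (\<mu> + \<nu>) = L \<mu> + L \<nu>"
  by (simp add: L_def lookup_add distrib_right sum.distrib)

lemma L_cmul: "L (frag_cmul a \<mu>) = of_int a * L \<mu>"
  by (simp add: L_def sum_distrib_left distrib_left mult.assoc)

lemma L_vv: "L (vv \<alpha>) = Lam \<alpha>"
proof -
  have lam1: "lam 1 = of_nat d * lam (m + 1) - (\<Sum>i\<in>{2..m}. of_nat (k i) * lam i)"
    using lam_relation by (simp add: algebra_simps)
  have "L (vv \<alpha>) = (\<Sum>i\<in>{2..m}. of_nat (lookup \<alpha> i) * lam i - of_nat (lookup \<alpha> 1) * (of_nat (k i) * lam i))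
      + (of_nat d * of_nat (lookup \<alpha> 1) + of_nat (lookup \<alpha> (m+1))) * lam (m + 1)"
    unfolding L_def by (intro arg_cong2[of _ _ _ _ "(+)"] sum.cong)
      (auto simp: lookup_vv_y[simplified] lookup_vv_0[simplified] algebra_simps)
  also have "\<dots> = Lam \<alpha>"
    unfolding Lam_def sum_vs lam1 by (simp add: sum_subtractf sum_distrib_left algebra_simps)
  finally show ?thesis .
qed

text \<open>While \<open>L\<close> is nonzero at the leading exponent, \<Delta> moves that exponent
  by exactly \<open>shift\<close>. Nilpotency stops this, so the chain reaches an exponent where
  \<open>L\<close> vanishes, and every exponent on the way is the leading exponent of an element of
  \<open>B\<close>.\<close>

lemma nilpotent_string:
  assumes "x \<in> B" "top_coeff (zsubst x) \<mu> c" "c \<noteq> 0" "(\<Delta> ^^ N) x = 0"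
  shows "\<exists>n. L \<mu> + of_nat n * L shift = 0 \<and>
    (\<forall>j\<le>n. \<exists>\<alpha>. keys \<alpha> \<subseteq> vs \<and> vv \<alpha> = \<mu> + frag_cmul (int j) shift)"
  using assms
proof (induction N arbitrary: x \<mu> c)
  case (Suc N)
  then have "x \<noteq> 0" by auto
  then obtain \<alpha> a where \<alpha>: "a \<noteq> 0" "keys \<alpha> \<subseteq> vs" "top_coeff (zsubst x) (vv \<alpha>) a"
    "top_coeff (zsubst (\<Delta> x)) (vv \<alpha> + shift) (a * Lam \<alpha>)" using top_del Suc.prems(1) by metis
  have \<mu>: "\<mu> = vv \<alpha>" using top_coeff_unique \<alpha> Suc.prems by blast
  show ?case
  proof (cases "Lam \<alpha> = 0")
    case True
    then show ?thesis using \<mu> \<alpha> by (intro exI[of _ 0]) (auto simp: L_vv)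
  next
    case False
    have "(\<Delta> ^^ N) (\<Delta> x) = 0" using Suc.prems(4) by (simp add: funpow_swap1)
    then obtain n where n: "L (\<mu> + shift) + of_nat n * L shift = 0"
      "\<forall>j\<le>n. \<exists>\<alpha>. keys \<alpha> \<subseteq> vs \<and> vv \<alpha> = \<mu> + shift + frag_cmul (int j) shift"
      using Suc.IH[of "\<Delta> x" "\<mu> + shift" "a * Lam \<alpha>"] \<alpha> False \<mu> del_B Suc.prems(1) by auto
    have "\<exists>\<beta>. keys \<beta> \<subseteq> vs \<and> vv \<beta> = \<mu> + frag_cmul (int j) shift" if "j \<le> Suc n" for j
    proof (cases j)
      case 0
      then show ?thesis using \<mu> \<alpha> by auto
    next
      case (Suc i)
      then show ?thesis using n(2)[rule_format, of i] that by (simp add: frag_cmul_distrib add.assoc)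
    qed
    then show ?thesis using n(1) by (intro exI[of _ "Suc n"]) (simp add: L_add algebra_simps)
  qed
qed (auto simp: top_coeff_def)

lemma string:
  assumes "keys \<alpha> \<subseteq> vs"
  shows "\<exists>n. Lam \<alpha> + of_nat n * L shift = 0 \<and>
    (\<forall>j\<le>n. \<exists>\<beta>. keys \<beta> \<subseteq> vs \<and> vv \<beta> = vv \<alpha> + frag_cmul (int j) shift)"
proof -
  note g = good_single[OF assms]
  obtain N where "(\<Delta> ^^ N) (ev (single \<alpha> 1)) = 0" using del_nilp g by (auto simp: good_def)
  from nilpotent_string[OF _ _ _ this, of "vv \<alpha>" 1] g show ?thesis by (auto simp: good_def L_vv)
qed

section \<open>The weight attached to a locally nilpotent derivation\<close>

definition wt :: "nat \<Rightarrow> nat" where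
  "wt i = (SOME n. lam i + of_nat n * L shift = 0)"

definition weight :: "(nat \<Rightarrow>\<^sub>0 nat) \<Rightarrow> nat" where
  "weight \<alpha> = (\<Sum>i\<in>vs. lookup \<alpha> i * wt i)"

lemma lam_wt: "i \<in> vs \<Longrightarrow> lam i = - (of_nat (wt i) * L shift)"
proof -
  assume i: "i \<in> vs"
  then have "\<exists>n. lam i + of_nat n * L shift = 0"
    using string[of "single i 1"] Lam_single[OF i] by auto
  then have "lam i + of_nat (wt i) * L shift = 0" unfolding wt_def by (rule someI_ex)
  then show ?thesis by (simp add: eq_neg_iff_add_eq_0)
qed

text \<open>Otherwise \<open>lam_wt\<close> would make every \<open>lam i\<close> zero, against
  \<open>ex_lam\<close>.\<close>

lemma L_shift_nz: "L shift \<noteq> 0"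
  using ex_lam lam_wt by fastforce

lemma Lam_weight: "Lam \<alpha> = - (of_nat (weight \<alpha>) * L shift)"
proof -
  have "Lam \<alpha> = (\<Sum>i\<in>vs. - (of_nat (lookup \<alpha> i * wt i) * L shift))"
    unfolding Lam_def by (intro sum.cong) (simp_all only: lam_wt of_nat_mult mult.assoc mult_minus_right)
  then show ?thesis by (simp only: sum_negf weight_def of_nat_sum sum_distrib_right)
qed

text \<open>As \<open>L shift\<close> is nonzero and the characteristic is zero, the length of the
  chain in \<open>string\<close> is the weight of its start, and each move lowers the weight by
  one.\<close>

lemma weight_string:
  assumes "keys \<alpha> \<subseteq> vs" "j \<le> weight \<alpha>"
  obtains \<beta> where "keys \<beta> \<subseteq> vs" "vv \<beta> = vv \<alpha> + frag_cmul (int j) shift" "weight \<beta> + j = weight \<alpha>"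
proof -
  obtain n where n: "Lam \<alpha> + of_nat n * L shift = 0"
    "\<forall>j\<le>n. \<exists>\<beta>. keys \<beta> \<subseteq> vs \<and> vv \<beta> = vv \<alpha> + frag_cmul (int j) shift"
    using string[OF assms(1)] by blast
  from n(1) have "n = weight \<alpha>" using L_shift_nz by (simp add: Lam_weight)
  with n assms obtain \<beta> where \<beta>: "keys \<beta> \<subseteq> vs" "vv \<beta> = vv \<alpha> + frag_cmul (int j) shift" by blast
  then have "Lam \<beta> = Lam \<alpha> + of_nat j * L shift" by (simp add: L_vv[symmetric] L_add L_cmul)
  then have "(of_nat (weight \<beta> + j) - of_nat (weight \<alpha>)) * L shift = 0"
    by (simp add: Lam_weight algebra_simps)
  then have "weight \<beta> + j = weight \<alpha>" using L_shift_nz by (simp flip: of_nat_add)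
  with \<beta> show thesis using that by blast
qed

lemma wt_relation: "wt 1 + (\<Sum>i\<in>{2..m}. k i * wt i) = d * wt (m + 1)"
proof -
  have "(\<Sum>i\<in>{2..m}. of_nat (k i) * lam i) = (\<Sum>i\<in>{2..m}. - (of_nat (k i * wt i) * L shift))"
    by (intro sum.cong) (simp_all add: lam_wt)
  also have "\<dots> = - (of_nat (\<Sum>i\<in>{2..m}. k i * wt i) * L shift)"
    by (simp only: sum_negf of_nat_sum sum_distrib_right)
  finally have "(of_nat (wt 1 + (\<Sum>i\<in>{2..m}. k i * wt i)) - of_nat (d * wt (m + 1))) * L shift = 0"
    using lam_relation lam_wt[of 1] lam_wt[of "m + 1"] by (simp add: algebra_simps)
  then have "of_nat (wt 1 + (\<Sum>i\<in>{2..m}. k i * wt i)) = (of_nat (d * wt (m + 1)) :: 'k)"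
    using L_shift_nz by simp
  then show ?thesis by (simp only: of_nat_eq_iff)
qed

lemma weight_single: "i \<in> vs \<Longrightarrow> weight (single i 1) = wt i"
proof -
  assume i: "i \<in> vs"
  have "weight (single i 1) = (\<Sum>j\<in>vs. if j = i then wt i else 0)"
    unfolding weight_def by (intro sum.cong) (auto simp: lookup_single when_def)
  then show ?thesis using i by simp
qed

lemma weight_0D: "weight \<alpha> = 0 \<Longrightarrow> i \<in> vs \<Longrightarrow> wt i > 0 \<Longrightarrow> lookup \<alpha> i = 0"
proof -
  assume "weight \<alpha> = 0" "i \<in> vs" "wt i > 0"
  moreover from this have "lookup \<alpha> i * wt i = 0" unfolding weight_def by (subst (asm) sum_eq_0_iff) blast+
  ultimately show ?thesis by simp
qed

text \<open>A positive weight of y_i makes the weight of z positive by \<open>wt_relation\<close>.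
  The chains from z and y_i down to weight 0, and from z down to weight 1, read at the coordinates
  of z and y_i, satisfy the equations refuted by \<open>no_lattice_root\<close>.\<close>

lemma wt_y: assumes i: "i \<in> {2..m}" shows "wt i = 0"
proof (rule ccontr)
  assume pos: "wt i \<noteq> 0"
  have iv: "i \<in> vs" and zv: "m + 1 \<in> vs" using i by auto
  have "0 < k i * wt i" using pos k_ge[OF i] by simp
  also have "\<dots> \<le> (\<Sum>i\<in>{2..m}. k i * wt i)" using i by (intro member_le_sum) auto
  also have "\<dots> \<le> d * wt (m + 1)" using wt_relation by linarith
  finally have b: "wt (m + 1) > 0" by (cases "wt (m + 1)") auto
  have sz: "vv (single (m+1) 1) = single 0 1" and si: "vv (single i 1) = single i 1"
    using vv_single[OF zv] vv_single[OF iv] i m_ge by (auto simp: vexp_def)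
  obtain q where q: "vv q = single 0 1 + frag_cmul (int (wt (m+1))) shift" "weight q = 0"
    using weight_string[of "single (m+1) 1" "wt (m+1)"] weight_single[OF zv] sz by auto
  obtain p where p: "vv p = single i 1 + frag_cmul (int (wt i)) shift" "weight p = 0"
    using weight_string[of "single i 1" "wt i"] weight_single[OF iv] si iv by auto
  obtain w where w: "vv w = single 0 1 + frag_cmul (int (wt (m+1) - 1)) shift"
    using weight_string[of "single (m+1) 1" "wt (m+1) - 1"] weight_single[OF zv] sz by auto
  \<comment> \<open>An exponent of weight 0 involves no generator of positive weight, so z and y_i
    are absent from \<open>q\<close> and \<open>p\<close>. The exponent \<open>w\<close> of weight 1
    may involve them.\<close>
  have q0: "lookup q (m+1) = 0" "lookup q i = 0" using weight_0D[OF q(2)] iv zv pos b by blast+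
  have p0: "lookup p (m+1) = 0" "lookup p i = 0" using weight_0D[OF p(2)] iv zv pos b by blast+
  have i0: "i \<noteq> 0" using i by simp
  note lk = lookup_add lookup_single when_def lookup_vv_0 lookup_vv_y[OF i]
  show False
  proof (rule no_lattice_root[of "int d" "int (k i)" "int (wt i)" "int (wt (m+1))"
        "int (lookup w (m+1))" "int (lookup w i)"])
    show "1 + int (wt (m+1)) * lookup shift 0 = int d * int (lookup q 1)"
      using arg_cong[OF q(1), of "\<lambda>v. lookup v 0"] q0 by (simp add: lk)
    show "int (wt (m+1)) * lookup shift i = - int (lookup q 1) * int (k i)"
      using arg_cong[OF q(1), of "\<lambda>v. lookup v i"] q0 i0 by (simp add: lk)
    show "int (wt i) * lookup shift 0 = int d * int (lookup p 1)"
      using arg_cong[OF p(1), of "\<lambda>v. lookup v 0"] p0 i0 by (simp add: lk)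
    show "1 + int (wt i) * lookup shift i = - int (lookup p 1) * int (k i)"
      using arg_cong[OF p(1), of "\<lambda>v. lookup v i"] p0 i0 by (simp add: lk)
    show "1 + (int (wt (m+1)) - 1) * lookup shift 0 = int d * int (lookup w 1) + int (lookup w (m+1))"
      using arg_cong[OF w, of "\<lambda>v. lookup v 0"] b by (simp add: lk of_nat_diff)
    show "(int (wt (m+1)) - 1) * lookup shift i = int (lookup w i) - int (lookup w 1) * int (k i)"
      using arg_cong[OF w, of "\<lambda>v. lookup v i"] b i0 by (simp add: lk of_nat_diff)
  qed (use b pos d_ge k_ge[OF i] in auto)
qed

text \<open>If \<open>\<Delta> x = 0\<close>, the leading exponent of x has weight 0. Some generator
  has positive weight, y_2, ..., y_m have weight 0, and \<open>wt 1 = d * wt (m + 1)\<close>; so y1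
  and z both have positive weight and are absent from this exponent. As z ranks first, they are
  absent from the other monomials too.\<close>

lemma kernel_subset_R:
  assumes "x \<in> B" "\<Delta> x = 0"
  shows "x \<in> R"
proof (cases "x = 0")
  case True
  then show ?thesis unfolding R_def by (intro image_eqI[of _ _ 0]) auto
next
  case False
  then obtain p \<alpha> c where p: "p \<in> reduced" "x = ev p" "\<alpha> \<in> keys p"
    "\<And>\<beta>. \<beta> \<in> keys p \<Longrightarrow> vv \<beta> \<le> vv \<alpha>" "c \<noteq> 0" "keys \<alpha> \<subseteq> vs"
    "top_coeff (zsubst (\<Delta> x)) (vv \<alpha> + shift) (c * Lam \<alpha>)"
    using top_del[OF assms(1)] by metis
  then have "weight \<alpha> = 0" using assms(2) L_shift_nz by (auto simp: Lam_weight)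
  have wt1: "wt 1 = d * wt (m + 1)" using wt_relation wt_y by simp
  obtain i where "i \<in> vs" "lam i \<noteq> 0" using ex_lam by blast
  then have i: "i \<in> vs" "wt i \<noteq> 0" using lam_wt by auto
  then consider "i = 1" | "i = m + 1" using wt_y[of i] by force
  then have "wt (m + 1) > 0" using i wt1 by cases auto
  then have "lookup \<alpha> 1 = 0" "lookup \<alpha> (m+1) = 0"
    using weight_0D[OF \<open>weight \<alpha> = 0\<close>] wt1 d_ge by auto
  then have \<alpha>0: "lookup (vv \<alpha>) 0 = 0" by (simp add: lookup_vv_0[simplified])
  have "keys \<beta> \<subseteq> {2..m}" if \<beta>: "\<beta> \<in> keys p" for \<beta>
  proof -
    have "int d * int (lookup \<beta> 1) + int (lookup \<beta> (m+1)) \<le> 0"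
      using le_lookup_0[OF p(4)[OF \<beta>]] \<alpha>0 by (simp only: lookup_vv_0)
    moreover have "int d * int (lookup \<beta> 1) \<ge> 0" by simp
    ultimately have "int d * int (lookup \<beta> 1) = 0" "int (lookup \<beta> (m+1)) = 0" by linarith+
    then have "1 \<notin> keys \<beta>" "m + 1 \<notin> keys \<beta>" using d_ge by (auto simp: in_keys_iff)
    moreover have "keys \<beta> \<subseteq> vs" using reducedD[OF p(1) \<beta>] by blast
    ultimately have "keys \<beta> \<subseteq> vs - {1, m+1}" by blast
    also have "\<dots> = {2..m}" by auto
    finally show ?thesis .
  qed
  then show ?thesis using p(2) by (auto simp: R_def polys_in_iff)
qed

end

section \<open>Automorphisms of the coordinate ring\<close>

text \<open>One joint induction, because a coefficient of the next power combines two neighbouring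
  coefficients of the previous one.\<close>

lemma linear_poly_power_coeffs:
  fixes b t :: "'a::idom"
  shows "coeff ([:b, t:] ^ n) n = t ^ n"
    and "n > 0 \<Longrightarrow> coeff ([:b, t:] ^ n) (n - 1) = of_nat n * t ^ (n - 1) * b"
    and "n < j \<Longrightarrow> coeff ([:b, t:] ^ n) j = 0"
proof (induction n arbitrary: j)
  case 0
  { case 1 then show ?case by simp }
  { case 2 then show ?case by simp }
  { case 3 then show ?case by (simp add: coeff_1) }
next
  case (Suc n)
  have *: "coeff ([:b, t:] ^ Suc n) (Suc i) = b * coeff ([:b, t:] ^ n) (Suc i) + t * coeff ([:b, t:] ^ n) i" for i
    by simp
  { case 1 then show ?case using Suc(1) Suc(3)[of "Suc n"] by (simp only: *) simp }
  { case 2 then show ?case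
    proof (cases n)
      case (Suc l)
      then show ?thesis using Suc.IH(1) Suc.IH(2) *[of l] by (simp add: algebra_simps)
    qed simp }
  { case 3
    then obtain i where "j = Suc i" "n < i" by (metis Suc_lessE)
    then show ?case using Suc.IH(3)[of "Suc i"] Suc.IH(3)[of i] by (simp only: *) simp }
qed

section \<open>Formal partial derivatives\<close>

lemma partial_superset:
  assumes "finite K" "keys p \<subseteq> K"
  shows "partial i p = (\<Sum>\<alpha>\<in>K. single (\<alpha> - single i 1) (of_nat (lookup \<alpha> i) * lookup p \<alpha>))"
  unfolding partial_def using assms by (intro sum.mono_neutral_left) (auto simp: in_keys_iff)

lemma partial_add: "partial i (p + q) = partial i p + partial i q"
  using keys_add[of p q]
  by (simp add: partial_superset[of "keys p \<union> keys q"] lookup_add distrib_left single_add sum.distrib)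

lemma partial_single: "partial i (single \<alpha> a) = single (\<alpha> - single i 1) (of_nat (lookup \<alpha> i) * a)"
  by (subst partial_superset[of "{\<alpha>}"]) auto

lemma partial_Const: "partial i (Const a) = 0"
  by (simp add: Const_def partial_single)

text \<open>The Leibniz rule for one variable factor. The case distinction comes from the truncated
  subtraction of exponents when the variable is absent.\<close>

lemma partial_Var_mult:
  "partial i (Var j * p) = Var j * partial i p + (if i = j then p else 0)"
proof -
  have 1: "partial i (Var j * single \<alpha> a) = Var j * partial i (single \<alpha> a) + (if i = j then single \<alpha> a else 0)" for \<alpha> a
  proof -
    consider "i = j" "lookup \<alpha> j = 0" | "i = j" "lookup \<alpha> j \<noteq> 0" | "i \<noteq> j" "lookup \<alpha> i = 0" | "i \<noteq> j" "lookup \<alpha> i \<noteq> 0"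
      by blast
    then show ?thesis
    proof cases
      case 1
      then show ?thesis by (simp add: Var_def mult_single partial_single lookup_add)
    next
      case 2
      have "single j 1 + (\<alpha> - single j 1) = \<alpha>"
        using 2 by (intro poly_mapping_eqI) (auto simp: lookup_add lookup_minus lookup_single when_def)
      then show ?thesis
        using 2 by (simp add: Var_def mult_single partial_single lookup_add single_add[symmetric] algebra_simps)
    next
      case 3
      then show ?thesis by (simp add: Var_def mult_single partial_single lookup_add lookup_single when_def)
    next
      case 4
      have "single j 1 + \<alpha> - single i 1 = single j 1 + (\<alpha> - single i 1)"
        using 4 by (intro poly_mapping_eqI) (auto simp: lookup_add lookup_minus lookup_single when_def)
      then show ?thesis
        using 4 by (simp add: Var_def mult_single partial_single lookup_add lookup_single when_def)
    qed
  qed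
  have "partial i (Var j * (\<Sum>\<alpha>\<in>K. single \<alpha> (lookup p \<alpha>)))
      = Var j * partial i (\<Sum>\<alpha>\<in>K. single \<alpha> (lookup p \<alpha>))
        + (if i = j then (\<Sum>\<alpha>\<in>K. single \<alpha> (lookup p \<alpha>)) else 0)" if "finite K" for K
    using that
  proof (induction K rule: finite_induct)
    case empty
    then show ?case by (simp add: partial_def)
  qed (simp_all add: distrib_left partial_add 1)
  from this[of "keys p"] show ?thesis by (simp add: sum_single_keys)
qed

lemma partial_in: "p \<in> polys_in I \<Longrightarrow> partial i p \<in> polys_in I"
  by (induction rule: polys_in_induct)
    (auto simp: partial_Const partial_add partial_Var_mult intro!: polys_in_intros)

context danielewski
begin

lemma ev_partial:
  assumes "p \<in> polys_in {2..m+1}"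
  shows "ev (partial (m+1) p) = pderiv (ev p)"
  using assms
proof (induction rule: polys_in_induct)
  case (Const a)
  then show ?case by (simp add: partial_Const kc_def pderiv_pCons)
next
  case (Var_mult i p)
  consider "i \<in> {2..m}" | "i = m + 1" using Var_mult by force
  then show ?case
  proof cases
    case 1
    then show ?thesis using Var_mult.IH by (simp add: partial_Var_mult xv_y pderiv_mult pderiv_pCons pderiv_smult)
  next
    case 2
    then show ?thesis
      using Var_mult.IH xv_z by (simp add: partial_Var_mult pderiv_pCons)
  qed
qed (simp add: partial_add pderiv_add)

section \<open>The canonical derivation on polynomials in z\<close>

definition Y :: "'k laurent poly" where "Y = [:ymono \<kappa>:]"

definition D :: "'k laurent poly \<Rightarrow> 'k laurent poly" where "D q = Y * pderiv q"

lemma Y_neq_0 [simp]: "Y \<noteq> 0" by (simp add: Y_def)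

lemma ev_dmonom': "ev (dmonom m k) = Y" by (simp add: ev_dmonom Y_def)

lemma Y_R [simp]: "Y \<in> R"
  unfolding R_def ev_dmonom'[symmetric] by (intro imageI dmonom_in)

lemma Y_B [simp]: "Y \<in> B" by (simp add: R_subset_B)

lemma xv_1_Y: "xv 1 * Y = ev P" using xv_1_mult by (simp only: Y_def)

lemma D_add: "D (x + y) = D x + D y" and D_mult: "D (x * y) = D x * y + x * D y"
  and D_kc: "D (kc c) = 0"
  by (simp_all add: D_def pderiv_add pderiv_mult algebra_simps kc_def pderiv_pCons)

lemma D_y: "i \<in> {2..m} \<Longrightarrow> D (xv i) = 0"
  by (simp add: D_def xv_y pderiv_pCons)

lemma D_z: "D (xv (m+1)) = Y"
  unfolding xv_z by (simp add: D_def pderiv_pCons)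

text \<open>Differentiate \<open>xv 1 * Y = ev P\<close>, in which Y is constant in z.\<close>

lemma D_x: "D (xv 1) = ev (partial (m+1) P)"
proof -
  have "pderiv (xv 1 * Y) = Y * pderiv (xv 1)"
    by (simp add: pderiv_smult Y_def)
  then show ?thesis by (simp only: xv_1_Y D_def ev_partial[OF P_in])
qed

text \<open>The factor Y clears the denominator that y1 brings in; by the Leibniz rule the
  generators are all that must be checked.\<close>

lemma D_B: "x \<in> B \<Longrightarrow> D x \<in> B"
proof (induction rule: B_induct)
  case (xv_mult i x)
  consider "i = 1" | "i \<in> {2..m}" | "i = m + 1" using xv_mult(1) by force
  then have "D (xv i) \<in> B"
  proof cases
    case 1
    then show ?thesis using partial_in[OF P_in'] by (simp only: D_x B_ev)
  qed (simp_all only: D_y D_z B_0 Y_B)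
  then show ?case using xv_mult by (simp only: D_mult) (intro B_closed B_xv)
qed (simp_all add: D_add D_kc B_add)

lemma D_nilpotent: "degree x < n \<Longrightarrow> (D ^^ n) x = 0"
proof (induction n arbitrary: x)
  case (Suc n)
  have D0: "(D ^^ n) 0 = 0" for n by (induction n) (simp_all add: D_def)
  have "(D ^^ n) (D x) = 0"
  proof (cases "degree x = 0")
    case True
    then have "D x = 0" by (simp add: D_def pderiv_eq_0_iff)
    then show ?thesis using D0 by simp
  next
    case False
    then show ?thesis
      using Suc.prems by (intro Suc.IH) (simp add: D_def Y_def degree_pderiv)
  qed
  then show ?case by (simp add: funpow_swap1)
qed simp

section \<open>The subring \<open>R\<close> as a polynomial ring\<close>

lemma R_kc [simp]: "kc c \<in> R"
  unfolding R_def by (rule image_eqI[of _ _ "Const c"]) auto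

lemma R_xv: "i \<in> {2..m} \<Longrightarrow> xv i \<in> R"
  unfolding R_def by (rule image_eqI[of _ _ "Var i"]) (auto intro: polys_in_Var)

lemma R_add: "x \<in> R \<Longrightarrow> y \<in> R \<Longrightarrow> x + y \<in> R"
  and R_mult: "x \<in> R \<Longrightarrow> y \<in> R \<Longrightarrow> x * y \<in> R"
  unfolding R_def by (force intro: image_eqI[of _ _ "_ + _"] image_eqI[of _ _ "_ * _"] polys_in_intros)+

lemma R_0 [simp]: "0 \<in> R" and R_1 [simp]: "1 \<in> R"
  using R_kc[of 0] R_kc[of 1] by simp_all

lemma R_power: "x \<in> R \<Longrightarrow> x ^ n \<in> R"
  by (induction n) (auto intro: R_mult)

lemma R_prod: "(\<And>j. j \<in> K \<Longrightarrow> f j \<in> R) \<Longrightarrow> prod f K \<in> R"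
  by (induction K rule: infinite_finite_induct) (auto intro: R_mult)

lemma R_induct [consumes 1, case_names kc add xv_mult]:
  assumes "x \<in> R" "\<And>c. Q (kc c)"
    and "\<And>x y. x \<in> R \<Longrightarrow> y \<in> R \<Longrightarrow> Q x \<Longrightarrow> Q y \<Longrightarrow> Q (x + y)"
    and "\<And>i x. i \<in> {2..m} \<Longrightarrow> x \<in> R \<Longrightarrow> Q x \<Longrightarrow> Q (xv i * x)"
  shows "Q x"
proof -
  obtain p where "p \<in> polys_in {2..m}" "x = ev p" using assms(1) by (auto simp: R_def)
  moreover have "Q (ev p)" if "p \<in> polys_in {2..m}"
    using that
  proof (induction rule: polys_in_induct)
    case (add p q)
    then show ?case using assms(3)[of "ev p" "ev q"] by (simp add: R_def)
  next
    case (Var_mult i p)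
    then show ?case using assms(4)[of i "ev p"] by (simp add: R_def)
  qed (simp add: assms)
  ultimately show ?thesis by blast
qed

lemma R_const:
  "x \<in> R \<Longrightarrow> \<exists>c. x = [:c:] \<and> (\<forall>e\<in>keys c. \<forall>i. 0 \<le> lookup e i \<and> (i \<notin> {2..m} \<longrightarrow> lookup e i = 0))"
proof (induction rule: R_induct)
  case (kc c)
  then show ?case by (auto simp: kc_def)
next
  case (add x y)
  then obtain a b where ab: "x = [:a:]" "y = [:b:]"
    "\<forall>e\<in>keys a. \<forall>i. 0 \<le> lookup e i \<and> (i \<notin> {2..m} \<longrightarrow> lookup e i = 0)"
    "\<forall>e\<in>keys b. \<forall>i. 0 \<le> lookup e i \<and> (i \<notin> {2..m} \<longrightarrow> lookup e i = 0)" by blast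
  then show ?case using keys_add[of a b] by (intro exI[of _ "a + b"]) auto
next
  case (xv_mult i x)
  then obtain a where a: "x = [:a:]"
    "\<forall>e\<in>keys a. \<forall>i. 0 \<le> lookup e i \<and> (i \<notin> {2..m} \<longrightarrow> lookup e i = 0)" by blast
  have "0 \<le> lookup e j \<and> (j \<notin> {2..m} \<longrightarrow> lookup e j = 0)" if "e \<in> keys (ymono (single i 1) * a)" for e j
  proof -
    obtain e' where "e' \<in> keys a" "e = single i 1 + e'"
      using subsetD[OF keys_mult \<open>e \<in> keys (ymono (single i 1) * a)\<close>] by (auto simp: ymono_def)
    then show ?thesis using a(2) xv_mult(1) by (auto simp: lookup_add lookup_single when_def)
  qed
  then show ?case using a xv_mult(1) by (intro exI[of _ "ymono (single i 1) * a"]) (auto simp: xv_y)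
qed

lemma R_degree: "x \<in> R \<Longrightarrow> degree x = 0"
  using R_const by fastforce

text \<open>Divisors of 1 are monomials already among Laurent polynomials. In \<open>R\<close> the
  exponents of x and y are nonnegative, and they add up to 0, so both vanish.\<close>

lemma R_unit:
  assumes "x \<in> R" "y \<in> R" "x * y = 1"
  shows "\<exists>c. c \<noteq> 0 \<and> x = kc c"
proof -
  obtain a where a: "x = [:a:]" "\<And>e i. e \<in> keys a \<Longrightarrow> 0 \<le> lookup e i" using R_const[OF assms(1)] by blast
  obtain b where b: "y = [:b:]" "\<And>e i. e \<in> keys b \<Longrightarrow> 0 \<le> lookup e i" using R_const[OF assms(2)] by blast
  have 1: "a * b = single 0 1" using assms(3) a(1) b(1) by (simp add: one_pCons single_one mult.commute)
  then obtain e c where c: "a = single e c" "c \<noteq> 0" using single_of_mult_eq_single[OF 1 one_neq_zero] by blast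
  have 2: "b * a = single 0 1" using 1 by (simp add: mult.commute)
  then obtain e' c' where c': "b = single e' c'" "c' \<noteq> 0" using single_of_mult_eq_single[OF 2 one_neq_zero] by blast
  have "single (e + e') (c * c') = single 0 1" using 1 c c' by (simp add: mult_single)
  then have "e + e' = 0" using c c' by (metis lookup_single_eq lookup_single_not_eq mult_eq_0_iff)
  then have "lookup e i + lookup e' i = 0" for i by (metis lookup_add lookup_zero)
  moreover have "0 \<le> lookup e i" "0 \<le> lookup e' i" for i using a(2)[of e] b(2)[of e'] c c' by auto
  ultimately have "e = 0" by (intro poly_mapping_eqI) (metis add_nonneg_eq_0_iff lookup_zero)
  then show ?thesis using a c by (auto simp: kc_def)
qed

section \<open>Elements of small degree in z\<close>

lemma coeff_ev_R: "p \<in> polys_in {2..m+1} \<Longrightarrow> [:coeff (ev p) j:] \<in> R"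
proof (induction arbitrary: j rule: polys_in_induct)
  case (Const a)
  have "[:coeff (kc a) j:] = (if j = 0 then kc a else 0)" by (simp add: kc_def coeff_pCons split: nat.splits)
  then show ?case by simp
next
  case (add p q)
  then show ?case using R_add[of "[:coeff (ev p) j:]" "[:coeff (ev q) j:]"] by simp
next
  case (Var_mult i p)
  consider "i \<in> {2..m}" | "i = m + 1" using Var_mult by force
  then show ?case
  proof cases
    case 1
    then show ?thesis using R_mult[OF R_xv[OF 1] Var_mult.IH[of j]] by (simp add: xv_y mult.commute)
  next
    case 2
    then show ?thesis using Var_mult.IH[of "j - 1"] xv_z by (auto simp: coeff_pCons split: nat.splits)
  qed
qed

lemma degree_ev_single:
  "keys \<alpha> \<subseteq> {2..m+1} \<Longrightarrow> degree (ev (single \<alpha> a)) \<le> lookup \<alpha> (m+1)"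
proof (induction \<alpha> rule: exponent_induct)
  case zero
  have "ev (single 0 a) = kc a" using ev_hom(1)[of a] by (simp add: Const_def)
  then show ?case by (simp add: kc_def)
next
  case (add i \<beta>)
  have eq: "single (single i 1 + \<beta>) a = Var i * single \<beta> a"
    by (simp add: Var_def mult_single)
  have i: "degree (xv i) \<le> lookup (single i (1::nat)) (m+1)"
  proof (cases "i = m + 1")
    case False
    then have "i \<in> {2..m}" using add by auto
    then show ?thesis by (simp add: xv_y)
  qed (use xv_z in simp)
  have "degree (xv i * ev (single \<beta> a)) \<le> degree (xv i) + degree (ev (single \<beta> a))" by (rule degree_mult_le)
  then show ?case using i add.IH unfolding eq ev_hom by (simp add: lookup_add)
qed

text \<open>By \<open>reduced_degree_bound\<close> each monomial of the reduced representative
  either avoids y1, with z-degree less than d, or is y1 times a monomial in y_2, ..., y_m. The set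
  \<open>V\<close> of sums of the desired form is closed under addition, so monomials
  suffice.\<close>

lemma B_degree_d:
  assumes "x \<in> B" "degree x \<le> d"
  obtains r g where "[:r:] \<in> R" "x = smult r (xv 1) + g" "degree g < d" "\<And>j. [:coeff g j:] \<in> R"
proof -
  define V where "V = {y. \<exists>r q. [:r:] \<in> R \<and> q \<in> polys_in {2..m+1} \<and> degree (ev q) < d \<and> y = smult r (xv 1) + ev q}"
  obtain p where p: "p \<in> reduced" "x = ev p" using B_reduced assms by blast
  have 1: "ev (single \<alpha> a) \<in> V" if \<alpha>: "\<alpha> \<in> keys p" for \<alpha> a
  proof -
    have le: "d * lookup \<alpha> 1 + lookup \<alpha> (m+1) \<le> d"
      using reduced_degree_bound[OF p(1) _ \<alpha>] p assms by blast
    note red = reducedD[OF p(1) \<alpha>]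
    show ?thesis
    proof (cases "lookup \<alpha> 1 = 0")
      case True
      then have "1 \<notin> keys \<alpha>" by (simp add: in_keys_iff)
      then have "keys \<alpha> \<subseteq> vs - {1}" using red by blast
      also have "vs - {1} = {2..m+1}" by auto
      finally have k: "keys \<alpha> \<subseteq> {2..m+1}" .
      then have "single \<alpha> a \<in> polys_in {2..m+1}" by (auto simp: polys_in_iff)
      moreover have "degree (ev (single \<alpha> a)) < d" using degree_ev_single[OF k] red by (meson le_less_trans)
      ultimately show ?thesis unfolding V_def by (intro CollectI exI[of _ 0] exI[of _ "single \<alpha> a"]) auto
    next
      case False
      then have "d * 1 \<le> d * lookup \<alpha> 1" by (intro mult_le_mono) auto
      then have "lookup \<alpha> (m+1) = 0" "d * lookup \<alpha> 1 = d * 1" using le by linarith+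
      then have az: "m + 1 \<notin> keys \<alpha>" and a1: "lookup \<alpha> 1 = 1" using d_ge by (auto simp: in_keys_iff)
      define \<beta> where "\<beta> = \<alpha> - single 1 1"
      have eq: "\<alpha> = single 1 1 + \<beta>" using a1
        by (intro poly_mapping_eqI) (auto simp: \<beta>_def lookup_add lookup_minus lookup_single when_def)
      have "keys \<beta> \<subseteq> keys \<alpha> - {1}" using a1 by (auto simp: \<beta>_def in_keys_iff lookup_minus)
      then have "keys \<beta> \<subseteq> vs - {1, m + 1}" using az red by blast
      also have "vs - {1, m+1} = {2..m}" by auto
      finally have "single \<beta> a \<in> polys_in {2..m}" by (auto simp: polys_in_iff)
      then have "ev (single \<beta> a) \<in> R" by (simp add: R_def)
      moreover from this obtain c where "ev (single \<beta> a) = [:c:]" using R_const by blast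
      moreover have "single \<alpha> a = Var 1 * single \<beta> a" by (simp add: eq Var_def mult_single)
      then have "ev (single \<alpha> a) = xv 1 * ev (single \<beta> a)" by (simp only: ev_hom)
      ultimately show ?thesis using d_ge unfolding V_def by (intro CollectI exI[of _ c] exI[of _ 0]) auto
    qed
  qed
  have V_add: "y + y' \<in> V" if "y \<in> V" "y' \<in> V" for y y'
  proof -
    obtain r q where "[:r:] \<in> R" "q \<in> polys_in {2..m+1}" "degree (ev q) < d" "y = smult r (xv 1) + ev q"
      using \<open>y \<in> V\<close> unfolding V_def by blast
    moreover obtain r' q' where "[:r':] \<in> R" "q' \<in> polys_in {2..m+1}" "degree (ev q') < d" "y' = smult r' (xv 1) + ev q'"
      using \<open>y' \<in> V\<close> unfolding V_def by blast
    ultimately have *: "[:r:] \<in> R" "q \<in> polys_in {2..m+1}" "degree (ev q) < d" "y = smult r (xv 1) + ev q"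
      "[:r':] \<in> R" "q' \<in> polys_in {2..m+1}" "degree (ev q') < d" "y' = smult r' (xv 1) + ev q'" by blast+
    have "[:r + r':] \<in> R" using R_add[OF *(1,5)] by simp
    moreover have "degree (ev (q + q')) < d" using * by (simp add: degree_add_less)
    ultimately show ?thesis using * unfolding V_def
      by (intro CollectI exI[of _ "r + r'"] exI[of _ "q + q'"])
        (auto simp: smult_add_left intro: polys_in_add simp del: One_nat_def Suc_eq_plus1)
  qed
  have V_0: "0 \<in> V" unfolding V_def using d_ge by (intro CollectI exI[of _ 0]) auto
  have "(\<Sum>\<alpha>\<in>K. ev (single \<alpha> (lookup p \<alpha>))) \<in> V" if "finite K" "K \<subseteq> keys p" for K
    using that by (induction K rule: finite_induct) (auto intro: V_add V_0 1)
  from this[of "keys p"] have "x \<in> V" by (simp add: p ev_eq_sum[of p])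
  then show thesis using that coeff_ev_R unfolding V_def by blast
qed

text \<open>y1 has degree d in z, so below this degree the reduced representative cannot involve
  it.\<close>

lemma B_coeff_R:
  assumes "x \<in> B" "degree x < d"
  shows "[:coeff x j:] \<in> R"
proof -
  obtain p where p: "p \<in> reduced" "x = ev p" using B_reduced assms by blast
  have "keys \<alpha> \<subseteq> {2..m+1}" if \<alpha>: "\<alpha> \<in> keys p" for \<alpha>
  proof -
    have "d * lookup \<alpha> 1 + lookup \<alpha> (m+1) \<le> degree x"
      using reduced_degree_bound[OF p(1) _ \<alpha>] p by blast
    then have "d * lookup \<alpha> 1 < d * 1" using assms(2) by linarith
    then have "1 \<notin> keys \<alpha>" by (simp add: in_keys_iff)
    then have "keys \<alpha> \<subseteq> vs - {1}" using reducedD[OF p(1) \<alpha>] by blast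
    also have "vs - {1} = {2..m+1}" by auto
    finally show ?thesis .
  qed
  then show ?thesis unfolding p(2) by (intro coeff_ev_R) (auto simp: polys_in_iff)
qed

lemma B_degree_0: "x \<in> B \<Longrightarrow> degree x = 0 \<Longrightarrow> x \<in> R"
  using B_coeff_R[of x 0] d_ge by (metis degree_0_id not_numeral_le_zero not_gr_zero)

lemma D_eq_0_iff: "x \<in> B \<Longrightarrow> D x = 0 \<longleftrightarrow> x \<in> R"
  using B_degree_0 R_degree by (auto simp: D_def pderiv_eq_0_iff)

text \<open>Each factor y1 costs one factor Y, which turns it into P.\<close>

lemma clear_denominators:
  "p \<in> polys_in vs \<Longrightarrow> \<exists>N. \<exists>q\<in>polys_in {2..m+1}. ev (dmonom m k ^ N * p) = ev q"
proof (induction rule: polys_in_induct)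
  case (Const a)
  then show ?case by (intro exI[of _ 0] bexI[of _ "Const a"]) auto
next
  case (add p p')
  then obtain N q N' q' where *: "q \<in> polys_in {2..m+1}" "Y ^ N * ev p = ev q"
    "q' \<in> polys_in {2..m+1}" "Y ^ N' * ev p' = ev q'" by (auto simp: ev_dmonom')
  have "dmonom m k ^ N' * q + dmonom m k ^ N * q' \<in> polys_in {2..m+1}"
    using * by (intro polys_in_intros polys_in_mono[OF dmonom_in]) auto
  moreover have "ev (dmonom m k ^ (N + N') * (p + p')) = ev (dmonom m k ^ N' * q + dmonom m k ^ N * q')"
    by (simp add: ev_dmonom' *(2,4)[symmetric] power_add algebra_simps)
  ultimately show ?case by blast
next
  case (Var_mult i p)
  then obtain N q where *: "q \<in> polys_in {2..m+1}" "Y ^ N * ev p = ev q" by (auto simp: ev_dmonom')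
  show ?case
  proof (cases "i = 1")
    case False
    then have "Var i * q \<in> polys_in {2..m+1}" using * Var_mult(1) by (intro polys_in_intros) auto
    moreover have "ev (dmonom m k ^ N * (Var i * p)) = ev (Var i * q)"
      by (simp add: ev_dmonom' *(2)[symmetric] algebra_simps)
    ultimately show ?thesis by blast
  next
    case True
    have "ev (dmonom m k ^ Suc N * (Var i * p)) = (xv 1 * Y) * (Y ^ N * ev p)"
      by (simp add: True ev_dmonom' algebra_simps)
    also have "\<dots> = ev (P * q)" by (simp only: xv_1_Y * ev_hom)
    finally show ?thesis using * P_in by (blast intro: polys_in_mult)
  qed
qed

section \<open>Endomorphisms and automorphisms of \<open>B\<close>\<close>

definition alg_endo :: "('k laurent poly \<Rightarrow> 'k laurent poly) \<Rightarrow> bool" where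
  "alg_endo \<Phi> \<longleftrightarrow> (\<forall>x\<in>B. \<Phi> x \<in> B) \<and> (\<forall>x\<in>B. \<forall>y\<in>B. \<Phi> (x + y) = \<Phi> x + \<Phi> y) \<and>
    (\<forall>x\<in>B. \<forall>y\<in>B. \<Phi> (x * y) = \<Phi> x * \<Phi> y) \<and> (\<forall>c. \<Phi> (kc c) = kc c)"

lemma alg_endoD:
  assumes "alg_endo \<Phi>"
  shows "x \<in> B \<Longrightarrow> \<Phi> x \<in> B" "x \<in> B \<Longrightarrow> y \<in> B \<Longrightarrow> \<Phi> (x + y) = \<Phi> x + \<Phi> y"
    "x \<in> B \<Longrightarrow> y \<in> B \<Longrightarrow> \<Phi> (x * y) = \<Phi> x * \<Phi> y" "\<Phi> (kc c) = kc c"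
    "\<Phi> 0 = 0" "\<Phi> 1 = 1"
proof -
  show K: "\<Phi> (kc c) = kc c" for c using assms by (simp add: alg_endo_def)
  show "\<Phi> 0 = 0" "\<Phi> 1 = 1" using K[of 0] K[of 1] by simp_all
qed (use assms in \<open>simp_all add: alg_endo_def\<close>)

lemma alg_endo_power: "alg_endo \<Phi> \<Longrightarrow> x \<in> B \<Longrightarrow> \<Phi> (x ^ n) = \<Phi> x ^ n"
  by (induction n) (simp_all add: alg_endoD B_power)

lemma alg_endo_sum:
  "alg_endo \<Phi> \<Longrightarrow> (\<And>j. j \<in> K \<Longrightarrow> f j \<in> B) \<Longrightarrow> \<Phi> (sum f K) = (\<Sum>j\<in>K. \<Phi> (f j))"
  by (induction K rule: infinite_finite_induct) (simp_all add: alg_endoD B_sum)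

lemma alg_endo_prod:
  "alg_endo \<Phi> \<Longrightarrow> (\<And>j. j \<in> K \<Longrightarrow> f j \<in> B) \<Longrightarrow> \<Phi> (prod f K) = (\<Prod>j\<in>K. \<Phi> (f j))"
  by (induction K rule: infinite_finite_induct) (simp_all add: alg_endoD B_prod)

lemma Y_prod: "Y = (\<Prod>i\<in>{2..m}. xv i ^ k i)"
  by (simp add: ev_dmonom'[symmetric] dmonom_def)

lemma xv_y_B: "i \<in> {2..m} \<Longrightarrow> xv i \<in> B"
  using R_xv R_subset_B by blast

lemma alg_endo_Y: "alg_endo \<Phi> \<Longrightarrow> \<Phi> Y = (\<Prod>i\<in>{2..m}. \<Phi> (xv i) ^ k i)"
  unfolding Y_prod
  by (subst alg_endo_prod) (auto intro: B_power xv_y_B simp: alg_endo_power xv_y_B)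

text \<open>\<open>y\<^sub>1\<close> need not be compared: it is determined by \<open>y\<^sub>1 Y = P\<close>.\<close>

lemma alg_endo_eqI:
  assumes "alg_endo \<Phi>" "alg_endo \<Phi>'" "\<And>i. i \<in> {2..m+1} \<Longrightarrow> \<Phi> (xv i) = \<Phi>' (xv i)"
    and "\<Phi> Y \<noteq> 0" "x \<in> B"
  shows "\<Phi> x = \<Phi>' x"
proof -
  note D = alg_endoD[OF assms(1)] alg_endoD[OF assms(2)]
  have P: "\<Phi> (ev p) = \<Phi>' (ev p)" if "p \<in> polys_in {2..m+1}" for p
  proof (rule hom_eqI[OF that])
    have "ev p \<in> B" if "p \<in> polys_in {2..m+1}" for p
      using that by (intro B_ev polys_in_mono[OF that]) auto
    then show "\<Phi> (ev (p + q)) = \<Phi> (ev p) + \<Phi> (ev q)" "\<Phi>' (ev (p + q)) = \<Phi>' (ev p) + \<Phi>' (ev q)"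
      "\<Phi> (ev (p * q)) = \<Phi> (ev p) * \<Phi> (ev q)" "\<Phi>' (ev (p * q)) = \<Phi>' (ev p) * \<Phi>' (ev q)"
      if "p \<in> polys_in {2..m+1}" "q \<in> polys_in {2..m+1}" for p q
      using that by (simp_all add: D)
  qed (use assms D in auto)
  have "dmonom m k \<in> polys_in {2..m+1}" by (rule polys_in_mono[OF dmonom_in]) auto
  then have Y: "\<Phi> Y = \<Phi>' Y" using P by (simp only: ev_dmonom'[symmetric])
  have x1: "xv 1 \<in> B" by (rule B_xv) simp
  have "\<Phi> (xv 1) * \<Phi> Y = \<Phi> (ev P)" by (subst D(3)[symmetric]) (simp_all only: xv_1_Y x1 Y_B)
  also have "\<dots> = \<Phi>' (ev P)" by (rule P[OF P_in])
  also have "\<dots> = \<Phi>' (xv 1) * \<Phi> Y" unfolding Y by (subst D(9)[symmetric]) (simp_all only: xv_1_Y x1 Y_B)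
  finally have 1: "\<Phi> (xv 1) = \<Phi>' (xv 1)" using assms(4) by simp
  show ?thesis using assms(5)
  proof (induction rule: B_induct)
    case (xv_mult i x)
    have "i = 1 \<or> i \<in> {2..m+1}" using xv_mult by force
    then have "\<Phi> (xv i) = \<Phi>' (xv i)" using 1 assms(3) by blast
    then show ?case using xv_mult B_xv[of i] by (simp only: D)
  qed (simp_all add: D)
qed

text \<open>The inverse is carried along because both maps are total functions of which only the
  values on \<open>B\<close> matter.\<close>

definition aut_pair :: "('k laurent poly \<Rightarrow> 'k laurent poly) \<Rightarrow> ('k laurent poly \<Rightarrow> 'k laurent poly) \<Rightarrow> bool" where
  "aut_pair \<Phi> \<Psi> \<longleftrightarrow> alg_endo \<Phi> \<and> alg_endo \<Psi> \<and> (\<forall>x\<in>B. \<Psi> (\<Phi> x) = x \<and> \<Phi> (\<Psi> x) = x)"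

lemma aut_pair_sym: "aut_pair \<Phi> \<Psi> \<Longrightarrow> aut_pair \<Psi> \<Phi>"
  by (auto simp: aut_pair_def)

lemma aut_pair_nz: "aut_pair \<Phi> \<Psi> \<Longrightarrow> x \<in> B \<Longrightarrow> x \<noteq> 0 \<Longrightarrow> \<Phi> x \<noteq> 0"
  using alg_endoD(5) unfolding aut_pair_def by metis

text \<open>The conjugate of \<open>D\<close> by an automorphism is locally nilpotent, hence has its kernel in \<open>R\<close>.\<close>

lemma aut_pair_R:
  assumes "aut_pair \<Phi> \<Psi>" "x \<in> R"
  shows "\<Phi> x \<in> R"
proof -
  have endo: "alg_endo \<Phi>" "alg_endo \<Psi>" and inv: "\<And>x. x \<in> B \<Longrightarrow> \<Psi> (\<Phi> x) = x" "\<And>x. x \<in> B \<Longrightarrow> \<Phi> (\<Psi> x) = x"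
    using assms by (auto simp: aut_pair_def)
  note E = alg_endoD[OF endo(1)] alg_endoD[OF endo(2)]
  have pow: "((\<lambda>x. \<Phi> (D (\<Psi> x))) ^^ n) x = \<Phi> ((D ^^ n) (\<Psi> x)) \<and> (D ^^ n) (\<Psi> x) \<in> B" if "x \<in> B" for n x
    using that by (induction n) (simp_all add: inv E D_B)
  have "danielewski_lnd m d k s P (\<lambda>x. \<Phi> (D (\<Psi> x)))"
  proof
    fix x y assume xy: "x \<in> B" "y \<in> B"
    then show "\<Phi> (D (\<Psi> (x + y))) = \<Phi> (D (\<Psi> x)) + \<Phi> (D (\<Psi> y))"
      "\<Phi> (D (\<Psi> (x * y))) = \<Phi> (D (\<Psi> x)) * y + x * \<Phi> (D (\<Psi> y))"
      by (simp_all add: E D_B D_add D_mult B_mult inv)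
  next
    fix x assume x: "x \<in> B"
    then show "\<Phi> (D (\<Psi> x)) \<in> B" by (simp add: E D_B)
    have "(D ^^ Suc (degree (\<Psi> x))) (\<Psi> x) = 0" by (rule D_nilpotent) simp
    then show "\<exists>n. ((\<lambda>x. \<Phi> (D (\<Psi> x))) ^^ n) x = 0" using pow[OF x] E(5) by metis
  next
    show "\<exists>x\<in>B. \<Phi> (D (\<Psi> x)) \<noteq> 0"
    proof (rule bexI[of _ "\<Phi> (xv (m+1))"])
      have "xv (m+1) \<in> B" by (rule B_xv) simp
      then show "\<Phi> (D (\<Psi> (\<Phi> (xv (m+1))))) \<noteq> 0" "\<Phi> (xv (m+1)) \<in> B"
        by (simp_all only: inv D_z aut_pair_nz[OF assms(1)] Y_B E not_False_eq_True Y_neq_0)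
    qed
  qed (simp add: E D_kc)
  then interpret danielewski_lnd m d k s P "\<lambda>x. \<Phi> (D (\<Psi> x))" .
  have xB: "x \<in> B" using assms(2) R_subset_B by blast
  then have "D x = 0" using D_eq_0_iff assms(2) by blast
  then show ?thesis using xB by (intro kernel_subset_R) (simp_all add: E inv)
qed


definition Z :: "'k laurent poly" where "Z = xv (m + 1)"

lemma Z_B [simp]: "Z \<in> B"
  unfolding Z_def by (rule B_xv) simp

lemma Z_eq: "Z = [:0, 1:]"
  unfolding Z_def by (rule xv_z)

lemma xv_Z: "xv (m + 1) = Z" by (simp add: Z_def)

text \<open>The coefficients in z lie in \<open>R\<close>, and their images are again constant in z;
  so a polynomial in z becomes a polynomial in \<open>\<Phi> Z\<close>. This feeds the degree count
  in \<open>aut_pair_degree_Z\<close>.\<close>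

lemma alg_endo_pcompose:
  assumes "alg_endo \<Phi>" "\<And>x. x \<in> R \<Longrightarrow> \<Phi> x \<in> R" "p \<in> polys_in {2..m+1}"
  shows "\<exists>Q. \<Phi> (ev p) = pcompose Q (\<Phi> Z)"
  using assms(3)
proof (induction rule: polys_in_induct)
  case (Const a)
  then show ?case by (intro exI[of _ "kc a"]) (simp add: alg_endoD[OF assms(1)], simp add: kc_def)
next
  case (add p q)
  then obtain Q Q' where "\<Phi> (ev p) = pcompose Q (\<Phi> Z)" "\<Phi> (ev q) = pcompose Q' (\<Phi> Z)" by blast
  moreover have "ev p \<in> B" "ev q \<in> B" using add by (auto intro!: B_ev elim!: polys_in_mono)
  ultimately have "\<Phi> (ev (p + q)) = pcompose (Q + Q') (\<Phi> Z)"
    by (simp only: ev_hom alg_endoD[OF assms(1)] pcompose_add)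
  then show ?case by blast
next
  case (Var_mult i p)
  then obtain Q where Q: "\<Phi> (ev p) = pcompose Q (\<Phi> Z)" by blast
  have i: "i \<in> vs" using Var_mult(1) by auto
  have "ev p \<in> B" using Var_mult by (auto intro!: B_ev elim!: polys_in_mono)
  then have *: "\<Phi> (ev (Var i * p)) = \<Phi> (xv i) * pcompose Q (\<Phi> Z)"
    using B_xv[OF i] by (simp only: ev_hom alg_endoD[OF assms(1)] Q)
  show ?case
  proof (cases "i = m + 1")
    case True
    then have "\<Phi> (xv i) = \<Phi> Z" by (simp add: Z_def)
    then have "\<Phi> (ev (Var i * p)) = pcompose ([:0, 1:] * Q) (\<Phi> Z)"
      unfolding * pcompose_mult by (simp add: pcompose_pCons)
    then show ?thesis by blast
  next
    case False
    then have "\<Phi> (xv i) \<in> R" using assms(2) R_xv Var_mult(1) by auto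
    then obtain c where "\<Phi> (xv i) = [:c:]" using R_const by blast
    then have "\<Phi> (ev (Var i * p)) = pcompose ([:c:] * Q) (\<Phi> Z)"
      unfolding * pcompose_mult by simp
    then show ?thesis by blast
  qed
qed

text \<open>Some \<open>Y ^ N * \<Psi> Z\<close> is a polynomial in z over \<open>R\<close>, so
  applying \<Phi> exhibits \<open>\<Phi> Y ^ N * Z\<close> as a polynomial in
  \<open>\<Phi> Z\<close>. The former has degree 1, and degrees multiply under composition.\<close>

lemma aut_pair_degree_Z:
  assumes "aut_pair \<Phi> \<Psi>"
  shows "degree (\<Phi> Z) = 1"
proof -
  have endo: "alg_endo \<Phi>" "alg_endo \<Psi>" and inv: "\<And>x. x \<in> B \<Longrightarrow> \<Phi> (\<Psi> x) = x"
    using assms by (auto simp: aut_pair_def)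
  note E = alg_endoD[OF endo(1)] alg_endoD[OF endo(2)]
  obtain p where p: "p \<in> polys_in vs" "\<Psi> Z = ev p" using E(7)[OF Z_B] by (auto simp: B_def)
  obtain N q where q: "q \<in> polys_in {2..m+1}" "ev (dmonom m k ^ N * p) = ev q"
    using clear_denominators[OF p(1)] by blast
  obtain Q where Q: "\<Phi> (ev q) = pcompose Q (\<Phi> Z)"
    using alg_endo_pcompose[OF endo(1) aut_pair_R[OF assms] q(1)] by blast
  have "Y ^ N * \<Psi> Z = ev q" using q(2) by (simp add: ev_dmonom' p(2))
  then have "\<Phi> (Y ^ N * \<Psi> Z) = pcompose Q (\<Phi> Z)" using Q by simp
  then have *: "\<Phi> Y ^ N * Z = pcompose Q (\<Phi> Z)"
    by (subst (asm) E(3)) (simp_all only: B_power Y_B E Z_B inv alg_endo_power[OF endo(1)])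
  have "\<Phi> Y ^ N \<in> R" by (intro R_power aut_pair_R[OF assms] Y_R)
  then have "degree (\<Phi> Y ^ N) = 0" by (rule R_degree)
  moreover have "\<Phi> Y ^ N \<noteq> 0" using aut_pair_nz[OF assms] by simp
  ultimately have "degree (\<Phi> Y ^ N * Z) = 1" unfolding Z_eq by (subst degree_mult_eq) simp_all
  then show ?thesis unfolding * degree_pcompose by simp
qed

text \<open>\<open>\<Phi> Z\<close> and \<open>\<Psi> Z\<close> are linear in z with coefficients in
  \<open>R\<close>, by \<open>B_coeff_R\<close> and d \<ge> 2. The coefficient of z in
  \<open>\<Phi> (\<Psi> Z) = Z\<close> shows that the leading coefficient of \<open>\<Phi> Z\<close>
  is a unit of \<open>R\<close>, hence constant.\<close>

lemma aut_pair_Z: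
  assumes "aut_pair \<Phi> \<Psi>"
  shows "\<exists>t b. t \<noteq> 0 \<and> b \<in> R \<and> \<Phi> Z = kc t * Z + b"
proof -
  have endo: "alg_endo \<Phi>" "alg_endo \<Psi>" and inv: "\<And>x. x \<in> B \<Longrightarrow> \<Phi> (\<Psi> x) = x"
    using assms by (auto simp: aut_pair_def)
  note E = alg_endoD[OF endo(1)] alg_endoD[OF endo(2)]
  have lin: "\<exists>a b. [:a:] \<in> R \<and> [:b:] \<in> R \<and> \<Theta> Z = [:b, a:]" if "aut_pair \<Theta> \<Theta>'" for \<Theta> \<Theta>'
  proof -
    have deg: "degree (\<Theta> Z) = 1" by (rule aut_pair_degree_Z[OF that])
    have "\<Theta> Z \<in> B" using that alg_endoD(1)[of \<Theta>] by (simp add: aut_pair_def)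
    then have "[:coeff (\<Theta> Z) j:] \<in> R" for j using B_coeff_R deg d_ge by simp
    moreover have "\<Theta> Z = [:coeff (\<Theta> Z) 0, coeff (\<Theta> Z) 1:]"
      using deg by (intro poly_eqI) (auto simp: coeff_pCons coeff_eq_0 split: nat.splits)
    ultimately show ?thesis by blast
  qed
  obtain a b where ab: "[:a:] \<in> R" "[:b:] \<in> R" "\<Phi> Z = [:b, a:]" using lin[OF assms] by blast
  obtain a' b' where ab': "[:a':] \<in> R" "[:b':] \<in> R" "\<Psi> Z = [:b', a':]" using lin[OF aut_pair_sym[OF assms]] by blast
  obtain a'' where a'': "\<Phi> [:a':] = [:a'':]" "[:a'':] \<in> R" using aut_pair_R[OF assms ab'(1)] R_const by metis
  obtain b'' where b'': "\<Phi> [:b':] = [:b'':]" using aut_pair_R[OF assms ab'(2)] R_const by metis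
  have "\<Psi> Z = [:b':] + [:a':] * Z" by (subst ab'(3)) (simp add: Z_eq)
  then have "\<Phi> (\<Psi> Z) = \<Phi> ([:b':] + [:a':] * Z)" by simp
  also have "\<dots> = [:b'':] + [:a'':] * [:b, a:]"
    using ab' R_subset_B by (simp only: E B_mult Z_B a'' b'' ab)
  finally have "[:0, 1:] = [:b'':] + [:a'':] * [:b, a:]" by (simp only: inv[OF Z_B]) (simp only: Z_eq)
  then have "a * a'' = 1" by (simp add: mult.commute)
  then have "[:a:] * [:a'':] = 1" by (simp add: one_pCons mult.commute)
  then obtain t where t: "t \<noteq> 0" "[:a:] = kc t" using R_unit[OF ab(1) a''(2)] by blast
  have "\<Phi> Z = [:a:] * Z + [:b:]" by (subst ab(3)) (simp add: Z_eq)
  then show ?thesis using t ab(2) by (auto simp del: Suc_eq_plus1)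
qed

text \<open>Since \<open>s (d - 1) = 0\<close>, the lower terms of P have z-degree at most d - 2 and
  so do their images; the degrees d and d - 1 only see the expansion of (b + t z)^d.\<close>

lemma alg_endo_P_coeffs:
  assumes "alg_endo \<Phi>" "\<And>x. x \<in> R \<Longrightarrow> \<Phi> x \<in> R" "\<Phi> Z = [:b, t:]"
  shows "coeff (\<Phi> (ev P)) d = t ^ d"
    and "coeff (\<Phi> (ev P)) (d - 1) = of_nat d * t ^ (d - 1) * b"
    and "degree (\<Phi> (ev P)) \<le> d"
proof -
  have sB: "ev (s j) \<in> B" if "j < d" for j using s_in[OF that] R_subset_B by (auto simp: R_def)
  have "\<exists>c. \<Phi> (ev (s j)) = [:c:]" if "j < d" for j
    using R_const[OF assms(2)[of "ev (s j)"]] s_in[OF that] by (auto simp: R_def)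
  then obtain c where c: "\<And>j. j < d \<Longrightarrow> \<Phi> (ev (s j)) = [:c j:]" by metis
  have c0: "c (d - 1) = 0" using c[of "d - 1"] d_ge by (simp add: s_0[simplified] alg_endoD[OF assms(1)])
  have "ev P = Z ^ d + (\<Sum>j<d. ev (s j) * Z ^ j)" by (subst P_def) (simp only: ev_hom xv_Z)
  then have "\<Phi> (ev P) = \<Phi> (Z ^ d + (\<Sum>j<d. ev (s j) * Z ^ j))" by simp
  also have "\<dots> = \<Phi> (Z ^ d) + \<Phi> (\<Sum>j<d. ev (s j) * Z ^ j)"
    using sB by (intro alg_endoD(2)[OF assms(1)] B_sum B_mult B_power Z_B) auto
  also have "\<Phi> (\<Sum>j<d. ev (s j) * Z ^ j) = (\<Sum>j<d. \<Phi> (ev (s j) * Z ^ j))"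
    using sB by (intro alg_endo_sum[OF assms(1)] B_mult B_power Z_B) auto
  also have "(\<Sum>j<d. \<Phi> (ev (s j) * Z ^ j)) = (\<Sum>j<d. smult (c j) ([:b, t:] ^ j))"
  proof (rule sum.cong)
    fix j assume "j \<in> {..<d}"
    then have j: "j < d" by simp
    show "\<Phi> (ev (s j) * Z ^ j) = smult (c j) ([:b, t:] ^ j)"
      by (subst alg_endoD(3)[OF assms(1) sB[OF j] B_power[OF Z_B]])
        (simp add: c[OF j] alg_endo_power[OF assms(1) Z_B] assms(3))
  qed simp
  also have "\<Phi> (Z ^ d) = [:b, t:] ^ d" by (simp only: alg_endo_power[OF assms(1) Z_B] assms(3))
  finally have eq: "\<Phi> (ev P) = [:b, t:] ^ d + (\<Sum>j<d. smult (c j) ([:b, t:] ^ j))" .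
  have coeff: "coeff (\<Phi> (ev P)) i = coeff ([:b, t:] ^ d) i + (\<Sum>j<d. c j * coeff ([:b, t:] ^ j) i)" for i
    by (simp add: eq coeff_sum)
  have z: "(\<Sum>j<d. c j * coeff ([:b, t:] ^ j) i) = 0" if "i \<ge> d" for i
    using that by (intro sum.neutral) (simp add: linear_poly_power_coeffs(3))
  show "coeff (\<Phi> (ev P)) d = t ^ d"
    unfolding coeff by (simp add: z linear_poly_power_coeffs(1))
  have "c j * coeff ([:b, t:] ^ j) (d - 1) = 0" if "j < d" for j
  proof (cases "j = d - 1")
    case False
    then have "j < d - 1" using that by linarith
    then show ?thesis by (simp add: linear_poly_power_coeffs(3))
  qed (simp add: c0[simplified])
  then have "(\<Sum>j<d. c j * coeff ([:b, t:] ^ j) (d - 1)) = 0" by (intro sum.neutral) simp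
  then show "coeff (\<Phi> (ev P)) (d - 1) = of_nat d * t ^ (d - 1) * b"
    unfolding coeff using d_ge linear_poly_power_coeffs(2)[of d b t] by simp
  show "degree (\<Phi> (ev P)) \<le> d"
    by (rule degree_le) (simp add: coeff z linear_poly_power_coeffs(3))
qed

text \<open>Comparing the coefficients of \<open>z\<^sup>d\<close> and \<open>z\<^sup>d\<^sup>-\<^sup>1\<close> in \<open>\<Phi>(y\<^sub>1) \<Phi>(Y) = \<Phi>(P)\<close>.\<close>

lemma aut_pair_Y:
  assumes "aut_pair \<Phi> \<Psi>" "\<Phi> Z = kc t * Z + b" "b \<in> R"
  obtains r g where "r \<in> R" "\<Phi> Y * r = kc (t ^ d) * Y"
    "g \<in> R" "\<Phi> Y * g = kc (of_nat d * t ^ (d - 1)) * b"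
proof -
  have endo: "alg_endo \<Phi>" using assms by (auto simp: aut_pair_def)
  note E = alg_endoD[OF endo]
  obtain c where c: "b = [:c:]" using R_const[OF assms(3)] by blast
  have \<Phi>Z: "\<Phi> Z = [:c, single 0 t:]" by (subst assms(2)) (simp add: c Z_eq kc_def)
  note W = alg_endo_P_coeffs[OF endo aut_pair_R[OF assms(1)] \<Phi>Z]
  \<comment> \<open>The identity yields the coefficients of P itself: 1 at z^d and 0 at
    z^(d-1).\<close>
  have "alg_endo (\<lambda>x. x)" by (simp add: alg_endo_def)
  note W1 = alg_endo_P_coeffs[OF this _ Z_eq]
  have "\<Phi> Y \<in> R" by (intro aut_pair_R[OF assms(1)] Y_R)
  then obtain u where u: "\<Phi> Y = [:u:]" "[:u:] \<in> R" using R_const by metis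
  have u0: "u \<noteq> 0" using aut_pair_nz[OF assms(1) Y_B] u by simp
  have x1: "xv 1 \<in> B" by (rule B_xv) simp
  have "\<Phi> (xv 1) * \<Phi> Y = \<Phi> (ev P)" by (subst E(3)[symmetric]) (simp_all only: xv_1_Y x1 Y_B)
  then have eq: "smult u (\<Phi> (xv 1)) = \<Phi> (ev P)" by (simp add: u(1))
  then have "degree (\<Phi> (xv 1)) \<le> d" using W(3) u0 by (metis degree_smult_eq)
  with x1 obtain r g where rg: "[:r:] \<in> R" "\<Phi> (xv 1) = smult r (xv 1) + g" "degree g < d" "\<And>j. [:coeff g j:] \<in> R"
    using B_degree_d[of "\<Phi> (xv 1)"] E(1) by metis
  have coeff: "u * (r * (ymono (- \<kappa>) * coeff (ev P) j) + coeff g j) = coeff (\<Phi> (ev P)) j" for j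
    by (simp only: eq[symmetric] rg(2) coeff_smult coeff_add) (simp add: xv_1[simplified])
  \<comment> \<open>At z^d the summand g drops out, having smaller degree; at z^(d-1) the multiple
    of y1 drops out.\<close>
  have "u * (r * ymono (- \<kappa>)) = single 0 t ^ d"
    using coeff[of d] W(1) W1(1) rg(3) by (simp add: coeff_eq_0)
  then have "(u * (r * ymono (- \<kappa>))) * ymono \<kappa> = single 0 t ^ d * ymono \<kappa>" by (rule arg_cong)
  then have "u * r * (ymono (- \<kappa>) * ymono \<kappa>) = single 0 t ^ d * ymono \<kappa>" by (simp only: mult.assoc)
  then have 1: "u * r = single 0 t ^ d * ymono \<kappa>" by (simp add: ymono_inverse)
  have "u * coeff g (d - 1) = of_nat d * single 0 t ^ (d - 1) * c"
    using coeff[of "d - 1"] W(2) W1(2) by simp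
  have pw: "single 0 t ^ n = single 0 (t ^ n)" for n
    by (induction n) (simp_all add: mult_single single_one)
  show thesis
  proof (rule that)
    show "[:r:] \<in> R" by (rule rg(1))
    show "[:coeff g (d - 1):] \<in> R" by (rule rg(4))
    show "\<Phi> Y * [:r:] = kc (t ^ d) * Y"
      unfolding u(1) using 1 by (simp add: kc_def Y_def pw mult.commute)
    show "\<Phi> Y * [:coeff g (d - 1):] = kc (of_nat d * t ^ (d - 1)) * b"
      using \<open>u * coeff g (d - 1) = of_nat d * single 0 t ^ (d - 1) * c\<close>
      unfolding u(1) by (simp add: kc_def c pw mult.commute mult_single flip: single_of_nat)
  qed
qed

lemma mono_poly_power: "[:single e c:] ^ n = [:single (frag_cmul (int n) e) (c ^ n):]"
  by (induction n) (simp_all add: mult_single frag_cmul_distrib one_pCons single_one mult.commute add.commute)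

lemma prod_single: "(\<Prod>i\<in>K. single (f i) (g i)) = single (\<Sum>i\<in>K. f i) (\<Prod>i\<in>K. g i)"
  by (induction K rule: infinite_finite_induct) (simp_all add: mult_single single_one)

text \<open>\<open>\<Phi> (xv i)\<close> divides \<open>\<Phi> Y\<close>, which by
  \<open>aut_pair_Y\<close> divides a constant multiple of the monomial Y, and divisors of monomials
  are monomials. A constant image is impossible because \<Psi> would map it back to a
  constant.\<close>

lemma aut_pair_monomial:
  assumes "aut_pair \<Phi> \<Psi>" "i \<in> {2..m}"
  shows "\<exists>e c. c \<noteq> 0 \<and> \<Phi> (xv i) = [:single e c:] \<and> (\<forall>j. 0 \<le> lookup e j \<and> (j \<notin> {2..m} \<longrightarrow> lookup e j = 0)) \<and> e \<noteq> 0"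
proof -
  have endo: "alg_endo \<Phi>" "alg_endo \<Psi>" and inv: "\<And>x. x \<in> B \<Longrightarrow> \<Psi> (\<Phi> x) = x"
    using assms by (auto simp: aut_pair_def)
  obtain t b where tb: "t \<noteq> 0" "b \<in> R" "\<Phi> Z = kc t * Z + b" using aut_pair_Z[OF assms(1)] by blast
  obtain r where r: "r \<in> R" "\<Phi> Y * r = kc (t ^ d) * Y" using aut_pair_Y[OF assms(1) tb(3,2)] by metis
  have fin: "finite {2..m}" by simp
  obtain l where l: "k i = Suc l" using k_ge[OF assms(2)] by (cases "k i") auto
  define w where "w = \<Phi> (xv i) ^ l * (\<Prod>j\<in>{2..m}-{i}. \<Phi> (xv j) ^ k j) * r"
  have "w \<in> R" unfolding w_def
    by (intro R_mult R_power R_prod aut_pair_R[OF assms(1)] R_xv r) (use assms in auto)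
  then obtain w' where w': "w = [:w':]" using R_const by blast
  have "\<Phi> (xv i) \<in> R" by (intro aut_pair_R[OF assms(1)] R_xv assms)
  then obtain v where v: "\<Phi> (xv i) = [:v:]"
    "\<And>e j. e \<in> keys v \<Longrightarrow> 0 \<le> lookup e j \<and> (j \<notin> {2..m} \<longrightarrow> lookup e j = 0)" using R_const by metis
  have "\<Phi> Y * r = \<Phi> (xv i) * w"
    unfolding alg_endo_Y[OF endo(1)] w_def prod.remove[OF fin assms(2)] l by (simp add: ac_simps)
  then have "v * w' = single \<kappa> (t ^ d)"
    using r(2) by (simp add: v w' kc_def Y_def ymono_def mult_single mult.commute)
  then obtain e c where ec: "v = single e c" "c \<noteq> 0" using single_of_mult_eq_single tb(1) by (metis power_not_zero)
  have "e \<noteq> 0"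
  proof
    assume "e = 0"
    then have "\<Phi> (xv i) = kc c" using v ec by (simp add: kc_def)
    then have "\<Psi> (\<Phi> (xv i)) = kc c" by (simp add: alg_endoD[OF endo(2)])
    then have "single (single i (1::int)) (1::'k) = single 0 c"
      using inv xv_y_B[OF assms(2)] xv_y[OF assms(2)] by (simp add: kc_def ymono_def)
    then have "lookup (single (single i (1::int)) (1::'k)) (single i (1::int)) = lookup (single 0 c) (single i (1::int))" by simp
    then show False by (auto simp: lookup_single when_def split: if_splits)
  qed
  then show ?thesis using v ec by auto
qed

definition tdeg :: "(nat \<Rightarrow>\<^sub>0 int) \<Rightarrow> int" where
  "tdeg e = (\<Sum>j\<in>{2..m}. lookup e j)"

lemma tdeg_hom: "tdeg (a + b) = tdeg a + tdeg b" "tdeg (frag_cmul c a) = c * tdeg a" "tdeg 0 = 0"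
  "tdeg (sum f K) = (\<Sum>j\<in>K. tdeg (f j))"
proof -
  show 1: "tdeg (a + b) = tdeg a + tdeg b" for a b by (simp add: tdeg_def lookup_add sum.distrib)
  show 2: "tdeg 0 = 0" by (simp add: tdeg_def)
  show "tdeg (frag_cmul c a) = c * tdeg a" by (simp add: tdeg_def sum_distrib_left)
  show "tdeg (sum f K) = (\<Sum>j\<in>K. tdeg (f j))"
    by (induction K rule: infinite_finite_induct) (simp_all add: 1 2)
qed

lemma tdeg_pos:
  assumes "\<And>j. 0 \<le> lookup e j \<and> (j \<notin> {2..m} \<longrightarrow> lookup e j = 0)" "e \<noteq> 0"
  shows "tdeg e \<ge> 1"
proof -
  obtain j where j: "lookup e j \<noteq> 0" using assms(2) by (metis lookup_zero poly_mapping_eqI)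
  then have "j \<in> {2..m}" "lookup e j > 0" using assms(1)[of j] by auto
  moreover have "lookup e j \<le> tdeg e" unfolding tdeg_def
    using assms \<open>j \<in> {2..m}\<close> by (intro member_le_sum) auto
  ultimately show ?thesis by linarith
qed

lemma single_eq_singleD: "single e (c::'k) = single e' c' \<Longrightarrow> c \<noteq> 0 \<Longrightarrow> e = e'"
  by (metis lookup_single_eq lookup_single_not_eq)

text \<open>\<Psi> sends each variable to a monomial of total degree at least 1, so it does not
  lower total degrees of monomials. It sends the monomial \<open>\<Phi> (xv i)\<close> to
  \<open>xv i\<close>, of total degree 1; hence that monomial has total degree 1 as well.\<close>

lemma aut_pair_variable:
  assumes "aut_pair \<Phi> \<Psi>" "i \<in> {2..m}"
  shows "\<exists>j c. j \<in> {2..m} \<and> c \<noteq> 0 \<and> \<Phi> (xv i) = kc c * xv j"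
proof -
  have endo: "alg_endo \<Phi>" "alg_endo \<Psi>" and inv: "\<And>x. x \<in> B \<Longrightarrow> \<Psi> (\<Phi> x) = x"
    using assms by (auto simp: aut_pair_def)
  note E = alg_endoD[OF endo(1)] alg_endoD[OF endo(2)]
  obtain e c where e: "c \<noteq> 0" "\<Phi> (xv i) = [:single e c:]"
    "\<And>j. 0 \<le> lookup e j \<and> (j \<notin> {2..m} \<longrightarrow> lookup e j = 0)" "e \<noteq> 0"
    using aut_pair_monomial[OF assms] by metis
  obtain e' c' where e': "\<And>j. j \<in> {2..m} \<Longrightarrow> c' j \<noteq> 0" "\<And>j. j \<in> {2..m} \<Longrightarrow> \<Psi> (xv j) = [:single (e' j) (c' j):]"
    "\<And>j l. j \<in> {2..m} \<Longrightarrow> 0 \<le> lookup (e' j) l \<and> (l \<notin> {2..m} \<longrightarrow> lookup (e' j) l = 0)"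
    "\<And>j. j \<in> {2..m} \<Longrightarrow> e' j \<noteq> 0"
    using aut_pair_monomial[OF aut_pair_sym[OF assms(1)]] by metis
  have e_sum: "e = (\<Sum>j\<in>{2..m}. single j (lookup e j))"
  proof (rule poly_mapping_eqI)
    fix l
    have "lookup (\<Sum>j\<in>{2..m}. single j (lookup e j)) l = (\<Sum>j\<in>{2..m}. if j = l then lookup e j else 0)"
      by (simp add: lookup_sum lookup_single when_def)
    then show "lookup e l = lookup (\<Sum>j\<in>{2..m}. single j (lookup e j)) l" using e(3)[of l] by simp
  qed
  let ?n = "\<lambda>j. nat (lookup e j)"
  have "[:single e c:] = kc c * [:ymono (\<Sum>j\<in>{2..m}. single j (lookup e j)):]"
    by (subst e_sum) (simp add: kc_def ymono_def mult_single)
  also have "[:ymono (\<Sum>j\<in>{2..m}. single j (lookup e j)):] = (\<Prod>j\<in>{2..m}. xv j ^ ?n j)"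
    using e(3) by (simp add: prod_ymono[symmetric] prod_const_poly[symmetric])
      (intro prod.cong, auto simp: xv_y const_poly_power ymono_power frag_cmul_single)
  finally have "\<Phi> (xv i) = kc c * (\<Prod>j\<in>{2..m}. xv j ^ ?n j)" using e(2) by simp
  then have "\<Psi> (\<Phi> (xv i)) = kc c * (\<Prod>j\<in>{2..m}. \<Psi> (xv j) ^ ?n j)"
  proof -
    have xB: "xv j ^ ?n j \<in> B" if "j \<in> {2..m}" for j using that by (intro B_power xv_y_B)
    then have PB: "(\<Prod>j\<in>{2..m}. xv j ^ ?n j) \<in> B" by (rule B_prod)
    assume "\<Phi> (xv i) = kc c * (\<Prod>j\<in>{2..m}. xv j ^ ?n j)"
    then have "\<Psi> (\<Phi> (xv i)) = kc c * \<Psi> (\<Prod>j\<in>{2..m}. xv j ^ ?n j)"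
      by (simp only: E(9)[OF B_kc PB] E(10))
    also have "\<Psi> (\<Prod>j\<in>{2..m}. xv j ^ ?n j) = (\<Prod>j\<in>{2..m}. \<Psi> (xv j ^ ?n j))"
      by (rule alg_endo_prod[OF endo(2) xB])
    also have "\<dots> = (\<Prod>j\<in>{2..m}. \<Psi> (xv j) ^ ?n j)"
      by (intro prod.cong refl alg_endo_power[OF endo(2)] xv_y_B)
    finally show ?thesis .
  qed
  also have "(\<Prod>j\<in>{2..m}. \<Psi> (xv j) ^ ?n j) = (\<Prod>j\<in>{2..m}. [:single (frag_cmul (lookup e j) (e' j)) (c' j ^ ?n j):])"
    using e(3) e'(2) by (intro prod.cong) (auto simp: mono_poly_power)
  also have "\<dots> = [:single (\<Sum>j\<in>{2..m}. frag_cmul (lookup e j) (e' j)) (\<Prod>j\<in>{2..m}. c' j ^ ?n j):]"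
    by (simp add: prod_const_poly prod_single)
  finally have "xv i = kc c * \<dots>" using inv xv_y_B[OF assms(2)] by simp
  then have "single (single i (1::int)) 1 = single (\<Sum>j\<in>{2..m}. frag_cmul (lookup e j) (e' j)) (c * (\<Prod>j\<in>{2..m}. c' j ^ ?n j))"
    using assms(2) by (simp add: xv_y kc_def ymono_def mult_single mult.commute)
  then have "single i 1 = (\<Sum>j\<in>{2..m}. frag_cmul (lookup e j) (e' j))" by (rule single_eq_singleD) simp
  then have "tdeg (single i 1) = (\<Sum>j\<in>{2..m}. lookup e j * tdeg (e' j))" by (simp add: tdeg_hom)
  moreover have "tdeg (single i 1) = 1" using assms(2) by (simp add: tdeg_def lookup_single when_def)
  moreover have "(\<Sum>j\<in>{2..m}. lookup e j * 1) \<le> (\<Sum>j\<in>{2..m}. lookup e j * tdeg (e' j))"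
    by (intro sum_mono mult_left_mono tdeg_pos) (use e e' in auto)
  ultimately have "tdeg e \<le> 1" by (simp add: tdeg_def)
  obtain j where j: "lookup e j \<noteq> 0" using e(4) by (metis lookup_zero poly_mapping_eqI)
  then have jm: "j \<in> {2..m}" and j1: "lookup e j \<ge> 1" using e(3)[of j] by auto
  have "tdeg e = lookup e j + (\<Sum>l\<in>{2..m}-{j}. lookup e l)"
    unfolding tdeg_def using jm by (simp add: sum.remove)
  moreover have "0 \<le> (\<Sum>l\<in>{2..m}-{j}. lookup e l)" using e(3) by (intro sum_nonneg) auto
  ultimately have ej: "lookup e j = 1" and "(\<Sum>l\<in>{2..m}-{j}. lookup e l) = 0" using \<open>tdeg e \<le> 1\<close> j1 by linarith+
  then have z: "lookup e l = 0" if "l \<in> {2..m} - {j}" for l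
    using that e(3) by (subst (asm) sum_nonneg_eq_0_iff) auto
  have "e = single j 1"
  proof (rule poly_mapping_eqI)
    show "lookup e l = lookup (single j 1) l" for l
      using ej z[of l] e(3)[of l] by (cases "l = j") (auto simp: lookup_single when_def)
  qed
  then have "\<Phi> (xv i) = kc c * xv j" using jm e(2) by (simp add: xv_y kc_def ymono_def mult_single)
  then show ?thesis using jm e(1) by blast
qed

lemma xv_y_inj:
  assumes "i \<in> {2..m}" "j \<in> {2..m}" "kc c * xv i = kc c' * xv j" "c \<noteq> 0"
  shows "i = j"
proof -
  have "single (single i (1::int)) c = single (single j 1) c'"
    using assms by (simp add: xv_y kc_def ymono_def mult_single)
  from single_eq_singleD[OF this assms(4)] have "lookup (single i (1::int)) i = lookup (single j 1) i" by simp
  then show ?thesis by (simp add: lookup_single when_def split: if_splits)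
qed

text \<open>The index map is injective because \<Phi> is. As \<open>\<Phi> Y\<close> divides a
  constant multiple of Y, \<open>k i \<le> k (\<sigma> i)\<close> for all i, and since both sides
  have the same sum, equality holds. Thus \<open>\<Phi> Y\<close> is a constant multiple of Y, and
  the second relation of \<open>aut_pair_Y\<close>, where d t^(d-1) is nonzero in characteristic
  zero, makes Y divide b.\<close>

theorem aut_pair_structure:
  assumes "aut_pair \<Phi> \<Psi>"
  obtains \<sigma> t f where "\<sigma> \<in> S_V m k TYPE('k)" "\<And>i. i \<in> {2..m+1} \<Longrightarrow> t i \<noteq> 0"
    "\<And>i. i \<in> {2..m} \<Longrightarrow> \<Phi> (xv i) = kc (t i) * xv (\<sigma> i)"
    "f \<in> R" "\<Phi> Z = kc (t (m+1)) * Z + Y * f"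
proof -
  have endo: "alg_endo \<Phi>" "alg_endo \<Psi>" and inv: "\<And>x. x \<in> B \<Longrightarrow> \<Psi> (\<Phi> x) = x"
    using assms by (auto simp: aut_pair_def)
  note E = alg_endoD[OF endo(1)] alg_endoD[OF endo(2)]
  obtain \<sigma>0 t0 where \<sigma>0: "\<And>i. i \<in> {2..m} \<Longrightarrow> \<sigma>0 i \<in> {2..m} \<and> t0 i \<noteq> 0 \<and> \<Phi> (xv i) = kc (t0 i) * xv (\<sigma>0 i)"
    using aut_pair_variable[OF assms] by metis
  \<comment> \<open>Extended by the identity, since \<open>permutes\<close> asks for fixed points
    outside the set.\<close>
  define \<sigma> where "\<sigma> i = (if i \<in> {2..m} then \<sigma>0 i else i)" for i
  obtain tz b where tz: "tz \<noteq> 0" "b \<in> R" "\<Phi> Z = kc tz * Z + b" using aut_pair_Z[OF assms] by blast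
  define t where "t i = (if i = m + 1 then tz else t0 i)" for i
  have \<sigma>: "\<sigma> i \<in> {2..m}" "\<Phi> (xv i) = kc (t i) * xv (\<sigma> i)" "t i \<noteq> 0" if "i \<in> {2..m}" for i
    using \<sigma>0[OF that] that by (auto simp: \<sigma>_def t_def)
  have inj: "inj_on \<sigma> {2..m}"
  proof (rule inj_onI)
    fix i j assume ij: "i \<in> {2..m}" "j \<in> {2..m}" "\<sigma> i = \<sigma> j"
    have "\<Phi> (kc (t j) * xv i) = \<Phi> (kc (t i) * xv j)"
      using ij xv_y_B by (simp add: E \<sigma> ac_simps)
    then have "kc (t j) * xv i = kc (t i) * xv j"
      using inv ij xv_y_B by (metis B_kc B_mult)
    then show "i = j" using xv_y_inj ij \<sigma> by blast
  qed
  have perm: "\<sigma> permutes {2..m}"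
  proof (rule bij_imp_permutes)
    show "bij_betw \<sigma> {2..m} {2..m}"
      using inj endo_inj_surj[of "{2..m}" \<sigma>] \<sigma>(1) by (simp add: bij_betw_def image_subset_iff)
  qed (auto simp: \<sigma>_def)
  obtain r g where rg: "r \<in> R" "\<Phi> Y * r = kc (tz ^ d) * Y"
    "g \<in> R" "\<Phi> Y * g = kc (of_nat d * tz ^ (d - 1)) * b"
    using aut_pair_Y[OF assms tz(3,2)] by metis
  define \<mu> where "\<mu> = (\<Sum>i\<in>{2..m}. single (\<sigma> i) (int (k i)))"
  define c where "c = (\<Prod>i\<in>{2..m}. t i ^ k i)"
  have c0: "c \<noteq> 0" using \<sigma>(3) by (simp add: c_def)
  have Y\<mu>: "\<Phi> Y = [:single \<mu> c:]"
  proof -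
    have "\<Phi> Y = (\<Prod>i\<in>{2..m}. [:single (single (\<sigma> i) (int (k i))) (t i ^ k i):])"
      unfolding alg_endo_Y[OF endo(1)]
    proof (rule prod.cong)
      fix i assume i: "i \<in> {2..m}"
      have "\<Phi> (xv i) = [:single (single (\<sigma> i) 1) (t i):]"
        using \<sigma>[OF i] by (simp add: xv_y kc_def ymono_def mult_single)
      then show "\<Phi> (xv i) ^ k i = [:single (single (\<sigma> i) (int (k i))) (t i ^ k i):]"
        by (simp add: mono_poly_power frag_cmul_single)
    qed simp
    then show ?thesis by (simp add: prod_const_poly prod_single \<mu>_def c_def)
  qed
  have lookup_\<mu>: "lookup \<mu> (\<sigma> i) = int (k i)" if i: "i \<in> {2..m}" for i
  proof -
    have "lookup \<mu> (\<sigma> i) = (\<Sum>j\<in>{2..m}. if j = i then int (k j) else 0)"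
      unfolding \<mu>_def lookup_sum using inj i
      by (intro sum.cong) (auto simp: lookup_single when_def inj_on_eq_iff)
    then show ?thesis using i by simp
  qed
  obtain v where v: "r = [:v:]" "\<And>e j. e \<in> keys v \<Longrightarrow> 0 \<le> lookup e j" using R_const[OF rg(1)] by blast
  have eq: "v * single \<mu> c = single \<kappa> (tz ^ d)"
    using rg(2)[unfolded Y\<mu>] by (simp add: v kc_def Y_def ymono_def mult_single mult.commute)
  then obtain e a where ea: "v = single e a" "a \<noteq> 0" using single_of_mult_eq_single tz(1) by (metis power_not_zero)
  have "e + \<mu> = \<kappa>" using eq c0 ea single_eq_singleD[of "e + \<mu>" "a * c"] by (simp add: mult_single)
  then have le: "k i \<le> k (\<sigma> i)" if i: "i \<in> {2..m}" for i
  proof -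
    have "lookup \<kappa> (\<sigma> i) = lookup e (\<sigma> i) + lookup \<mu> (\<sigma> i)" using \<open>e + \<mu> = \<kappa>\<close> by (metis lookup_add)
    moreover have "0 \<le> lookup e (\<sigma> i)" using v(2)[of e] ea by simp
    ultimately have "int (k i) \<le> int (k (\<sigma> i))" using \<sigma>(1)[OF i] lookup_\<mu>[OF i] by (simp add: lookup_\<kappa>)
    then show ?thesis by simp
  qed
  have "(\<Sum>i\<in>{2..m}. k i) = (\<Sum>i\<in>{2..m}. k (\<sigma> i))" using sum.permute[OF perm, of k] by (simp add: comp_def)
  then have k\<sigma>: "k i = k (\<sigma> i)" if "i \<in> {2..m}" for i
    by (rule sum_mono_inv[of k "{2..m}" "\<lambda>i. k (\<sigma> i)"]) (use le that \<open>sum k {2..m} = _\<close> in simp_all)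
  have S: "\<sigma> \<in> S_V m k TYPE('k)"
  proof -
    have "(\<Prod>i\<in>{2..m}. Var (\<sigma> i) ^ k i) = (\<Prod>i\<in>{2..m}. (Var (\<sigma> i) ^ k (\<sigma> i) :: 'k mpoly))"
      using k\<sigma> by (intro prod.cong) auto
    also have "\<dots> = dmonom m k"
      unfolding dmonom_def using prod.permute[OF perm, of "\<lambda>i. Var i ^ k i :: 'k mpoly"] by (simp add: comp_def)
    finally show ?thesis using perm by (simp add: S_V_def)
  qed
  have "\<mu> = \<kappa>"
  proof -
    have "\<mu> = (\<Sum>i\<in>{2..m}. single (\<sigma> i) (int (k (\<sigma> i))))" unfolding \<mu>_def using k\<sigma> by (intro sum.cong) auto
    also have "\<dots> = \<kappa>" unfolding \<kappa>_def
      using sum.permute[OF perm, of "\<lambda>i. single i (int (k i))"] by (simp add: comp_def)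
    finally show ?thesis .
  qed
  then have Yc: "\<Phi> Y = kc c * Y" by (subst Y\<mu>) (simp add: kc_def Y_def ymono_def mult_single)
  define a' where "a' = of_nat d * tz ^ (d - 1)"
  have a': "a' \<noteq> 0" using tz(1) d_ge by (simp add: a'_def)
  have "b = kc (inverse a' * a') * b" using a' by simp
  also have "\<dots> = kc (inverse a') * (kc a' * b)" by (simp only: kc.c_mult mult.assoc)
  also have "kc a' * b = Y * (kc c * g)" unfolding a'_def rg(4)[symmetric] Yc by (simp add: ac_simps)
  finally have b: "b = Y * (kc (inverse a') * (kc c * g))" by (simp add: ac_simps)
  show thesis
  proof (rule that)
    show "kc (inverse a') * (kc c * g) \<in> R" by (intro R_mult R_kc rg)
    show "\<Phi> Z = kc (t (m+1)) * Z + Y * (kc (inverse a') * (kc c * g))"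
      unfolding tz(3) b[symmetric] by (simp add: t_def)
    show "t i \<noteq> 0" if "i \<in> {2..m+1}" for i using that \<sigma>(3)[of i] tz(1) by (cases "i = m + 1") (auto simp: t_def)
  qed (use S \<sigma> in auto)
qed

end

section \<open>Semidirect products and Taylor expansion\<close>

text \<open>Dedekind's modular law: if x = n c lies in H and N is contained in H, then c lies in H,
  so H is the product of N and C \<inter> H. It reduces the theorem to a decomposition of the full
  automorphism group together with U being contained in the centralizer.\<close>

lemma semidirect_complement:
  fixes G (structure)
  assumes "group G" "subgroup H G" "N \<lhd> G" "N \<subseteq> H" "subgroup C G" "N \<inter> C = {\<one>\<^bsub>G\<^esub>}"
    and split: "\<And>x. x \<in> H \<Longrightarrow> \<exists>n\<in>N. \<exists>c\<in>C. x = n \<otimes>\<^bsub>G\<^esub> c"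
  defines "SD \<equiv> semidirect (G\<lparr>carrier := N\<rparr>) (G\<lparr>carrier := C \<inter> H\<rparr>) (conj_act G)"
  shows "subgroup (C \<inter> H) (G\<lparr>carrier := H\<rparr>)" "N \<lhd> G\<lparr>carrier := H\<rparr>"
    "(\<lambda>(n, c). n \<otimes>\<^bsub>G\<^esub> c) \<in> iso SD (G\<lparr>carrier := H\<rparr>)"
    "G\<lparr>carrier := H\<rparr> \<cong> SD"
proof -
  interpret group G by fact
  interpret H: subgroup H G by fact
  interpret C: subgroup C G by fact
  interpret N: normal N G by fact
  have Ccap: "subgroup (C \<inter> H) G"
    using assms(2,5) by (simp add: subgroups_Inter_pair)
  show "subgroup (C \<inter> H) (G\<lparr>carrier := H\<rparr>)"
    by (rule subgroup_incl[OF Ccap assms(2)]) simp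
  show "N \<lhd> G\<lparr>carrier := H\<rparr>" by (rule normal_restrict_supergroup) fact+
  let ?f = "\<lambda>(n, c). n \<otimes>\<^bsub>G\<^esub> c"
  have carr: "carrier SD = N \<times> (C \<inter> H)" by (simp add: SD_def semidirect_def)
  have mult: "(n, c) \<otimes>\<^bsub>SD\<^esub> (n', c') = (n \<otimes> (c \<otimes> n' \<otimes> inv c), c \<otimes> c')" for n c n' c'
    by (simp add: SD_def semidirect_def conj_act_def)
  have closed: "x \<otimes>\<^bsub>SD\<^esub> y \<in> carrier SD" if "x \<in> carrier SD" "y \<in> carrier SD" for x y
    using that N.inv_op_closed2 by (auto simp: carr mult)
  have hom: "?f (x \<otimes>\<^bsub>SD\<^esub> y) = ?f x \<otimes> ?f y" if xSD: "x \<in> carrier SD" "y \<in> carrier SD" for x y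
  proof -
    obtain n c n' c' where xy: "x = (n, c)" "y = (n', c')" "n \<in> N" "n' \<in> N" "c \<in> C" "c' \<in> C"
      using xSD by (auto simp: carr)
    then have G: "n \<in> carrier G" "n' \<in> carrier G" "c \<in> carrier G" "c' \<in> carrier G"
      using N.mem_carrier C.mem_carrier by auto
    then have "inv c \<otimes> (c \<otimes> c') = c'" by (simp add: m_assoc[symmetric])
    then show ?thesis using G by (simp add: xy mult m_assoc)
  qed
  have in_H: "?f x \<in> H" if "x \<in> carrier SD" for x
    using that assms(4) by (auto simp: carr)
  have inj: "inj_on ?f (carrier SD)"
  proof (rule inj_onI)
    fix x y assume xy: "x \<in> carrier SD" "y \<in> carrier SD" "?f x = ?f y"
    then obtain n c n' c' where *: "x = (n, c)" "y = (n', c')" "n \<in> N" "n' \<in> N" "c \<in> C" "c' \<in> C"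
      by (auto simp: carr)
    then have G: "n \<in> carrier G" "n' \<in> carrier G" "c \<in> carrier G" "c' \<in> carrier G"
      using N.mem_carrier C.mem_carrier by auto
    have eq: "n \<otimes> c = n' \<otimes> c'" using xy * by simp
    then have "inv n' \<otimes> n = c' \<otimes> inv c"
      using G by (metis inv_closed inv_solve_left inv_solve_right m_assoc m_closed)
    moreover have "inv n' \<otimes> n \<in> N" "c' \<otimes> inv c \<in> C" using * by auto
    ultimately have "inv n' \<otimes> n \<in> N \<inter> C" by simp
    then have "inv n' \<otimes> n = \<one>" using assms(6) by blast
    then have "n = n'" using G by (metis inv_closed inv_equality inv_inv)
    moreover from this have "c = c'" using eq G by simp
    ultimately show "x = y" by (simp add: *)
  qed
  have surj: "?f ` carrier SD = H"
  proof
    show "H \<subseteq> ?f ` carrier SD"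
    proof
      fix x assume x: "x \<in> H"
      then obtain n c where nc: "n \<in> N" "c \<in> C" "x = n \<otimes> c" using split by blast
      then have "c = inv n \<otimes> x" using N.mem_carrier C.mem_carrier x H.mem_carrier by (simp add: inv_solve_left)
      moreover have "inv n \<in> H" using nc assms(4) H.m_inv_closed by blast
      ultimately have "c \<in> H" using x H.m_closed by metis
      then show "x \<in> ?f ` carrier SD" using nc by (force simp: carr)
    qed
  qed (use in_H in blast)
  show iso: "?f \<in> iso SD (G\<lparr>carrier := H\<rparr>)"
    using in_H hom inj surj by (auto simp: iso_def hom_def bij_betw_def)
  \<comment> \<open>\<open>\<cong>\<close> is read from the subgroup to the semidirect product, so
    the inverse of the multiplication map is required.\<close>
  define g where "g = inv_into (carrier SD) ?f"
  have g: "g x \<in> carrier SD" "?f (g x) = x" if "x \<in> H" for x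
    using that surj unfolding g_def by (metis inv_into_into, metis f_inv_into_f)
  have "g (x \<otimes> y) = g x \<otimes>\<^bsub>SD\<^esub> g y" if "x \<in> H" "y \<in> H" for x y
  proof -
    have "?f (g x \<otimes>\<^bsub>SD\<^esub> g y) = x \<otimes> y" using hom[of "g x" "g y"] g that by simp
    then show ?thesis using closed[of "g x" "g y"] g that inj unfolding g_def by (metis inv_into_f_f)
  qed
  moreover have "bij_betw g H (carrier SD)"
    unfolding g_def using inj surj by (metis bij_betw_def bij_betw_inv_into)
  ultimately have "g \<in> iso (G\<lparr>carrier := H\<rparr>) SD" using g by (auto simp: iso_def hom_def)
  then show "G\<lparr>carrier := H\<rparr> \<cong> SD" by (rule is_isoI)
qed

section \<open>Taylor expansion\<close>

lemma pderiv_funpow_zero: "degree (q :: 'a::{idom, semiring_char_0} poly) < n \<Longrightarrow> (pderiv ^^ n) q = 0"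
proof (induction n arbitrary: q)
  case (Suc n)
  have z: "(pderiv ^^ n) 0 = (0 :: 'a poly)" for n by (induction n) simp_all
  show ?case
  proof (cases "degree q = 0")
    case True
    then have "pderiv q = 0" by (simp add: pderiv_eq_0_iff)
    then show ?thesis by (simp add: funpow_swap1 z)
  next
    case False
    then show ?thesis using Suc by (simp add: funpow_swap1 degree_pderiv)
  qed
qed simp

text \<open>The higher Leibniz rule for a + z q, in which only the first derivative of z is nonzero.
  Taking order i + 1 keeps the last term free of predecessors.\<close>

lemma pderiv_funpow_pCons:
  "(pderiv ^^ Suc i) (pCons a q) = pCons 0 ((pderiv ^^ Suc i) q) + of_nat (Suc i) * (pderiv ^^ i) q"
  for q :: "'a::idom poly"
proof (induction i)
  case (Suc i)
  have "(pderiv ^^ Suc (Suc i)) (pCons a q) = pderiv ((pderiv ^^ Suc i) (pCons a q))" by simp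
  also have "\<dots> = pderiv (pCons 0 ((pderiv ^^ Suc i) q)) + pderiv (of_nat (Suc i) * (pderiv ^^ i) q)"
    by (simp only: Suc pderiv_add)
  also have "pderiv (of_nat (Suc i) * (pderiv ^^ i) q) = of_nat (Suc i) * (pderiv ^^ Suc i) q"
    by (simp only: pderiv_mult pderiv_of_nat) simp
  finally show ?case by (simp add: pderiv_pCons algebra_simps)
qed (simp add: pderiv_pCons)

text \<open>Taylor's formula; \<open>c i\<close> plays the role of \<open>1 / i!\<close>.\<close>

lemma pcompose_shift_eq_sum:
  fixes q :: "'a::{idom, semiring_char_0} poly"
  assumes c: "c 0 = 1" "\<And>i. of_nat (Suc i) * c (Suc i) = c i" and "degree q \<le> n"
  shows "pcompose q [:w, 1:] = (\<Sum>i\<le>n. smult (c i * w ^ i) ((pderiv ^^ i) q))"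
  using assms(3)
proof (induction q arbitrary: n)
  case 0
  have z: "(pderiv ^^ n) 0 = (0 :: 'a poly)" for n by (induction n) simp_all
  show ?case by (simp add: z)
next
  case (pCons a q)
  show ?case
  proof (cases "q = 0")
    case True
    have "(pderiv ^^ i) [:a:] = 0" if "i > 0" for i
      using that by (intro pderiv_funpow_zero) simp
    then have "(\<Sum>i\<le>n. smult (c i * w ^ i) ((pderiv ^^ i) [:a:])) = (\<Sum>i\<in>{0}. smult (c i * w ^ i) ((pderiv ^^ i) [:a:]))"
      by (intro sum.mono_neutral_right) auto
    then show ?thesis using True c by (simp add: pcompose_pCons)
  next
    case False
    then obtain n' where n': "n = Suc n'" "degree q \<le> n'" using pCons.prems by (cases n) auto
    \<comment> \<open>Each Taylor term of a + z q splits into z times the term for q of the same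
      order and w times the term of the preceding order, matching the recursion of
      \<open>pcompose\<close>.\<close>
    have step: "smult (c (Suc i) * w ^ Suc i) ((pderiv ^^ Suc i) (pCons a q))
        = [:0, 1:] * smult (c (Suc i) * w ^ Suc i) ((pderiv ^^ Suc i) q)
          + [:w:] * smult (c i * w ^ i) ((pderiv ^^ i) q)" for i
    proof -
      have "smult (c (Suc i) * w ^ Suc i) (of_nat (Suc i) * (pderiv ^^ i) q)
          = smult (of_nat (Suc i) * c (Suc i) * w ^ Suc i) ((pderiv ^^ i) q)"
        by (simp only: of_nat_poly) (simp add: mult_ac)
      also have "\<dots> = [:w:] * smult (c i * w ^ i) ((pderiv ^^ i) q)"
        by (simp only: c) (simp add: mult_ac)
      finally show ?thesis unfolding pderiv_funpow_pCons smult_add_right by simp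
    qed
    have "(\<Sum>i\<le>n. smult (c i * w ^ i) ((pderiv ^^ i) (pCons a q)))
        = pCons a q + (\<Sum>i\<le>n'. smult (c (Suc i) * w ^ Suc i) ((pderiv ^^ Suc i) (pCons a q)))"
      unfolding n' sum.atMost_Suc_shift by (simp add: c)
    also have "\<dots> = [:a:] + [:0, 1:] * (q + (\<Sum>i\<le>n'. smult (c (Suc i) * w ^ Suc i) ((pderiv ^^ Suc i) q)))
        + [:w:] * (\<Sum>i\<le>n'. smult (c i * w ^ i) ((pderiv ^^ i) q))"
      unfolding step sum.distrib sum_distrib_left by (simp add: distrib_left sum_distrib_left)
    also have "q + (\<Sum>i\<le>n'. smult (c (Suc i) * w ^ Suc i) ((pderiv ^^ Suc i) q))
        = (\<Sum>i\<le>n. smult (c i * w ^ i) ((pderiv ^^ i) q))"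
      unfolding n' sum.atMost_Suc_shift by (simp add: c)
    also have "\<dots> = pcompose q [:w, 1:]" using pCons.IH[of n] n' by simp
    also have "(\<Sum>i\<le>n'. smult (c i * w ^ i) ((pderiv ^^ i) q)) = pcompose q [:w, 1:]"
      using pCons.IH[of n'] n' by simp
    finally show ?thesis by (simp add: pcompose_pCons algebra_simps)
  qed
qed

context danielewski
begin

abbreviation C where "C \<equiv> carrier A"

sublocale A: cring A by (rule cring_A)

section \<open>Passing between residue classes and \<open>B\<close>\<close>

definition \<eta> :: "'k mpoly set \<Rightarrow> 'k laurent poly" where
  "\<eta> a = ev (SOME p. p \<in> polys_in vs \<and> cl p = a)"

definition \<theta> :: "'k laurent poly \<Rightarrow> 'k mpoly set" where
  "\<theta> x = cl (SOME p. p \<in> polys_in vs \<and> ev p = x)"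

lemma \<eta>_cl: assumes "p \<in> polys_in vs" shows "\<eta> (cl p) = ev p"
proof -
  have "(SOME q. q \<in> polys_in vs \<and> cl q = cl p) \<in> polys_in vs \<and> cl (SOME q. q \<in> polys_in vs \<and> cl q = cl p) = cl p"
    by (rule someI) (use assms in simp)
  then show ?thesis unfolding \<eta>_def using assms cl_eq_ev by blast
qed

lemma \<theta>_ev: assumes "p \<in> polys_in vs" shows "\<theta> (ev p) = cl p"
proof -
  have "(SOME q. q \<in> polys_in vs \<and> ev q = ev p) \<in> polys_in vs \<and> ev (SOME q. q \<in> polys_in vs \<and> ev q = ev p) = ev p"
    by (rule someI) (use assms in simp)
  then show ?thesis unfolding \<theta>_def using assms cl_eq_ev by blast
qed

lemma C_cases: assumes "a \<in> C" obtains p where "p \<in> polys_in vs" "a = cl p"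
  using assms carrier_A by blast

lemma B_cases: assumes "x \<in> B" obtains p where "p \<in> polys_in vs" "x = ev p"
  using assms unfolding B_def by blast

lemma \<eta>_B: "a \<in> C \<Longrightarrow> \<eta> a \<in> B"
  by (elim C_cases) (simp only: \<eta>_cl B_ev)

lemma \<theta>_C: "x \<in> B \<Longrightarrow> \<theta> x \<in> C"
  by (elim B_cases) (simp only: \<theta>_ev cl_in)

lemma \<theta>_\<eta>: "a \<in> C \<Longrightarrow> \<theta> (\<eta> a) = a"
  by (elim C_cases) (simp only: \<eta>_cl \<theta>_ev)

lemma \<eta>_\<theta>: "x \<in> B \<Longrightarrow> \<eta> (\<theta> x) = x"
  by (elim B_cases) (simp only: \<eta>_cl \<theta>_ev)

lemma \<eta>_eq_iff: "a \<in> C \<Longrightarrow> b \<in> C \<Longrightarrow> \<eta> a = \<eta> b \<longleftrightarrow> a = b"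
  using \<theta>_\<eta> by metis

lemma \<eta>_add: "a \<in> C \<Longrightarrow> b \<in> C \<Longrightarrow> \<eta> (a \<oplus>\<^bsub>A\<^esub> b) = \<eta> a + \<eta> b"
  by (elim C_cases) (simp only: cl_add \<eta>_cl polys_in_add ev_hom)

lemma \<eta>_mult: "a \<in> C \<Longrightarrow> b \<in> C \<Longrightarrow> \<eta> (a \<otimes>\<^bsub>A\<^esub> b) = \<eta> a * \<eta> b"
  by (elim C_cases) (simp only: cl_mult \<eta>_cl polys_in_mult ev_hom)

lemma \<eta>_Const [simp]: "\<eta> (cl (Const c)) = kc c"
  by (subst \<eta>_cl) simp_all

lemma \<eta>_0 [simp]: "\<eta> \<zero>\<^bsub>A\<^esub> = 0" and \<eta>_1 [simp]: "\<eta> \<one>\<^bsub>A\<^esub> = 1"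
  by (simp_all add: cl_hom \<eta>_cl[simplified])

lemma \<eta>_Var: "i \<in> vs \<Longrightarrow> \<eta> (cl (Var i)) = xv i"
  by (subst \<eta>_cl) (auto intro: polys_in_Var)

lemma Const_C [simp]: "cl (Const c) \<in> C"
  by (intro cl_in) simp

lemma \<eta>_eq_0_iff: "a \<in> C \<Longrightarrow> \<eta> a = 0 \<longleftrightarrow> a = \<zero>\<^bsub>A\<^esub>"
  using \<eta>_eq_iff[of a "\<zero>\<^bsub>A\<^esub>"] by simp

lemma \<eta>_finsum:
  "finite K \<Longrightarrow> (\<And>i. i \<in> K \<Longrightarrow> f i \<in> C) \<Longrightarrow> \<eta> (\<Oplus>\<^bsub>A\<^esub>i\<in>K. f i) = (\<Sum>i\<in>K. \<eta> (f i))"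
proof (induction K rule: finite_induct)
  case (insert i K)
  then show ?case by (subst A.finsum_insert) (auto simp: \<eta>_add A.finsum_closed)
qed simp

text \<open>Transport along the identification of residue classes with \<open>B\<close>, which makes
  the results on \<open>alg_endo\<close> and \<open>aut_pair\<close> available for automorphisms of
  the coordinate ring.\<close>

definition lft :: "('k mpoly set \<Rightarrow> 'k mpoly set) \<Rightarrow> 'k laurent poly \<Rightarrow> 'k laurent poly" where
  "lft \<phi> x = \<eta> (\<phi> (\<theta> x))"

lemma \<eta>_lft: "a \<in> C \<Longrightarrow> \<eta> (\<phi> a) = lft \<phi> (\<eta> a)"
  by (simp add: lft_def \<theta>_\<eta>)

section \<open>The automorphism group\<close>

abbreviation G where "G \<equiv> AutV m k P"

text \<open>Separates bijectivity and extensionality, which belong to \<open>BijGroup\<close>, from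
  the algebraic laws, which are stated on \<open>B\<close>.\<close>

lemma AutV_iff: "\<phi> \<in> carrier G \<longleftrightarrow> \<phi> \<in> Bij C \<and> alg_endo (lft \<phi>)"
proof
  assume "\<phi> \<in> carrier G"
  then have \<phi>: "\<phi> \<in> ring_iso A A" "\<phi> \<in> extensional C" "\<And>c. \<phi> (cl (Const c)) = cl (Const c)"
    by (auto simp: AutV_def Let_def)
  note I = ring_iso_memE[OF \<phi>(1)]
  have "alg_endo (lft \<phi>)"
    unfolding alg_endo_def
  proof (intro conjI ballI allI)
    fix x y assume x: "x \<in> B" and y: "y \<in> B"
    note xy = \<theta>_C[OF x] \<theta>_C[OF y]
    have "\<theta> (x + y) = \<theta> x \<oplus>\<^bsub>A\<^esub> \<theta> y" "\<theta> (x * y) = \<theta> x \<otimes>\<^bsub>A\<^esub> \<theta> y"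
      using x y xy by (auto simp: \<eta>_eq_iff[symmetric] \<eta>_add \<eta>_mult \<eta>_\<theta> B_closed \<theta>_C)
    then show "lft \<phi> (x + y) = lft \<phi> x + lft \<phi> y" "lft \<phi> (x * y) = lft \<phi> x * lft \<phi> y"
      using xy by (simp_all add: lft_def I \<eta>_add \<eta>_mult)
  next
    show "lft \<phi> x \<in> B" if "x \<in> B" for x using that by (simp add: lft_def I \<theta>_C \<eta>_B)
    have "\<theta> (kc c) = cl (Const c)" for c using \<theta>_ev[of "Const c"] by simp
    then show "lft \<phi> (kc c) = kc c" for c by (simp add: lft_def \<phi>(3))
  qed
  then show "\<phi> \<in> Bij C \<and> alg_endo (lft \<phi>)" using \<phi> I by (simp add: Bij_def)
next
  assume \<phi>: "\<phi> \<in> Bij C \<and> alg_endo (lft \<phi>)"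
  then have in_C: "\<phi> a \<in> C" if "a \<in> C" for a using that by (auto dest: Bij_imp_funcset)
  note E = alg_endoD[OF conjunct2[OF \<phi>]]
  have "\<phi> \<in> ring_iso A A"
  proof (rule ring_iso_memI)
    fix a b assume ab: "a \<in> C" "b \<in> C"
    then have "\<eta> (\<phi> (a \<otimes>\<^bsub>A\<^esub> b)) = \<eta> (\<phi> a \<otimes>\<^bsub>A\<^esub> \<phi> b)" "\<eta> (\<phi> (a \<oplus>\<^bsub>A\<^esub> b)) = \<eta> (\<phi> a \<oplus>\<^bsub>A\<^esub> \<phi> b)"
      by (simp_all add: \<eta>_lft[where \<phi>=\<phi>] \<eta>_add \<eta>_mult E in_C \<eta>_B)
    then show "\<phi> (a \<otimes>\<^bsub>A\<^esub> b) = \<phi> a \<otimes>\<^bsub>A\<^esub> \<phi> b" "\<phi> (a \<oplus>\<^bsub>A\<^esub> b) = \<phi> a \<oplus>\<^bsub>A\<^esub> \<phi> b"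
      using ab in_C by (simp_all add: \<eta>_eq_iff)
  next
    have "\<eta> (\<phi> \<one>\<^bsub>A\<^esub>) = \<eta> \<one>\<^bsub>A\<^esub>" by (simp add: \<eta>_lft[where \<phi>=\<phi>] E)
    then show "\<phi> \<one>\<^bsub>A\<^esub> = \<one>\<^bsub>A\<^esub>" using \<eta>_eq_iff in_C A.one_closed by blast
  qed (use \<phi> in_C in \<open>auto simp: Bij_def\<close>)
  moreover have "\<phi> (cl (Const c)) = cl (Const c)" for c
  proof -
    have "\<eta> (\<phi> (cl (Const c))) = \<eta> (cl (Const c))" by (simp add: \<eta>_lft[where \<phi>=\<phi>] E)
    then show ?thesis using \<eta>_eq_iff in_C Const_C by blast
  qed
  ultimately show "\<phi> \<in> carrier G" using \<phi> by (simp add: AutV_def Let_def Bij_def)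
qed

lemma AutV_C: "\<phi> \<in> carrier G \<Longrightarrow> a \<in> C \<Longrightarrow> \<phi> a \<in> C"
  by (auto simp: AutV_iff dest: Bij_imp_funcset)

lemma G_mult: "\<phi> \<in> carrier G \<Longrightarrow> \<psi> \<in> carrier G \<Longrightarrow> \<phi> \<otimes>\<^bsub>G\<^esub> \<psi> = compose C \<phi> \<psi>"
  by (simp add: AutV_iff) (simp add: AutV_def Let_def BijGroup_def)

lemma G_one: "\<one>\<^bsub>G\<^esub> = (\<lambda>a\<in>C. a)"
  by (simp add: AutV_def Let_def BijGroup_def)

lemma alg_endo_cong:
  assumes "alg_endo \<Phi>" "\<And>x. x \<in> B \<Longrightarrow> \<Phi> x = \<Phi>' x"
  shows "alg_endo \<Phi>'"
  unfolding alg_endo_def using alg_endoD[OF assms(1)] by (simp add: assms(2)[symmetric] B_add B_mult)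

lemma subgroup_AutV: "subgroup (carrier G) (BijGroup C)"
proof (rule group.subgroupI[OF group_BijGroup])
  show "carrier G \<subseteq> carrier (BijGroup C)" by (auto simp: AutV_iff BijGroup_def)
  have "(\<lambda>a\<in>C. a) \<in> carrier G"
    unfolding AutV_iff
  proof
    show "alg_endo (lft (\<lambda>a\<in>C. a))"
      by (rule alg_endo_cong[of "\<lambda>x. x"]) (auto simp: alg_endo_def lft_def \<theta>_C \<eta>_\<theta>)
  qed (rule id_Bij)
  then show "carrier G \<noteq> {}" by blast
next
  fix \<phi> \<psi> assume \<phi>: "\<phi> \<in> carrier G" and \<psi>: "\<psi> \<in> carrier G"
  have "alg_endo (lft (compose C \<phi> \<psi>))"
  proof (rule alg_endo_cong)
    show "alg_endo (\<lambda>x. lft \<phi> (lft \<psi> x))"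
      using \<phi> \<psi> by (auto simp: AutV_iff alg_endo_def)
    show "lft \<phi> (lft \<psi> x) = lft (compose C \<phi> \<psi>) x" if "x \<in> B" for x
      using that \<psi> by (simp add: lft_def compose_def \<theta>_C \<theta>_\<eta> AutV_C)
  qed
  then have "compose C \<phi> \<psi> \<in> carrier G" using \<phi> \<psi> by (simp add: AutV_iff compose_Bij)
  then show "\<phi> \<otimes>\<^bsub>BijGroup C\<^esub> \<psi> \<in> carrier G" using \<phi> \<psi> by (simp add: AutV_iff BijGroup_def)
next
  fix \<phi> assume \<phi>: "\<phi> \<in> carrier G"
  then have \<phi>B: "\<phi> \<in> Bij C" and endo: "alg_endo (lft \<phi>)" by (simp_all add: AutV_iff)
  note E = alg_endoD[OF endo]
  let ?\<psi> = "\<lambda>a\<in>C. inv_into C \<phi> a"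
  have \<psi>: "?\<psi> \<in> Bij C" by (rule restrict_inv_into_Bij[OF \<phi>B])
  have inv1: "\<phi> (?\<psi> a) = a" if "a \<in> C" for a
    using that \<phi>B bij_betw_inv_into_right[of \<phi> C C a] by (simp add: Bij_def)
  have inv2: "?\<psi> (\<phi> a) = a" if "a \<in> C" for a
    using that \<phi>B bij_betw_inv_into_left[of \<phi> C C a] AutV_C[OF \<phi> that] by (simp add: Bij_def)
  have \<psi>C: "?\<psi> a \<in> C" if "a \<in> C" for a using \<psi> that by (blast dest: Bij_imp_funcset funcset_mem)
  have L1: "lft \<phi> (lft ?\<psi> x) = x" "lft ?\<psi> x \<in> B" if "x \<in> B" for x
    using that \<psi>C[OF \<theta>_C[OF that]] inv1[OF \<theta>_C[OF that]] by (simp_all only: lft_def \<theta>_\<eta> \<eta>_\<theta> \<eta>_B)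
  have L2: "lft ?\<psi> (lft \<phi> x) = x" if "x \<in> B" for x
    using inv2[OF \<theta>_C[OF that]] that by (simp only: lft_def \<theta>_\<eta> \<eta>_\<theta> AutV_C[OF \<phi>] \<theta>_C)
  have "alg_endo (lft ?\<psi>)"
    unfolding alg_endo_def
  proof (intro conjI ballI allI)
    fix x y assume xy: "x \<in> B" "y \<in> B"
    have "lft \<phi> (lft ?\<psi> x + lft ?\<psi> y) = x + y" "lft \<phi> (lft ?\<psi> x * lft ?\<psi> y) = x * y"
      using L1 xy by (simp_all only: E)
    moreover have "lft ?\<psi> x + lft ?\<psi> y \<in> B" "lft ?\<psi> x * lft ?\<psi> y \<in> B"
      using L1(2) xy by (simp_all only: B_add B_mult)
    ultimately show "lft ?\<psi> (x + y) = lft ?\<psi> x + lft ?\<psi> y" "lft ?\<psi> (x * y) = lft ?\<psi> x * lft ?\<psi> y"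
      using L2 by metis+
  next
    show "lft ?\<psi> x \<in> B" if "x \<in> B" for x by (rule L1(2)[OF that])
    show "lft ?\<psi> (kc c) = kc c" for c using L2[OF B_kc[of c]] by (simp only: E)
  qed
  with \<psi> have "?\<psi> \<in> carrier G" by (simp add: AutV_iff)
  moreover have "inv\<^bsub>BijGroup C\<^esub> \<phi> = ?\<psi>"
  proof (rule group.inv_equality[OF group_BijGroup])
    show "?\<psi> \<otimes>\<^bsub>BijGroup C\<^esub> \<phi> = \<one>\<^bsub>BijGroup C\<^esub>"
      using \<psi> \<phi>B Bij_compose_restrict_eq[OF \<phi>B] by (simp add: BijGroup_def)
  qed (use \<psi> \<phi>B in \<open>simp_all add: BijGroup_def\<close>)
  ultimately show "inv\<^bsub>BijGroup C\<^esub> \<phi> \<in> carrier G" by simp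
qed

lemma group_AutV: "group G"
proof -
  have "G = BijGroup C\<lparr>carrier := carrier G\<rparr>" by (simp add: AutV_def Let_def)
  then show ?thesis using subgroup.subgroup_is_group[OF subgroup_AutV group_BijGroup] by metis
qed

sublocale G: group G by (rule group_AutV)

lemma lft_mult: "\<phi> \<in> carrier G \<Longrightarrow> \<psi> \<in> carrier G \<Longrightarrow> x \<in> B \<Longrightarrow> lft (\<phi> \<otimes>\<^bsub>G\<^esub> \<psi>) x = lft \<phi> (lft \<psi> x)"
  by (simp add: G_mult) (simp add: lft_def compose_def \<theta>_C \<theta>_\<eta> AutV_C)

lemma lft_one: "x \<in> B \<Longrightarrow> lft \<one>\<^bsub>G\<^esub> x = x"
  by (simp add: G_one lft_def \<theta>_C \<eta>_\<theta>)

lemma lft_B: "\<phi> \<in> carrier G \<Longrightarrow> x \<in> B \<Longrightarrow> lft \<phi> x \<in> B"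
  by (simp add: lft_def AutV_C \<theta>_C \<eta>_B)

lemma lft_endo: "\<phi> \<in> carrier G \<Longrightarrow> alg_endo (lft \<phi>)"
  by (simp add: AutV_iff)

lemma lft_inv:
  assumes "\<phi> \<in> carrier G" "x \<in> B"
  shows "lft \<phi> (lft (inv\<^bsub>G\<^esub> \<phi>) x) = x" "lft (inv\<^bsub>G\<^esub> \<phi>) (lft \<phi> x) = x"
  using assms lft_mult[of \<phi> "inv\<^bsub>G\<^esub> \<phi>" x] lft_mult[of "inv\<^bsub>G\<^esub> \<phi>" \<phi> x] by (simp_all add: lft_one)

lemma lft_aut_pair: "\<phi> \<in> carrier G \<Longrightarrow> aut_pair (lft \<phi>) (lft (inv\<^bsub>G\<^esub> \<phi>))"
  by (simp add: aut_pair_def lft_endo lft_inv)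

lemma AutV_eqI:
  assumes "\<phi> \<in> carrier G" "\<psi> \<in> carrier G" "\<And>x. x \<in> B \<Longrightarrow> lft \<phi> x = lft \<psi> x"
  shows "\<phi> = \<psi>"
proof (rule extensionalityI)
  show "\<phi> \<in> extensional C" "\<psi> \<in> extensional C" using assms by (simp_all add: AutV_iff Bij_def)
  fix a assume a: "a \<in> C"
  then have "\<eta> (\<phi> a) = \<eta> (\<psi> a)" using assms(3) \<eta>_B by (simp add: \<eta>_lft[where \<phi>=\<phi>] \<eta>_lft[where \<phi>=\<psi>])
  then show "\<phi> a = \<psi> a" using a assms AutV_C by (simp add: \<eta>_eq_iff)
qed

text \<open>An automorphism does not kill Y, so \<open>alg_endo_eqI\<close> applies and y1 takes
  care of itself.\<close>

lemma AutV_eqI':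
  assumes "\<phi> \<in> carrier G" "\<psi> \<in> carrier G" "\<And>i. i \<in> {2..m} \<Longrightarrow> lft \<phi> (xv i) = lft \<psi> (xv i)"
    "lft \<phi> Z = lft \<psi> Z"
  shows "\<phi> = \<psi>"
proof (rule AutV_eqI[OF assms(1,2)])
  have "lft \<phi> (xv i) = lft \<psi> (xv i)" if "i \<in> {2..m+1}" for i
    using that assms(3)[of i] assms(4) xv_Z by (cases "i = m + 1") auto
  then show "lft \<phi> x = lft \<psi> x" if "x \<in> B" for x
    using aut_pair_nz[OF lft_aut_pair[OF assms(1)] Y_B Y_neq_0]
    by (intro alg_endo_eqI[OF lft_endo[OF assms(1)] lft_endo[OF assms(2)] _ _ that])
qed

lemma AutV_of_aut_pair:
  assumes "aut_pair \<Phi> \<Psi>"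
  shows "(\<lambda>a\<in>C. \<theta> (\<Phi> (\<eta> a))) \<in> carrier G" "x \<in> B \<Longrightarrow> lft (\<lambda>a\<in>C. \<theta> (\<Phi> (\<eta> a))) x = \<Phi> x"
proof -
  have E: "alg_endo \<Phi>" "alg_endo \<Psi>" "\<And>x. x \<in> B \<Longrightarrow> \<Phi> x \<in> B" "\<And>x. x \<in> B \<Longrightarrow> \<Psi> x \<in> B"
    "\<And>x. x \<in> B \<Longrightarrow> \<Psi> (\<Phi> x) = x" "\<And>x. x \<in> B \<Longrightarrow> \<Phi> (\<Psi> x) = x"
    using assms by (auto simp: aut_pair_def alg_endo_def)
  have l: "lft (\<lambda>a\<in>C. \<theta> (\<Phi> (\<eta> a))) x = \<Phi> x" if "x \<in> B" for x
    using that by (simp add: lft_def \<theta>_C \<eta>_\<theta> E)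
  then show "x \<in> B \<Longrightarrow> lft (\<lambda>a\<in>C. \<theta> (\<Phi> (\<eta> a))) x = \<Phi> x" .
  have "bij_betw (\<lambda>a\<in>C. \<theta> (\<Phi> (\<eta> a))) C C"
    by (rule bij_betw_byWitness[of _ "\<lambda>a. \<theta> (\<Psi> (\<eta> a))"])
      (auto simp: \<theta>_C \<eta>_\<theta> \<theta>_\<eta> \<eta>_B E)
  then show "(\<lambda>a\<in>C. \<theta> (\<Phi> (\<eta> a))) \<in> carrier G"
    unfolding AutV_iff using alg_endo_cong[OF E(1)] l by (auto simp: Bij_def)
qed

section \<open>The canonical derivation on residue classes\<close>

abbreviation DV where "DV \<equiv> canonical_lnd m k P"

text \<open>Resolves the definite description: the transported \<open>D\<close> has the prescribed
  values, and by \<open>B_induct\<close> a derivation is determined by its values on the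
  generators.\<close>

lemma canonical_lnd_eq: "DV = (\<lambda>a\<in>C. \<theta> (D (\<eta> a)))"
proof -
  let ?D = "\<lambda>a\<in>C. \<theta> (D (\<eta> a))"
  have z: "m + 1 \<in> vs" and o: "1 \<in> vs" by auto
  have PC: "cl (partial (m+1) P) \<in> C" "cl (dmonom m k) \<in> C"
    using partial_in[OF P_in'] dmonom_in' by auto
  have VC: "cl (Var i) \<in> C" if "i \<in> vs" for i using that by (intro cl_in polys_in_Var)
  have val: "\<eta> (cl (partial (m+1) P)) = D (xv 1)" "\<eta> (cl (dmonom m k)) = D (xv (m+1))"
    using \<eta>_cl[OF partial_in[OF P_in']] \<eta>_cl[OF dmonom_in'] by (simp_all only: D_x D_z ev_dmonom')
  define Q where "Q D' \<longleftrightarrow> derivation m k P D' \<and> D' (cl (Var 1)) = cl (partial (m+1) P) \<and>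
     D' (cl (Var (m+1))) = cl (dmonom m k) \<and> (\<forall>i\<in>{2..m}. D' (cl (Var i)) = \<zero>\<^bsub>A\<^esub>)" for D'
  have DC: "?D a \<in> C" "\<eta> (?D a) = D (\<eta> a)" if "a \<in> C" for a
    using that by (simp_all add: \<theta>_C D_B \<eta>_B \<eta>_\<theta>)
  have "derivation m k P ?D"
    unfolding derivation_def Let_def
  proof (intro conjI ballI allI)
    show "?D \<in> C \<rightarrow>\<^sub>E C" using DC by auto
    fix a b assume ab: "a \<in> C" "b \<in> C"
    note c = DC[OF ab(1)] DC[OF ab(2)] DC[OF A.a_closed[OF ab]] DC[OF A.m_closed[OF ab]]
    show "?D (a \<oplus>\<^bsub>A\<^esub> b) = ?D a \<oplus>\<^bsub>A\<^esub> ?D b"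
      by (rule \<eta>_eq_iff[THEN iffD1]) (use ab c in \<open>simp_all only: A.a_closed \<eta>_add D_add\<close>)
    show "?D (a \<otimes>\<^bsub>A\<^esub> b) = ?D a \<otimes>\<^bsub>A\<^esub> b \<oplus>\<^bsub>A\<^esub> a \<otimes>\<^bsub>A\<^esub> ?D b"
      by (rule \<eta>_eq_iff[THEN iffD1]) (use ab c in \<open>simp_all only: A.a_closed A.m_closed \<eta>_add \<eta>_mult D_mult\<close>)
  next
    fix a b assume ab: "b \<in> C"
    note c = DC[OF ab] DC[OF A.m_closed[OF Const_C[of a] ab]]
    show "?D (cl (Const a) \<otimes>\<^bsub>A\<^esub> b) = cl (Const a) \<otimes>\<^bsub>A\<^esub> ?D b"
      by (rule \<eta>_eq_iff[THEN iffD1]) (use ab c in \<open>simp_all only: A.m_closed \<eta>_mult D_mult D_kc \<eta>_Const Const_C mult_zero_left add_0_left\<close>)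
  qed
  moreover have "?D (cl (Var 1)) = cl (partial (m+1) P)" "?D (cl (Var (m+1))) = cl (dmonom m k)"
    using DC[OF VC[OF o]] DC[OF VC[OF z]] PC val z o by (simp_all only: \<eta>_eq_iff[symmetric] \<eta>_Var)
  moreover have "?D (cl (Var i)) = \<zero>\<^bsub>A\<^esub>" if i: "i \<in> {2..m}" for i
  proof -
    have iv: "i \<in> vs" using i by simp
    show ?thesis using DC[OF VC[OF iv]] iv D_y[OF i] by (simp only: \<eta>_eq_0_iff[symmetric] \<eta>_Var)
  qed
  ultimately have "Q ?D" by (simp only: Q_def) blast
  moreover have "D' = ?D" if "Q D'" for D'
  proof -
    have D': "derivation m k P D'" and v1: "D' (cl (Var 1)) = cl (partial (m+1) P)"
      and vz: "D' (cl (Var (m+1))) = cl (dmonom m k)" and vy: "\<And>i. i \<in> {2..m} \<Longrightarrow> D' (cl (Var i)) = \<zero>\<^bsub>A\<^esub>"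
      using that by (auto simp only: Q_def)
    have D'C: "D' a \<in> C" if "a \<in> C" for a using D' that by (auto simp: derivation_def Let_def)
    have add': "D' (a \<oplus>\<^bsub>A\<^esub> b) = D' a \<oplus>\<^bsub>A\<^esub> D' b"
      and mult: "D' (a \<otimes>\<^bsub>A\<^esub> b) = D' a \<otimes>\<^bsub>A\<^esub> b \<oplus>\<^bsub>A\<^esub> a \<otimes>\<^bsub>A\<^esub> D' b" if "a \<in> C" "b \<in> C" for a b
      using D' that by (auto simp: derivation_def Let_def)
    have scal: "D' (cl (Const c) \<otimes>\<^bsub>A\<^esub> a) = cl (Const c) \<otimes>\<^bsub>A\<^esub> D' a" if "a \<in> C" for c a
      using D' that by (auto simp: derivation_def Let_def)
    \<comment> \<open>The Leibniz rule for 1 * 1 shows that a derivation kills 1; by linearity it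
      kills all constants.\<close>
    have "\<eta> (D' \<one>\<^bsub>A\<^esub>) = \<eta> (D' \<one>\<^bsub>A\<^esub>) + \<eta> (D' \<one>\<^bsub>A\<^esub>)"
      using arg_cong[OF mult[of "\<one>\<^bsub>A\<^esub>" "\<one>\<^bsub>A\<^esub>"], of \<eta>] D'C[of "\<one>\<^bsub>A\<^esub>"] by (simp add: \<eta>_add)
    then have D1: "\<eta> (D' \<one>\<^bsub>A\<^esub>) = 0" by simp
    have const: "\<eta> (D' (cl (Const c))) = 0" for c
      using arg_cong[OF scal[of "\<one>\<^bsub>A\<^esub>" c], of \<eta>] D'C[of "\<one>\<^bsub>A\<^esub>"] D1 by (simp add: \<eta>_mult)
    have eq: "\<eta> (D' (\<theta> x)) = D x" if "x \<in> B" for x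
      using that
    proof (induction rule: B_induct)
      case (kc c)
      have "\<theta> (kc c) = cl (Const c)" using \<theta>_ev[of "Const c"] by simp
      then show ?case by (simp add: const D_kc)
    next
      case (add x y)
      have "\<theta> (x + y) = \<theta> x \<oplus>\<^bsub>A\<^esub> \<theta> y"
        using add.hyps by (auto simp: \<eta>_eq_iff[symmetric] \<eta>_add \<eta>_\<theta> B_closed \<theta>_C)
      then show ?case using add by (simp add: add' \<theta>_C \<eta>_add D'C D_add)
    next
      case (xv_mult i x)
      have xi: "xv i \<in> B" by (rule B_xv[OF xv_mult(1)])
      have "\<theta> (xv i * x) = \<theta> (xv i) \<otimes>\<^bsub>A\<^esub> \<theta> x"
        using xv_mult.hyps xi by (auto simp: \<eta>_eq_iff[symmetric] \<eta>_mult \<eta>_\<theta> B_closed \<theta>_C)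
      moreover have "\<theta> (xv i) = cl (Var i)" using \<theta>_ev[OF polys_in_Var[OF xv_mult(1)]] by simp
      moreover have "\<eta> (D' (cl (Var i))) = D (xv i)"
      proof -
        consider "i = 1" | "i \<in> {2..m}" | "i = m + 1" using xv_mult(1) by force
        then show ?thesis by cases (simp_all only: v1 vz vy val D_y \<eta>_0)
      qed
      ultimately show ?case
        using xv_mult VC[OF xv_mult(1)] \<eta>_Var[OF xv_mult(1)]
        by (simp add: mult \<theta>_C \<eta>_add \<eta>_mult D'C D_mult \<eta>_\<theta>)
    qed
    show "D' = ?D"
    proof (rule extensionalityI[of _ C])
      show "D' \<in> extensional C" using D' by (auto simp: derivation_def Let_def PiE_def)
      fix a assume a: "a \<in> C"
      have "\<eta> (D' a) = \<eta> (?D a)" using eq[OF \<eta>_B[OF a]] DC(2)[OF a] by (simp only: \<theta>_\<eta>[OF a])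
      then show "D' a = ?D a" by (rule iffD1[OF \<eta>_eq_iff[OF D'C[OF a] DC(1)[OF a]]])
    qed simp
  qed
  ultimately have "(THE D'. Q D') = ?D" by (rule the_equality)
  then show ?thesis unfolding canonical_lnd_def Q_def .
qed

end

section \<open>The big unipotent group and the canonical group\<close>

interpretation Const: coeff_hom Const
  by standard (simp_all add: Const_add Const_mult)

interpretation fract: coeff_hom "\<lambda>c. Fract (Const c) 1"
  by standard (simp_all add: Const_add Const_mult Zero_fract_def One_fract_def)

lemma Fract_eqI: "x \<noteq> 0 \<Longrightarrow> Fract x 1 * y = Fract z 1 \<Longrightarrow> y = Fract z (x :: 'a::idom)"
  by (cases y) (simp add: eq_fract mult.commute mult.left_commute)

context danielewski
begin

section \<open>Exponentials of multiples of the canonical derivation\<close>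

lemma DV_C: "a \<in> C \<Longrightarrow> DV a \<in> C" and \<eta>_DV: "a \<in> C \<Longrightarrow> \<eta> (DV a) = D (\<eta> a)"
  by (simp_all add: canonical_lnd_eq \<theta>_C D_B \<eta>_B \<eta>_\<theta>)

lemma DV_eq_0_iff: "a \<in> C \<Longrightarrow> DV a = \<zero>\<^bsub>A\<^esub> \<longleftrightarrow> \<eta> a \<in> R"
  using \<eta>_eq_0_iff[OF DV_C] D_eq_0_iff[OF \<eta>_B] by (simp add: \<eta>_DV)

lemma scale_C: "f \<in> C \<Longrightarrow> a \<in> C \<Longrightarrow> scale m k P f DV a \<in> C"
  and \<eta>_scale: "f \<in> C \<Longrightarrow> a \<in> C \<Longrightarrow> \<eta> (scale m k P f DV a) = \<eta> f * D (\<eta> a)"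
  by (simp_all add: scale_def DV_C \<eta>_mult \<eta>_DV)

lemma pcompose_kc [simp]: "pcompose (kc c) q = kc c"
  by (simp add: kc_def)

text \<open>The multiplier w is constant in z and so commutes with d/dz.\<close>

lemma \<eta>_scale_funpow:
  assumes "f \<in> C" "\<eta> f * Y = [:w:]" "a \<in> C"
  shows "(scale m k P f DV ^^ i) a \<in> C \<and> \<eta> ((scale m k P f DV ^^ i) a) = smult (w ^ i) ((pderiv ^^ i) (\<eta> a))"
proof (induction i)
  case (Suc i)
  let ?b = "(scale m k P f DV ^^ i) a"
  have "\<eta> f * D x = smult w (pderiv x)" for x
    using assms(2) by (simp add: D_def mult.assoc[symmetric])
  then have "\<eta> (scale m k P f DV ?b) = smult w (pderiv (\<eta> ?b))"
    using Suc assms(1) by (simp add: \<eta>_scale)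
  then show ?case using Suc scale_C[OF assms(1), of ?b] by (simp add: pderiv_smult)
qed (use assms in simp)

text \<open>Taylor's formula turns the exponential into the substitution of z + w for z. The sum in
  \<open>Exp\<close> runs over the nonzero terms only; extending it up to the degree adds
  zeros.\<close>

lemma Exp_scale:
  assumes "f \<in> C" "\<eta> f * Y = [:w:]" "a \<in> C"
  shows "Exp m k P (scale m k P f DV) a \<in> C"
    and "\<eta> (Exp m k P (scale m k P f DV) a) = pcompose (\<eta> a) [:w, 1:]"
proof -
  let ?\<delta> = "scale m k P f DV"
  let ?K = "{i. (?\<delta> ^^ i) a \<noteq> \<zero>\<^bsub>A\<^esub>}"
  let ?f = "\<lambda>i. cl (Const (1 / fact i)) \<otimes>\<^bsub>A\<^esub> (?\<delta> ^^ i) a"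
  note F = \<eta>_scale_funpow[OF assms]
  have fC: "?f i \<in> C" for i using F[of i] by simp
  have K: "?K \<subseteq> {..degree (\<eta> a)}"
  proof
    fix i assume "i \<in> ?K"
    then have "\<eta> ((?\<delta> ^^ i) a) \<noteq> 0" using F[of i] \<eta>_eq_0_iff by blast
    then have "(pderiv ^^ i) (\<eta> a) \<noteq> 0" using F[of i] by auto
    then show "i \<in> {..degree (\<eta> a)}" using pderiv_funpow_zero[of "\<eta> a" i] by force
  qed
  then have fin: "finite ?K" by (rule finite_subset) simp
  have E: "Exp m k P ?\<delta> a = (\<Oplus>\<^bsub>A\<^esub>i\<in>?K. ?f i)" using assms(3) by (simp add: Exp_def Let_def)
  show "Exp m k P ?\<delta> a \<in> C" unfolding E using fC by (intro A.finsum_closed) auto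
  let ?c = "\<lambda>i. single 0 (1 / fact i) :: 'k laurent"
  have \<eta>f: "\<eta> (?f i) = smult (?c i * w ^ i) ((pderiv ^^ i) (\<eta> a))" for i
    using F[of i] by (simp add: \<eta>_mult kc_def mult.commute)
  have c: "of_nat (Suc i) * ?c (Suc i) = ?c i" for i
  proof -
    have "of_nat (Suc i) * ?c (Suc i) = single 0 (of_nat (Suc i) * (1 / fact (Suc i)))"
      by (simp only: single_of_nat[symmetric] mult_single add_0_left)
    also have "of_nat (Suc i) * (1 / fact (Suc i)) = (1 / fact i :: 'k)"
      by (simp del: of_nat_Suc)
    finally show ?thesis .
  qed
  have "\<eta> (Exp m k P ?\<delta> a) = (\<Sum>i\<in>?K. \<eta> (?f i))" unfolding E using fin fC by (intro \<eta>_finsum)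
  also have "\<dots> = (\<Sum>i\<le>degree (\<eta> a). \<eta> (?f i))"
    using K F by (intro sum.mono_neutral_left) (auto simp: \<eta>_mult)
  also have "\<dots> = pcompose (\<eta> a) [:w, 1:]"
    unfolding \<eta>f by (rule pcompose_shift_eq_sum[OF _ c, symmetric]) (simp_all add: single_one)
  finally show "\<eta> (Exp m k P ?\<delta> a) = pcompose (\<eta> a) [:w, 1:]" .
qed

lemma R_Y_const: "x \<in> R \<Longrightarrow> \<exists>w. x * Y = [:w:]"
  using R_const[OF R_mult[OF _ Y_R]] by blast

text \<open>The substitution of z + w for z preserves \<open>B\<close> because it is an exponential.
  Its inverse is the substitution for -w, which is the exponential belonging to -f.\<close>

lemma Exp_in_G:
  assumes "f \<in> C" "\<eta> f \<in> R" "\<eta> f * Y = [:w:]"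
  shows "Exp m k P (scale m k P f DV) \<in> carrier G"
    and "x \<in> B \<Longrightarrow> lft (Exp m k P (scale m k P f DV)) x = pcompose x [:w, 1:]"
proof -
  have shift_B: "pcompose x [:w, 1:] \<in> B" if "f \<in> C" "\<eta> f * Y = [:w:]" "x \<in> B" for f w x
    using Exp_scale[OF that(1,2) \<theta>_C[OF that(3)]] \<eta>_\<theta>[OF that(3)] \<eta>_B by metis
  have endo: "alg_endo (\<lambda>x. pcompose x [:w, 1:])" if "f \<in> C" "\<eta> f * Y = [:w:]" for f w
    using shift_B[OF that] by (simp add: alg_endo_def pcompose_add pcompose_mult)
  define f' where "f' = \<theta> (- \<eta> f)"
  have "- \<eta> f \<in> B" using assms \<eta>_B B_uminus by blast
  then have f': "f' \<in> C" "\<eta> f' * Y = [:- w:]" using assms(3) by (simp_all add: f'_def \<theta>_C \<eta>_\<theta>)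
  have "aut_pair (\<lambda>x. pcompose x [:w, 1:]) (\<lambda>x. pcompose x [:- w, 1:])"
    using endo[OF assms(1,3)] endo[OF f'] by (simp add: aut_pair_def pcompose_assoc[symmetric] pcompose_pCons)
  note mk = AutV_of_aut_pair[OF this]
  have eq: "Exp m k P (scale m k P f DV) = (\<lambda>a\<in>C. \<theta> (pcompose (\<eta> a) [:w, 1:]))"
  proof (rule extensionalityI[of _ C])
    show "Exp m k P (scale m k P f DV) \<in> extensional C" by (simp add: Exp_def Let_def)
    fix a assume a: "a \<in> C"
    show "Exp m k P (scale m k P f DV) a = (\<lambda>a\<in>C. \<theta> (pcompose (\<eta> a) [:w, 1:])) a"
      using \<theta>_\<eta>[OF Exp_scale(1)[OF assms(1,3) a]] Exp_scale(2)[OF assms(1,3) a] a by simp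
  qed simp
  show "Exp m k P (scale m k P f DV) \<in> carrier G" unfolding eq by (rule mk)
  show "x \<in> B \<Longrightarrow> lft (Exp m k P (scale m k P f DV)) x = pcompose x [:w, 1:]" unfolding eq by (rule mk)
qed

section \<open>The big unipotent group as a normal subgroup\<close>

abbreviation U where "U \<equiv> big_unipotent m k P"

text \<open>Trades exponentials for values on generators. Conversely, f can be read off from the
  image of z, and its exponential has the same values, hence is the same automorphism by
  \<open>AutV_eqI'\<close>.\<close>

lemma U_iff:
  "\<phi> \<in> U \<longleftrightarrow> \<phi> \<in> carrier G \<and> (\<forall>i\<in>{2..m}. lft \<phi> (xv i) = xv i) \<and> (\<exists>f\<in>R. lft \<phi> Z = Z + Y * f)"
proof
  assume "\<phi> \<in> U"
  then obtain f where f: "f \<in> C" "DV f = \<zero>\<^bsub>A\<^esub>" "\<phi> = Exp m k P (scale m k P f DV)"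
    by (auto simp: big_unipotent_def Let_def)
  then have fR: "\<eta> f \<in> R" using DV_eq_0_iff by blast
  then obtain w where w: "\<eta> f * Y = [:w:]" using R_Y_const by blast
  note E = Exp_in_G[OF f(1) fR w]
  have "lft \<phi> (xv i) = xv i" if "i \<in> {2..m}" for i
    using E(2)[OF xv_y_B[OF that]] xv_y[OF that] by (simp add: f(3))
  moreover have "lft \<phi> Z = Z + Y * \<eta> f"
    using E(2)[OF Z_B] w by (simp add: f(3) mult.commute) (simp add: Z_eq pcompose_pCons)
  ultimately show "\<phi> \<in> carrier G \<and> (\<forall>i\<in>{2..m}. lft \<phi> (xv i) = xv i) \<and> (\<exists>f\<in>R. lft \<phi> Z = Z + Y * f)"
    using E(1) fR f(3) by blast
next
  assume *: "\<phi> \<in> carrier G \<and> (\<forall>i\<in>{2..m}. lft \<phi> (xv i) = xv i) \<and> (\<exists>f\<in>R. lft \<phi> Z = Z + Y * f)"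
  then obtain f where f: "f \<in> R" "lft \<phi> Z = Z + Y * f" by blast
  have fC: "\<theta> f \<in> C" and \<eta>f: "\<eta> (\<theta> f) = f" using f(1) R_subset_B by (simp_all add: \<theta>_C \<eta>_\<theta>)
  have fR: "\<eta> (\<theta> f) \<in> R" using f \<eta>f by simp
  then obtain w where w: "\<eta> (\<theta> f) * Y = [:w:]" using R_Y_const by blast
  note E = Exp_in_G[OF fC fR w]
  have "\<phi> = Exp m k P (scale m k P (\<theta> f) DV)"
  proof (rule AutV_eqI'[OF _ E(1)])
    fix i assume i: "i \<in> {2..m}"
    show "lft \<phi> (xv i) = lft (Exp m k P (scale m k P (\<theta> f) DV)) (xv i)"
    proof -
      have "lft (Exp m k P (scale m k P (\<theta> f) DV)) (xv i) = pcompose (xv i) [:w, 1:]"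
        by (rule E(2)[OF xv_y_B[OF i]])
      also have "\<dots> = xv i" by (simp add: xv_y[OF i])
      finally show ?thesis using * i by metis
    qed
  next
    have "Y * f = [:w:]" using w \<eta>f by (simp add: mult.commute)
    then have "lft \<phi> Z = pcompose Z [:w, 1:]" unfolding f(2) by (simp add: Z_eq pcompose_pCons)
    then show "lft \<phi> Z = lft (Exp m k P (scale m k P (\<theta> f) DV)) Z" using E(2)[OF Z_B] by simp
  qed (use * in blast)
  moreover have "DV (\<theta> f) = \<zero>\<^bsub>A\<^esub>" using DV_eq_0_iff[OF fC] fR by blast
  ultimately show "\<phi> \<in> U" using fC by (auto simp: big_unipotent_def Let_def)
qed

lemma U_fixes_R:
  assumes "\<phi> \<in> U" "x \<in> R"
  shows "lft \<phi> x = x"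
proof -
  have \<phi>: "\<phi> \<in> carrier G" "\<And>i. i \<in> {2..m} \<Longrightarrow> lft \<phi> (xv i) = xv i" using assms(1) by (auto simp: U_iff)
  note E = alg_endoD[OF lft_endo[OF \<phi>(1)]]
  show ?thesis using assms(2)
    by (induction rule: R_induct) (simp_all add: E R_subset_B xv_y_B \<phi>(2))
qed

text \<open>\<open>\<Phi> Y\<close> is a constant multiple of Y because \<sigma> stabilizes the
  monomial, and \<Phi> preserves \<open>R\<close>. This is what keeps translations by multiples of Y
  stable under conjugation.\<close>

lemma aut_pair_Y_multiple:
  assumes "aut_pair \<Phi> \<Psi>" "f \<in> R"
  shows "\<exists>f'\<in>R. \<Phi> (Y * f) = Y * f'"
proof -
  have endo: "alg_endo \<Phi>" using assms by (simp add: aut_pair_def)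
  note E = alg_endoD[OF endo]
  obtain \<sigma> t g where s: "\<sigma> \<in> S_V m k TYPE('k)" "\<And>i. i \<in> {2..m} \<Longrightarrow> \<Phi> (xv i) = kc (t i) * xv (\<sigma> i)"
    using aut_pair_structure[OF assms(1)] by metis
  have "\<Phi> Y = (\<Prod>i\<in>{2..m}. (kc (t i) * xv (\<sigma> i)) ^ k i)"
    unfolding alg_endo_Y[OF endo] by (intro prod.cong) (simp_all add: s)
  also have "\<dots> = (\<Prod>i\<in>{2..m}. kc (t i) ^ k i) * ev (\<Prod>i\<in>{2..m}. Var (\<sigma> i) ^ k i)"
    by (simp add: power_mult_distrib prod.distrib)
  also have "(\<Prod>i\<in>{2..m}. Var (\<sigma> i) ^ k i) = (dmonom m k :: 'k mpoly)" using s(1) by (simp add: S_V_def)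
  finally have Y: "\<Phi> Y = (\<Prod>i\<in>{2..m}. kc (t i) ^ k i) * Y" by (simp add: ev_dmonom')
  have "\<Phi> (Y * f) = \<Phi> Y * \<Phi> f" using assms(2) R_subset_B by (simp add: E)
  also have "\<dots> = Y * ((\<Prod>i\<in>{2..m}. kc (t i) ^ k i) * \<Phi> f)" by (simp add: Y ac_simps)
  finally show ?thesis
    by (intro bexI[of _ "(\<Prod>i\<in>{2..m}. kc (t i) ^ k i) * \<Phi> f"] R_mult R_prod R_power R_kc
        aut_pair_R[OF assms(1)] assms(2)) auto
qed

lemma subgroup_U: "subgroup U G"
proof (rule G.subgroupI)
  show "U \<subseteq> carrier G" by (auto simp: U_iff)
  have "\<one>\<^bsub>G\<^esub> \<in> U" by (auto simp: U_iff lft_one xv_y_B intro!: bexI[of _ 0])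
  then show "U \<noteq> {}" by blast
next
  fix \<phi> assume \<phi>: "\<phi> \<in> U"
  then obtain f where f: "\<phi> \<in> carrier G" "f \<in> R" "lft \<phi> Z = Z + Y * f" by (auto simp: U_iff)
  note E = alg_endoD[OF lft_endo[OF G.inv_closed[OF f(1)]]]
  have R: "lft (inv\<^bsub>G\<^esub> \<phi>) x = x" if "x \<in> R" for x
    using lft_inv(2)[OF f(1), of x] U_fixes_R[OF \<phi> that] that R_subset_B by simp
  have YB: "Y * f \<in> R" using f(2) by (intro R_mult Y_R)
  have "Z = lft (inv\<^bsub>G\<^esub> \<phi>) (lft \<phi> Z)" using lft_inv(2)[OF f(1) Z_B] by simp
  also have "\<dots> = lft (inv\<^bsub>G\<^esub> \<phi>) Z + Y * f" unfolding f(3) using YB R_subset_B by (simp add: E R)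
  finally have "lft (inv\<^bsub>G\<^esub> \<phi>) Z = Z + Y * (kc (- 1) * f)" by (simp add: kc_m1 algebra_simps)
  then show "inv\<^bsub>G\<^esub> \<phi> \<in> U" using f R R_xv R_mult[OF R_kc] by (auto simp: U_iff)
next
  fix \<phi> \<psi> assume \<phi>: "\<phi> \<in> U" and \<psi>: "\<psi> \<in> U"
  then obtain f g where f: "\<phi> \<in> carrier G" "f \<in> R" "lft \<phi> Z = Z + Y * f"
    and g: "\<psi> \<in> carrier G" "g \<in> R" "lft \<psi> Z = Z + Y * g" by (auto simp: U_iff)
  note E = alg_endoD[OF lft_endo[OF f(1)]]
  have "Y * g \<in> R" using g(2) by (intro R_mult Y_R)
  then have "lft (\<phi> \<otimes>\<^bsub>G\<^esub> \<psi>) Z = Z + Y * (f + g)"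
    using f g R_subset_B by (simp add: lft_mult E U_fixes_R[OF \<phi>] algebra_simps)
  then show "\<phi> \<otimes>\<^bsub>G\<^esub> \<psi> \<in> U"
    using f g R_xv U_fixes_R[OF \<phi>] U_fixes_R[OF \<psi>] R_add by (auto simp: U_iff lft_mult xv_y_B)
qed

text \<open>The conjugate fixes \<open>R\<close>, because automorphisms preserve \<open>R\<close>
  and u fixes it. At z, the inverse of \<phi> gives t z + b, u adds Y t f, and \<phi> maps this term
  to a multiple of Y.\<close>

lemma normal_U: "U \<lhd> G"
proof (rule G.normal_invI[OF subgroup_U])
  fix \<phi> u assume \<phi>: "\<phi> \<in> carrier G" and u: "u \<in> U"
  then obtain f where f: "u \<in> carrier G" "f \<in> R" "lft u Z = Z + Y * f" by (auto simp: U_iff)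
  note E = alg_endoD[OF lft_endo[OF \<phi>]] and Eu = alg_endoD[OF lft_endo[OF f(1)]]
  note ap = lft_aut_pair[OF \<phi>]
  have l: "lft (\<phi> \<otimes>\<^bsub>G\<^esub> u \<otimes>\<^bsub>G\<^esub> inv\<^bsub>G\<^esub> \<phi>) x = lft \<phi> (lft u (lft (inv\<^bsub>G\<^esub> \<phi>) x))" if "x \<in> B" for x
    using that \<phi> f(1) by (simp add: lft_mult lft_B)
  have y: "lft (\<phi> \<otimes>\<^bsub>G\<^esub> u \<otimes>\<^bsub>G\<^esub> inv\<^bsub>G\<^esub> \<phi>) (xv i) = xv i" if i: "i \<in> {2..m}" for i
    using aut_pair_R[OF aut_pair_sym[OF ap] R_xv[OF i]] xv_y_B[OF i]
    by (simp add: l U_fixes_R[OF u] lft_inv[OF \<phi>])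
  obtain t b where tb: "b \<in> R" "lft (inv\<^bsub>G\<^esub> \<phi>) Z = kc t * Z + b" using aut_pair_Z[OF aut_pair_sym[OF ap]] by blast
  have ktf: "kc t * f \<in> R" using f(2) by (intro R_mult R_kc)
  obtain f' where f': "f' \<in> R" "lft \<phi> (Y * (kc t * f)) = Y * f'"
    using aut_pair_Y_multiple[OF ap ktf] by blast
  have bB: "b \<in> B" "f \<in> B" "Y * f \<in> B" using tb f R_subset_B R_mult[OF Y_R] by auto
  have "lft u (kc t * Z + b) = kc t * (Z + Y * f) + b"
    using bB by (simp add: Eu B_mult f(3) U_fixes_R[OF u tb(1)])
  also have "\<dots> = (kc t * Z + b) + Y * (kc t * f)" by (simp add: algebra_simps)
  finally have "lft (\<phi> \<otimes>\<^bsub>G\<^esub> u \<otimes>\<^bsub>G\<^esub> inv\<^bsub>G\<^esub> \<phi>) Z = lft \<phi> (lft (inv\<^bsub>G\<^esub> \<phi>) Z + Y * (kc t * f))"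
    by (simp add: l tb(2))
  also have "\<dots> = Z + Y * f'"
    using \<phi> ktf R_subset_B R_mult[OF Y_R ktf] by (simp add: E lft_B lft_inv f'(2))
  finally show "\<phi> \<otimes>\<^bsub>G\<^esub> u \<otimes>\<^bsub>G\<^esub> inv\<^bsub>G\<^esub> \<phi> \<in> U" using y f'(1) \<phi> f(1) by (auto simp: U_iff)
qed

section \<open>The embedding into the fraction field\<close>

definition fv :: "nat \<Rightarrow> 'k mpoly fract" where
  "fv i = (if i = 1 then Fract P (dmonom m k) else Fract (Var i) 1)"

definition evF :: "'k mpoly \<Rightarrow> 'k mpoly fract" where
  "evF = peval (\<lambda>c. Fract (Const c) 1) fv"

lemma evF_hom [simp]:
  "evF (Const c) = Fract (Const c) 1" "evF 0 = 0" "evF 1 = 1" "evF (Var i) = fv i"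
  "evF (p + q) = evF p + evF q" "evF (p - q) = evF p - evF q"
  "evF (p * q) = evF p * evF q" "evF (p ^ n) = evF p ^ n"
  by (simp_all add: evF_def fract.peval_hom)

lemma dmonom_neq_0 [simp]: "dmonom m k \<noteq> (0 :: 'k mpoly)"
  by (simp add: dmonom_def)

lemma evF_Fract: "p \<in> polys_in {2..m+1} \<Longrightarrow> evF p = Fract p 1"
  by (rule hom_eqI) (auto simp: fv_def)

lemma dmonom_in'': "dmonom m k \<in> polys_in {2..m+1}"
  by (rule polys_in_mono[OF dmonom_in]) auto

lemma evF_F: "evF F = 0"
proof -
  have "fv 1 * Fract (dmonom m k) 1 = Fract P 1"
    by (simp add: fv_def eq_fract)
  then show ?thesis
    using evF_Fract[OF dmonom_in''] evF_Fract[OF P_in] by (simp only: evF_hom) simp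
qed

text \<open>F evaluates to 0, so the values on a class form a singleton and \<open>the_elem\<close>
  is meaningful.\<close>

lemma embed_cl:
  assumes "p \<in> polys_in vs"
  shows "embed m k P (cl p) = evF p"
proof -
  have evF': "peval (\<lambda>c. Fract (Const c) 1) (\<lambda>i. if i = 1 then Fract P (dmonom m k) else Fract (Var i) 1) = evF"
    by (simp only: evF_def fv_def[abs_def])
  have all: "evF q = evF p" if q: "q \<in> cl p" for q
  proof -
    obtain r where "q = r * F + p" using q by (auto simp: cl_eq dideal_eq)
    then have "evF q = evF r * evF F + evF p" by (simp only: evF_hom)
    then show ?thesis by (simp only: evF_F) simp
  qed
  have self: "p \<in> cl p"
  proof -
    have "0 \<in> dideal m k P" by (auto simp: dideal_eq intro: exI[of _ 0])
    then show ?thesis by (force simp: cl_eq)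
  qed
  have "evF ` cl p = {evF p}"
  proof (rule equalityI)
    show "evF ` cl p \<subseteq> {evF p}" by (rule image_subsetI) (simp only: all singleton_iff)
    show "{evF p} \<subseteq> evF ` cl p" using imageI[OF self] by (simp only: insert_subset empty_subsetI simp_thms)
  qed
  then show ?thesis unfolding embed_def evF' by simp
qed

text \<open>Multiplied by a power of Y, the element becomes a polynomial without y1, whose value
  under \<open>evF\<close> is a fraction with denominator 1. If this is 0, so is the polynomial, and
  Y is not a zero divisor.\<close>

lemma evF_eq_0D:
  assumes "p \<in> polys_in vs" "evF p = 0"
  shows "ev p = 0"
proof -
  obtain N q where q: "q \<in> polys_in {2..m+1}" "ev (dmonom m k ^ N * p) = ev q"
    using clear_denominators[OF assms(1)] by blast
  have in': "dmonom m k ^ N * p \<in> polys_in vs" "q \<in> polys_in vs"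
  proof -
    show "dmonom m k ^ N * p \<in> polys_in vs" by (intro polys_in_mult polys_in_power dmonom_in' assms(1))
    show "q \<in> polys_in vs" by (rule polys_in_mono[OF q(1)]) simp
  qed
  from cl_eq_ev[OF in'] q(2) have "cl (dmonom m k ^ N * p) = cl q" by (rule iffD2)
  then have "evF (dmonom m k ^ N * p) = evF q" by (simp only: embed_cl[OF in'(1), symmetric] embed_cl[OF in'(2), symmetric])
  then have "evF q = 0" using assms(2) by simp
  then have "q = 0" using evF_Fract[OF q(1)] by (simp add: Zero_fract_def eq_fract)
  then have "Y ^ N * ev p = 0" using q(2) by (simp add: ev_dmonom')
  then show ?thesis by simp
qed

lemma embed_inj:
  assumes "a \<in> C" "b \<in> C" "embed m k P a = embed m k P b"
  shows "a = b"
proof -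
  obtain p q where pq: "p \<in> polys_in vs" "q \<in> polys_in vs" "a = cl p" "b = cl q"
    using assms(1,2) by (metis C_cases)
  then have "evF (p - q) = 0" using assms(3) by (simp add: embed_cl[simplified])
  then have "ev (p - q) = 0" using pq by (intro evF_eq_0D polys_in_diff)
  then show ?thesis using pq cl_eq_ev[OF pq(1,2)] by simp
qed

lemma poly_act_hom [simp]:
  "poly_act \<sigma> t (Const c) = Const c" "poly_act \<sigma> t 0 = 0" "poly_act \<sigma> t 1 = 1"
  "poly_act \<sigma> t (Var i) = Const (t i) * Var (\<sigma> i)"
  "poly_act \<sigma> t (p + q) = poly_act \<sigma> t p + poly_act \<sigma> t q"
  "poly_act \<sigma> t (p * q) = poly_act \<sigma> t p * poly_act \<sigma> t q"
  "poly_act \<sigma> t (p ^ n) = poly_act \<sigma> t p ^ n"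
  by (simp_all add: poly_act_def Const.peval_hom)

lemma permutes_y: "\<sigma> permutes {2..m} \<Longrightarrow> i \<in> {2..m+1} \<Longrightarrow> \<sigma> i \<in> {2..m+1}"
  using permutes_in_image[of \<sigma> "{2..m}" i] permutes_not_in[of \<sigma> "{2..m}" i]
  by (cases "i \<in> {2..m}") auto

lemma poly_act_in:
  assumes "\<sigma> permutes {2..m}" "p \<in> polys_in {2..m+1}"
  shows "poly_act \<sigma> t p \<in> polys_in {2..m+1}"
  using assms(2)
proof (induction rule: polys_in_induct)
  case (Var_mult i p)
  then show ?case
    unfolding poly_act_hom by (intro polys_in_mult polys_in_Const polys_in_Var permutes_y[OF assms(1)])
qed (simp_all add: polys_in_add)

text \<open>The substitution has a left inverse, built from the inverse permutation and the
  reciprocal scalars. This keeps denominators nonzero.\<close>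

lemma poly_act_eq_0D:
  assumes "\<sigma> permutes {2..m}" "\<forall>i\<in>{2..m+1}. t i \<noteq> 0"
    and "p \<in> polys_in {2..m+1}" "poly_act \<sigma> t p = (0 :: 'k mpoly)"
  shows "p = 0"
proof -
  let ?act = "poly_act (Hilbert_Choice.inv \<sigma>) (\<lambda>j. 1 / t (Hilbert_Choice.inv \<sigma> j))"
  have "?act (poly_act \<sigma> t p) = p"
  proof (rule hom_eqI[OF assms(3)])
    fix i assume i: "i \<in> {2..m+1}"
    show "?act (poly_act \<sigma> t (Var i)) = Var i"
      using bspec[OF assms(2) i] permutes_inverses(2)[OF assms(1)]
      by (simp add: mult.assoc[symmetric] Const_mult[symmetric])
  qed simp_all
  then show ?thesis by (simp add: assms(4))
qed

text \<open>Resolves the choice in \<open>field_act\<close>: the cross-multiplied equation between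
  two representations of a fraction is preserved by \<open>poly_act\<close>.\<close>

lemma field_act_Fract:
  assumes "\<sigma> permutes {2..m}" "\<forall>i\<in>{2..m+1}. t i \<noteq> 0"
    and "p \<in> polys_in {2..m+1}" "q \<in> polys_in {2..m+1}" "q \<noteq> (0 :: 'k mpoly)"
  shows "field_act m \<sigma> t (Fract p q) = Fract (poly_act \<sigma> t p) (poly_act \<sigma> t q)"
proof -
  let ?Q = "\<lambda>(p', q'). p' \<in> polys_in {2..m+1} \<and> q' \<in> polys_in {2..m+1} \<and> q' \<noteq> 0 \<and> Fract p q = Fract p' q'"
  obtain p' q' where eq: "(SOME x. ?Q x) = (p', q')" by (cases "SOME x. ?Q x")
  have "?Q (p', q')" by (subst eq[symmetric], rule someI[of ?Q "(p, q)"]) (use assms in simp)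
  then have *: "p' \<in> polys_in {2..m+1}" "q' \<in> polys_in {2..m+1}" "q' \<noteq> 0" "Fract p q = Fract p' q'"
    by simp_all
  then have "p * q' = p' * q" using assms(5) by (simp add: eq_fract)
  then have "poly_act \<sigma> t p * poly_act \<sigma> t q' = poly_act \<sigma> t p' * poly_act \<sigma> t q"
    by (metis poly_act_hom(6))
  moreover have "poly_act \<sigma> t q \<noteq> 0" "poly_act \<sigma> t q' \<noteq> 0"
    using poly_act_eq_0D[OF assms(1,2)] assms(4,5) * by blast+
  ultimately show ?thesis unfolding field_act_def eq by (simp add: eq_fract)
qed

text \<open>Forward, the action is read at z, whose index \<sigma> fixes. Backward,
  \<open>aut_pair_structure\<close> supplies the permutation and the scalars, clearing denominators
  extends the agreement from polynomials to the whole ring, and surjectivity of \<phi> shows that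
  the image of the ring is stabilized.\<close>

lemma canonical_group_iff:
  "\<phi> \<in> canonical_group m k P \<longleftrightarrow> \<phi> \<in> carrier G \<and> (\<exists>t. lft \<phi> Z = kc t * Z)"
proof
  assume "\<phi> \<in> canonical_group m k P"
  then obtain \<sigma> t where \<phi>: "\<phi> \<in> carrier G" and st: "(\<sigma>, t) \<in> canonical_stabilizer m k P"
    and act: "\<And>a. a \<in> C \<Longrightarrow> embed m k P (\<phi> a) = field_act m \<sigma> t (embed m k P a)"
    by (auto simp: canonical_group_def)
  have \<sigma>: "\<sigma> permutes {2..m}" and t: "\<forall>i\<in>{2..m+1}. t i \<noteq> 0"
    using st by (auto simp: canonical_stabilizer_def S_V_def PiE_def Pi_def)
  have \<sigma>z: "\<sigma> (m+1) = m+1" by (rule permutes_not_in[OF \<sigma>]) simp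
  have V: "Var (m+1) \<in> polys_in {2..m+1}" using m_ge by (intro polys_in_Var) simp
  have V': "Var (m+1) \<in> polys_in vs" "Const (t (m+1)) * Var (m+1) \<in> polys_in vs"
    by (auto intro!: polys_in_intros)
  have V'': "Const (t (m+1)) * Var (m+1) \<in> polys_in {2..m+1}" using V by (intro polys_in_mult) simp_all
  have "embed m k P (\<phi> (cl (Var (m+1)))) = field_act m \<sigma> t (Fract (Var (m+1)) 1)"
    using act[OF cl_in[OF V'(1)]] embed_cl[OF V'(1)] evF_Fract[OF V] by (simp only:)
  also have "\<dots> = Fract (Const (t (m+1)) * Var (m+1)) 1"
    using field_act_Fract[OF \<sigma> t V] by (simp only: poly_act_hom \<sigma>z) simp
  also have "\<dots> = embed m k P (cl (Const (t (m+1)) * Var (m+1)))"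
    using embed_cl[OF V'(2)] evF_Fract[OF V''] by (simp only:)
  finally have "\<phi> (cl (Var (m+1))) = cl (Const (t (m+1)) * Var (m+1))"
    using embed_inj AutV_C[OF \<phi>] V' cl_in by meson
  then have "lft \<phi> (\<eta> (cl (Var (m+1)))) = \<eta> (cl (Const (t (m+1)) * Var (m+1)))"
    using \<eta>_lft[OF cl_in[OF V'(1)], of \<phi>] by simp
  then have "lft \<phi> Z = kc (t (m+1)) * Z"
    by (simp only: \<eta>_cl[OF V'(1)] \<eta>_cl[OF V'(2)] ev_hom xv_Z)
  then show "\<phi> \<in> carrier G \<and> (\<exists>t. lft \<phi> Z = kc t * Z)" using \<phi> by blast
next
  assume "\<phi> \<in> carrier G \<and> (\<exists>t. lft \<phi> Z = kc t * Z)"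
  then obtain t' where \<phi>: "\<phi> \<in> carrier G" and t': "lft \<phi> Z = kc t' * Z" by blast
  note E = alg_endoD[OF lft_endo[OF \<phi>]]
  obtain \<sigma> t0 f where \<sigma>S: "\<sigma> \<in> S_V m k TYPE('k)" and t0: "\<And>i. i \<in> {2..m+1} \<Longrightarrow> t0 i \<noteq> 0"
    and y: "\<And>i. i \<in> {2..m} \<Longrightarrow> lft \<phi> (xv i) = kc (t0 i) * xv (\<sigma> i)"
    and f: "f \<in> R" "lft \<phi> Z = kc (t0 (m+1)) * Z + Y * f"
    using aut_pair_structure[OF lft_aut_pair[OF \<phi>]] by metis
  have "Y * f \<in> R" using f by (intro R_mult Y_R)
  then obtain c where c: "Y * f = [:c:]" using R_const by blast
  \<comment> \<open>The constant terms in z of the two formulas for \<open>lft \<phi> Z\<close> give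
    \<open>Y * f = 0\<close>.\<close>
  have "[:0, single 0 t':] = [:c, single 0 (t0 (m+1)):]"
    using t' f(2) by (simp add: c Z_eq kc_def)
  then have z: "lft \<phi> Z = kc (t0 (m+1)) * Z" using f(2) c by simp
  \<comment> \<open>The tuples in the stabilizer are extensional on \<open>{2..m+1}\<close>, hence
    the restriction.\<close>
  define t where "t = restrict t0 {2..m+1}"
  have \<sigma>: "\<sigma> permutes {2..m}" using \<sigma>S by (simp add: S_V_def)
  have \<sigma>z: "\<sigma> (m+1) = m+1" by (rule permutes_not_in[OF \<sigma>]) simp
  have t: "\<forall>i\<in>{2..m+1}. t i \<noteq> 0" using t0 by (simp add: t_def)
  have gen: "lft \<phi> (xv i) = kc (t i) * xv (\<sigma> i)" if "i \<in> {2..m+1}" for i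
  proof (cases "i = m + 1")
    case True
    show ?thesis unfolding True \<sigma>z xv_Z using z m_ge by (simp add: t_def)
  qed (use that y[of i] in \<open>auto simp: t_def\<close>)
  have sub: "p \<in> polys_in vs" if "p \<in> polys_in {2..m+1}" for p :: "'k mpoly"
    using that by (rule polys_in_mono) auto
  have act: "lft \<phi> (ev p) = ev (poly_act \<sigma> t p)" if "p \<in> polys_in {2..m+1}" for p
    by (rule hom_eqI[OF that]) (simp_all add: gen[simplified] E B_ev[OF sub, simplified])
  have main: "embed m k P (\<phi> a) = field_act m \<sigma> t (embed m k P a)" if a: "a \<in> C" for a
  proof -
    obtain p where p: "p \<in> polys_in vs" "a = cl p" using a by (rule C_cases)
    obtain p' where p': "p' \<in> polys_in vs" "\<phi> a = cl p'" using AutV_C[OF \<phi> a] by (rule C_cases)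
    obtain N q where q: "q \<in> polys_in {2..m+1}" "ev (dmonom m k ^ N * p) = ev q"
      using clear_denominators[OF p(1)] by blast
    let ?M = "dmonom m k ^ N :: 'k mpoly"
    have M: "?M \<in> polys_in {2..m+1}" by (intro polys_in_power dmonom_in'')
    have M0: "?M \<noteq> 0" by simp
    note aM = poly_act_in[OF \<sigma> M, of t] and aq = poly_act_in[OF \<sigma> q(1), of t]
    have aM0: "poly_act \<sigma> t ?M \<noteq> 0" using poly_act_eq_0D[OF \<sigma> t M] M0 by blast
    note Mp = polys_in_mult[OF sub[OF M] p(1)] and q' = sub[OF q(1)]
    from cl_eq_ev[OF Mp q'] q(2) have "cl (?M * p) = cl q" by (rule iffD2)
    then have "evF (?M * p) = evF q" by (simp only: embed_cl[OF Mp, symmetric] embed_cl[OF q', symmetric])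
    then have "Fract ?M 1 * evF p = Fract q 1" using evF_Fract[OF M] evF_Fract[OF q(1)] by (simp only: evF_hom(7))
    with M0 have 1: "evF p = Fract q ?M" by (rule Fract_eqI)
    have \<phi>p: "lft \<phi> (ev p) = ev p'"
      using \<eta>_lft[OF a, of \<phi>] by (simp only: p'(2) \<eta>_cl[OF p'(1)]) (simp only: p(2) \<eta>_cl[OF p(1)])
    have "lft \<phi> (ev (?M * p)) = lft \<phi> (ev ?M) * lft \<phi> (ev p)"
      using E(3)[OF B_ev[OF sub[OF M]] B_ev[OF p(1)]] by (simp only: ev_hom(8))
    then have "lft \<phi> (ev q) = ev (poly_act \<sigma> t ?M * p')"
      by (simp only: q(2)) (simp only: act[OF M] \<phi>p ev_hom(8))
    then have "ev (poly_act \<sigma> t q) = ev (poly_act \<sigma> t ?M * p')"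
      by (simp only: act[OF q(1)])
    note aq' = sub[OF aq] and aMp = polys_in_mult[OF sub[OF aM] p'(1)]
    from cl_eq_ev[OF aq' aMp] \<open>ev (poly_act \<sigma> t q) = _\<close>
    have "cl (poly_act \<sigma> t q) = cl (poly_act \<sigma> t ?M * p')" by (rule iffD2)
    then have "evF (poly_act \<sigma> t q) = evF (poly_act \<sigma> t ?M * p')"
      by (simp only: embed_cl[OF aq', symmetric] embed_cl[OF aMp, symmetric])
    then have "Fract (poly_act \<sigma> t ?M) 1 * evF p' = Fract (poly_act \<sigma> t q) 1"
      using evF_Fract[OF aq] evF_Fract[OF aM] by (simp only: evF_hom(7))
    with aM0 have "evF p' = Fract (poly_act \<sigma> t q) (poly_act \<sigma> t ?M)" by (rule Fract_eqI)
    then have "evF p' = field_act m \<sigma> t (evF p)" using field_act_Fract[OF \<sigma> t q(1) M M0] by (simp only: 1)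
    then have "embed m k P (cl p') = field_act m \<sigma> t (embed m k P (cl p))"
      by (simp only: embed_cl[OF p(1)] embed_cl[OF p'(1)])
    then show ?thesis by (simp only: p'(2) p(2)[symmetric])
  qed
  have "field_act m \<sigma> t ` (embed m k P ` C) = embed m k P ` (\<phi> ` C)"
    using main by (force simp: image_image)
  also have "\<phi> ` C = C" using \<phi> by (auto simp: AutV_iff Bij_def bij_betw_def)
  finally have stab: "field_act m \<sigma> t ` (embed m k P ` C) = embed m k P ` C" .
  have "t \<in> {2..m+1} \<rightarrow>\<^sub>E - {0}" using t by (auto simp: PiE_def t_def)
  with \<sigma>S stab have "(\<sigma>, t) \<in> canonical_stabilizer m k P"
    by (simp only: canonical_stabilizer_def mem_Collect_eq split mem_Sigma_iff simp_thms)
  then show "\<phi> \<in> canonical_group m k P" using \<phi> main by (auto simp: canonical_group_def)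
qed

section \<open>The canonical group as a complement\<close>

lemma subgroup_canonical_group: "subgroup (canonical_group m k P) G"
proof (rule G.subgroupI)
  show "canonical_group m k P \<subseteq> carrier G" by (auto simp: canonical_group_iff)
  have "\<one>\<^bsub>G\<^esub> \<in> canonical_group m k P" by (auto simp: canonical_group_iff lft_one intro!: exI[of _ 1])
  then show "canonical_group m k P \<noteq> {}" by blast
next
  fix \<phi> assume "\<phi> \<in> canonical_group m k P"
  then obtain t where \<phi>: "\<phi> \<in> carrier G" "lft \<phi> Z = kc t * Z" by (auto simp: canonical_group_iff)
  note E = alg_endoD[OF lft_endo[OF G.inv_closed[OF \<phi>(1)]]]
  have "lft \<phi> Z \<noteq> 0" by (rule aut_pair_nz[OF lft_aut_pair[OF \<phi>(1)] Z_B]) (simp add: Z_eq)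
  then have t: "t \<noteq> 0" using \<phi>(2) by auto
  have "Z = lft (inv\<^bsub>G\<^esub> \<phi>) (lft \<phi> Z)" using lft_inv(2)[OF \<phi>(1) Z_B] by simp
  also have "\<dots> = kc t * lft (inv\<^bsub>G\<^esub> \<phi>) Z" unfolding \<phi>(2) by (simp add: E)
  finally have "kc (inverse t) * Z = kc (inverse t * t) * lft (inv\<^bsub>G\<^esub> \<phi>) Z"
    by (simp only: kc.c_mult mult.assoc)
  then have "lft (inv\<^bsub>G\<^esub> \<phi>) Z = kc (inverse t) * Z" using t by simp
  then show "inv\<^bsub>G\<^esub> \<phi> \<in> canonical_group m k P" using \<phi>(1) by (auto simp: canonical_group_iff)
next
  fix \<phi> \<psi> assume "\<phi> \<in> canonical_group m k P" "\<psi> \<in> canonical_group m k P"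
  then obtain t u where \<phi>: "\<phi> \<in> carrier G" "lft \<phi> Z = kc t * Z" "\<psi> \<in> carrier G" "lft \<psi> Z = kc u * Z"
    by (auto simp: canonical_group_iff)
  note E = alg_endoD[OF lft_endo[OF \<phi>(1)]]
  have "lft (\<phi> \<otimes>\<^bsub>G\<^esub> \<psi>) Z = kc (u * t) * Z" using \<phi> by (simp add: lft_mult E kc.c_mult mult.assoc)
  then show "\<phi> \<otimes>\<^bsub>G\<^esub> \<psi> \<in> canonical_group m k P" using \<phi> by (auto simp: canonical_group_iff)
qed

text \<open>An element of both sends z to z + Y f and to a multiple of z, which forces Y f = 0; it
  then fixes y_2, ..., y_m and z.\<close>

lemma U_Int_canonical_group: "U \<inter> canonical_group m k P = {\<one>\<^bsub>G\<^esub>}"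
proof
  show "{\<one>\<^bsub>G\<^esub>} \<subseteq> U \<inter> canonical_group m k P"
    using subgroup.one_closed[OF subgroup_U] subgroup.one_closed[OF subgroup_canonical_group] by simp
  show "U \<inter> canonical_group m k P \<subseteq> {\<one>\<^bsub>G\<^esub>}"
  proof
    fix \<phi> assume "\<phi> \<in> U \<inter> canonical_group m k P"
    then obtain f t where \<phi>: "\<phi> \<in> carrier G" "\<And>i. i \<in> {2..m} \<Longrightarrow> lft \<phi> (xv i) = xv i"
      "f \<in> R" "lft \<phi> Z = Z + Y * f" "lft \<phi> Z = kc t * Z" by (auto simp: U_iff canonical_group_iff)
    obtain c where c: "Y * f = [:c:]" using R_const[OF R_mult[OF Y_R \<phi>(3)]] by blast
    have "[:c, 1:] = [:0, single 0 t:]" using \<phi>(4,5) by (simp add: c Z_eq kc_def)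
    then have "lft \<phi> Z = Z" using \<phi>(4) c by simp
    then have "\<phi> = \<one>\<^bsub>G\<^esub>" using \<phi> by (intro AutV_eqI') (simp_all add: lft_one xv_y_B)
    then show "\<phi> \<in> {\<one>\<^bsub>G\<^esub>}" by simp
  qed
qed

text \<open>If \<phi> sends z to t z + Y f, take u with z mapped to z + Y f / t. The inverse of u,
  applied to t z + Y f, fixes Y f and subtracts t times Y f / t.\<close>

lemma AutV_decomp:
  assumes \<phi>: "\<phi> \<in> carrier G"
  shows "\<exists>u\<in>U. \<exists>g\<in>canonical_group m k P. \<phi> = u \<otimes>\<^bsub>G\<^esub> g"
proof -
  obtain \<sigma> t0 f where nz: "\<And>i. i \<in> {2..m+1} \<Longrightarrow> t0 i \<noteq> 0"
    and "\<sigma> \<in> S_V m k TYPE('k)" "\<And>i. i \<in> {2..m} \<Longrightarrow> lft \<phi> (xv i) = kc (t0 i) * xv (\<sigma> i)"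
    and f: "f \<in> R" "lft \<phi> Z = kc (t0 (m+1)) * Z + Y * f"
    using aut_pair_structure[OF lft_aut_pair[OF \<phi>]] by metis
  have t: "t0 (m+1) \<noteq> 0" using m_ge by (intro nz) simp
  define t where "t = t0 (m+1)"
  note f = f[folded t_def] and t = t[folded t_def]
  let ?f = "kc (inverse t) * f"
  have fR: "?f \<in> R" using f by (intro R_mult R_kc)
  then have C: "\<theta> ?f \<in> C" and \<eta>f: "\<eta> (\<theta> ?f) = ?f" using R_subset_B by (simp_all add: \<theta>_C \<eta>_\<theta>)
  obtain w where w: "?f * Y = [:w:]" using R_Y_const[OF fR] by blast
  define u where "u = Exp m k P (scale m k P (\<theta> ?f) DV)"
  have uU: "u \<in> U" using C DV_eq_0_iff[OF C] fR \<eta>f by (auto simp: big_unipotent_def Let_def u_def)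
  then have uG: "u \<in> carrier G" by (simp add: U_iff)
  have "lft u Z = pcompose Z [:w, 1:]" unfolding u_def by (rule Exp_in_G(2)[OF C]) (use fR \<eta>f w in simp_all)
  also have "\<dots> = Z + ?f * Y" unfolding w by (simp add: Z_eq pcompose_pCons)
  finally have uZ: "lft u Z = Z + ?f * Y" .
  have fY: "?f * Y \<in> R" by (rule R_mult[OF fR Y_R])
  note E = alg_endoD[OF lft_endo[OF G.inv_closed[OF uG]]]
  have "inv\<^bsub>G\<^esub> u \<in> U" using subgroup.m_inv_closed[OF subgroup_U uU] .
  note fix_R = U_fixes_R[OF this]
  have "Z = lft (inv\<^bsub>G\<^esub> u) (lft u Z)" using lft_inv(2)[OF uG Z_B] by simp
  also have "\<dots> = lft (inv\<^bsub>G\<^esub> u) Z + ?f * Y" unfolding uZ using fY R_subset_B by (simp add: E fix_R)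
  finally have iZ: "lft (inv\<^bsub>G\<^esub> u) Z = Z - ?f * Y" by (simp add: algebra_simps)
  define g where "g = inv\<^bsub>G\<^esub> u \<otimes>\<^bsub>G\<^esub> \<phi>"
  have gG: "g \<in> carrier G" using uG \<phi> by (simp add: g_def)
  have Yf: "Y * f \<in> R" using f by (intro R_mult Y_R)
  have "lft g Z = lft (inv\<^bsub>G\<^esub> u) (kc t * Z + Y * f)" using uG \<phi> f by (simp add: g_def lft_mult)
  also have "\<dots> = kc t * (Z - ?f * Y) + Y * f"
    using Yf R_subset_B by (simp add: E B_mult fix_R iZ)
  also have "\<dots> = kc t * Z + (1 - kc (t * inverse t)) * (Y * f)" by (simp add: kc.c_mult algebra_simps)
  also have "\<dots> = kc t * Z" using t by simp
  finally have "g \<in> canonical_group m k P" using gG by (auto simp: canonical_group_iff)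
  moreover have "\<phi> = u \<otimes>\<^bsub>G\<^esub> g" using uG \<phi> by (simp add: g_def G.inv_solve_left' G.m_assoc[symmetric])
  ultimately show ?thesis using uU by blast
qed

section \<open>The centralizer of a multiple of the canonical derivation\<close>

context
  fixes h assumes h: "h \<in> C" "\<eta> h \<in> R"
begin

abbreviation Aut_h where "Aut_h \<equiv> carrier (Aut_der m k P (scale m k P h DV))"

lemma Aut_h_iff:
  "\<phi> \<in> Aut_h \<longleftrightarrow> \<phi> \<in> carrier G \<and> (\<forall>x\<in>B. lft \<phi> (\<eta> h * D x) = \<eta> h * D (lft \<phi> x))"
proof -
  have "(\<forall>a\<in>C. \<phi> (scale m k P h DV a) = scale m k P h DV (\<phi> a))
      \<longleftrightarrow> (\<forall>x\<in>B. lft \<phi> (\<eta> h * D x) = \<eta> h * D (lft \<phi> x))" if \<phi>: "\<phi> \<in> carrier G"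
  proof -
    have eq: "\<phi> (scale m k P h DV a) = scale m k P h DV (\<phi> a) \<longleftrightarrow>
        lft \<phi> (\<eta> h * D (\<eta> a)) = \<eta> h * D (lft \<phi> (\<eta> a))" if a: "a \<in> C" for a
      using \<eta>_eq_iff[OF AutV_C[OF \<phi> scale_C[OF h(1) a]] scale_C[OF h(1) AutV_C[OF \<phi> a]]]
        \<eta>_lft[OF scale_C[OF h(1) a], of \<phi>] \<eta>_lft[OF a, of \<phi>] \<eta>_scale[OF h(1) a] \<eta>_scale[OF h(1) AutV_C[OF \<phi> a]]
      by simp
    show ?thesis
    proof
      assume l: "\<forall>a\<in>C. \<phi> (scale m k P h DV a) = scale m k P h DV (\<phi> a)"
      show "\<forall>x\<in>B. lft \<phi> (\<eta> h * D x) = \<eta> h * D (lft \<phi> x)"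
      proof
        fix x assume x: "x \<in> B"
        show "lft \<phi> (\<eta> h * D x) = \<eta> h * D (lft \<phi> x)"
          using l eq[OF \<theta>_C[OF x]] \<theta>_C[OF x] \<eta>_\<theta>[OF x] by simp
      qed
    next
      assume "\<forall>x\<in>B. lft \<phi> (\<eta> h * D x) = \<eta> h * D (lft \<phi> x)"
      then show "\<forall>a\<in>C. \<phi> (scale m k P h DV a) = scale m k P h DV (\<phi> a)" using eq \<eta>_B by blast
    qed
  qed
  then show ?thesis by (auto simp: Aut_der_def)
qed

lemma subgroup_Aut_h: "subgroup Aut_h G"
proof (rule G.subgroupI)
  have hD: "\<eta> h * D x \<in> B" if "x \<in> B" for x using that h by (intro B_mult D_B \<eta>_B)
  show "Aut_h \<subseteq> carrier G" by (auto simp: Aut_h_iff)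
  have "\<one>\<^bsub>G\<^esub> \<in> Aut_h" using hD by (simp add: Aut_h_iff lft_one)
  then show "Aut_h \<noteq> {}" by blast
  show "\<phi> \<otimes>\<^bsub>G\<^esub> \<psi> \<in> Aut_h" if "\<phi> \<in> Aut_h" "\<psi> \<in> Aut_h" for \<phi> \<psi>
    using that hD by (simp add: Aut_h_iff lft_mult lft_B)
  show "inv\<^bsub>G\<^esub> \<phi> \<in> Aut_h" if "\<phi> \<in> Aut_h" for \<phi>
  proof -
    have \<phi>: "\<phi> \<in> carrier G" "\<And>x. x \<in> B \<Longrightarrow> lft \<phi> (\<eta> h * D x) = \<eta> h * D (lft \<phi> x)"
      using that by (auto simp: Aut_h_iff)
    have "lft (inv\<^bsub>G\<^esub> \<phi>) (\<eta> h * D x) = \<eta> h * D (lft (inv\<^bsub>G\<^esub> \<phi>) x)" if x: "x \<in> B" for x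
    proof -
      have iB: "lft (inv\<^bsub>G\<^esub> \<phi>) x \<in> B" using lft_B[OF G.inv_closed[OF \<phi>(1)] x] .
      have "\<eta> h * D x = lft \<phi> (\<eta> h * D (lft (inv\<^bsub>G\<^esub> \<phi>) x))"
        using \<phi>(2)[OF iB] lft_inv(1)[OF \<phi>(1) x] by simp
      then show ?thesis using lft_inv(2)[OF \<phi>(1) hD[OF iB]] by simp
    qed
    then show ?thesis using \<phi>(1) by (simp add: Aut_h_iff)
  qed
qed

text \<open>On \<open>B\<close> an element of U is a translation of z by w, and \<delta> is c times
  d/dz with c constant in z; translations fix c and commute with d/dz.\<close>

lemma U_subset_Aut_h: "U \<subseteq> Aut_h"
proof
  fix \<phi> assume "\<phi> \<in> U"
  then obtain f where f: "f \<in> C" "DV f = \<zero>\<^bsub>A\<^esub>" "\<phi> = Exp m k P (scale m k P f DV)"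
    by (auto simp: big_unipotent_def Let_def)
  then have fR: "\<eta> f \<in> R" using DV_eq_0_iff by blast
  then obtain w where w: "\<eta> f * Y = [:w:]" using R_Y_const by blast
  note E = Exp_in_G[OF f(1) fR w, folded f(3)]
  obtain c where c: "\<eta> h * Y = [:c:]" using R_Y_const[OF h(2)] by blast
  have hD: "\<eta> h * D x = smult c (pderiv x)" for x
    using c by (simp add: D_def mult.assoc[symmetric])
  have "lft \<phi> (\<eta> h * D x) = \<eta> h * D (lft \<phi> x)" if x: "x \<in> B" for x
  proof -
    have "\<eta> h * D x \<in> B" using x h by (intro B_mult D_B \<eta>_B)
    then have "lft \<phi> (\<eta> h * D x) = pcompose (\<eta> h * D x) [:w, 1:]" by (rule E(2))
    then show ?thesis by (simp add: E(2)[OF x] hD pcompose_smult pderiv_pcompose pderiv_pCons)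
  qed
  then show "\<phi> \<in> Aut_h" using E(1) by (simp add: Aut_h_iff)
qed

end

end

theorem corollary6p2:
  fixes m d :: nat
    and k :: "nat \<Rightarrow> nat"
    and s :: "nat \<Rightarrow> 'k::{alg_closed_field, field_char_0} mpoly"
    and P :: "'k mpoly"
    and h :: "'k mpoly set"
    and \<delta> :: "'k mpoly set \<Rightarrow> 'k mpoly set"
    and G\<delta> U :: "('k mpoly set \<Rightarrow> 'k mpoly set) set"
  assumes "m \<ge> 2" and "d \<ge> 2"
    and "\<And>i. i \<in> {2..m} \<Longrightarrow> k i \<ge> 2"
    and "\<And>j. j < d \<Longrightarrow> s j \<in> polys_in {2..m}"
    and "s (d - 1) = 0"
    and "P = Var (m+1) ^ d + (\<Sum>j<d. s j * Var (m+1) ^ j)"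
    and "h \<in> cls m k P ` polys_in {2..m}"
    and "\<delta> = scale m k P h (canonical_lnd m k P)"
    and "G\<delta> = canonical_group m k P \<inter> carrier (Aut_der m k P \<delta>)"
    and "U = big_unipotent m k P"
  shows "subgroup G\<delta> (Aut_der m k P \<delta>) \<and>
    U \<lhd> Aut_der m k P \<delta> \<and>
    (let SD = semidirect ((AutV m k P)\<lparr>carrier := U\<rparr>) ((AutV m k P)\<lparr>carrier := G\<delta>\<rparr>)
                (conj_act (AutV m k P))
     in (\<lambda>(u, g). u \<otimes>\<^bsub>AutV m k P\<^esub> g) \<in> iso SD (Aut_der m k P \<delta>) \<and>
        Aut_der m k P \<delta> \<cong> SD)"
proof -
  interpret danielewski m d k s P
    by standard (use assms in auto)
  obtain p where p: "p \<in> polys_in {2..m}" "h = cls m k P p" using assms(7) by blast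
  have pvs: "p \<in> polys_in vs" by (rule polys_in_mono[OF p(1)]) auto
  have h: "h \<in> carrier (coord_ring m k P)" "\<eta> h \<in> R"
    using p(1) cl_in[OF pvs] \<eta>_cl[OF pvs] by (simp_all add: p(2) R_def)
  \<comment> \<open>Brings the group into the shape of a restricted carrier, in which
    \<open>semidirect_complement\<close> states its conclusions.\<close>
  have Aut: "Aut_der m k P \<delta> = (AutV m k P)\<lparr>carrier := carrier (Aut_der m k P \<delta>)\<rparr>"
    by (simp add: Aut_der_def)
  note sd = semidirect_complement[OF group_AutV subgroup_Aut_h[OF h] normal_U U_subset_Aut_h[OF h]
      subgroup_canonical_group U_Int_canonical_group]
  have split: "\<exists>n\<in>big_unipotent m k P. \<exists>c\<in>canonical_group m k P. x = n \<otimes>\<^bsub>AutV m k P\<^esub> c"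
    if "x \<in> carrier (Aut_der m k P (scale m k P h (canonical_lnd m k P)))" for x
    using that Aut_h_iff[OF h] by (intro AutV_decomp) blast
  show ?thesis
    using sd[OF split] unfolding Let_def assms(8-10) Aut[unfolded assms(8), symmetric] by simp
qed

end
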